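(* Let $K$ be a commutative ring, $\delta,\delta_e,\kappa\in K$ with $\kappa$ invertible, and $m\ge1$. The category of left $b'_{2m-2}(\delta,\delta_e,\kappa)$-modules is fully embedded in the category of left $b'_{2m}(\delta,\kappa,\delta_e)$-modules; that is, there is a fully faithful functor from the former category to the latter.
   Context: A Temperley--Lieb (TL) diagram on $n$ vertices is a non-crossing pairing of vertices $1,\dots,n$ (left to right on the northern edge of a rectangle) and $1',\dots,n'$ (left to right on the southern edge), realised by disjoint lines inside the rectangle, up to isotopy. $J^B_{2m}$ is the set of TL diagrams on $2m$ vertices invariant under reflection in the central vertical line. Diagrams $d_1,d_2$ are concatenated by stacking (a symmetric picture of) $d_1$ above $d_2$. Regions of the picture are two-coloured black/white, regions on two sides of a line having different colours, with the region touching the northern interval between vertices $m$ and $m+1$ white (for $m=0$: the northern edge touches a white region; $J^B_0$ consists of the empty diagram). For $\alpha,\beta,\gamma\in K$, $b'_{2m}(\alpha,\beta,\gamma)$ is the free $K$-module on $J^B_{2m}$ with product $d_1d_2=\alpha^{l_0}\beta^{l_w}\gamma^{l_b}c$, where $c$ is the diagram obtained from the concatenation by deleting closed loops, $l_0$ is the number of mirror pairs of closed loops not crossing the centre line, and $l_w$ (resp. $l_b$) is the number of closed loops crossing the centre line whose immediate interior is white (resp. black). *)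

theory Defs
  imports "HOL-Algebra.Module" "HOL-Library.Disjoint_Sets" "HOL-Library.FuncSet"
begin

section \<open>Categories and fully faithful functors\<close>

record ('o, 'a) category_data =
  Obj :: "'o set"
  Hom :: "'o \<Rightarrow> 'o \<Rightarrow> 'a set"
  Ident :: "'o \<Rightarrow> 'a"
  Comp :: "'o \<Rightarrow> 'o \<Rightarrow> 'o \<Rightarrow> 'a \<Rightarrow> 'a \<Rightarrow> 'a"

text \<open>\<open>Comp C X Y Z g f\<close> is the composite of \<open>f : X \<rightarrow> Y\<close> and \<open>g : Y \<rightarrow> Z\<close>. Hom-sets of
  different pairs of objects need not be disjoint; morphisms are always taken relative
  to given source and target.\<close>

locale is_category =
  fixes C :: "('o, 'a) category_data"
  assumes ident_in_hom: "X \<in> Obj C \<Longrightarrow> Ident C X \<in> Hom C X X"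
    and comp_in_hom: "\<lbrakk>X \<in> Obj C; Y \<in> Obj C; Z \<in> Obj C; f \<in> Hom C X Y; g \<in> Hom C Y Z\<rbrakk>
      \<Longrightarrow> Comp C X Y Z g f \<in> Hom C X Z"
    and comp_ident: "\<lbrakk>X \<in> Obj C; Y \<in> Obj C; f \<in> Hom C X Y\<rbrakk> \<Longrightarrow> Comp C X X Y f (Ident C X) = f"
    and ident_comp: "\<lbrakk>X \<in> Obj C; Y \<in> Obj C; f \<in> Hom C X Y\<rbrakk> \<Longrightarrow> Comp C X Y Y (Ident C Y) f = f"
    and comp_assoc: "\<lbrakk>X \<in> Obj C; Y \<in> Obj C; Z \<in> Obj C; W \<in> Obj C;
        f \<in> Hom C X Y; g \<in> Hom C Y Z; h \<in> Hom C Z W\<rbrakk>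
      \<Longrightarrow> Comp C X Z W h (Comp C X Y Z g f) = Comp C X Y W (Comp C Y Z W h g) f"

record ('o, 'a, 'p, 'b) functor_data =
  on_obj :: "'o \<Rightarrow> 'p"
  on_hom :: "'o \<Rightarrow> 'o \<Rightarrow> 'a \<Rightarrow> 'b"

locale is_functor = C: is_category C + D: is_category D
  for C :: "('o, 'a) category_data" and D :: "('p, 'b) category_data" +
  fixes F :: "('o, 'a, 'p, 'b) functor_data"
  assumes on_obj: "X \<in> Obj C \<Longrightarrow> on_obj F X \<in> Obj D"
    and on_hom: "\<lbrakk>X \<in> Obj C; Y \<in> Obj C; f \<in> Hom C X Y\<rbrakk>
      \<Longrightarrow> on_hom F X Y f \<in> Hom D (on_obj F X) (on_obj F Y)"
    and on_ident: "X \<in> Obj C \<Longrightarrow> on_hom F X X (Ident C X) = Ident D (on_obj F X)"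
    and on_comp: "\<lbrakk>X \<in> Obj C; Y \<in> Obj C; Z \<in> Obj C; f \<in> Hom C X Y; g \<in> Hom C Y Z\<rbrakk>
      \<Longrightarrow> on_hom F X Z (Comp C X Y Z g f) =
        Comp D (on_obj F X) (on_obj F Y) (on_obj F Z) (on_hom F Y Z g) (on_hom F X Y f)"

definition faithful :: "('o, 'a) category_data \<Rightarrow> ('o, 'a, 'p, 'b) functor_data \<Rightarrow> bool" where
  "faithful C F \<longleftrightarrow> (\<forall>X \<in> Obj C. \<forall>Y \<in> Obj C. inj_on (on_hom F X Y) (Hom C X Y))"

definition full :: "('o, 'a) category_data \<Rightarrow> ('p, 'b) category_data
    \<Rightarrow> ('o, 'a, 'p, 'b) functor_data \<Rightarrow> bool" where
  "full C D F \<longleftrightarrow> (\<forall>X \<in> Obj C. \<forall>Y \<in> Obj C.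
      on_hom F X Y ` Hom C X Y = Hom D (on_obj F X) (on_obj F Y))"

definition fully_faithful_functor :: "('o, 'a) category_data \<Rightarrow> ('p, 'b) category_data
    \<Rightarrow> ('o, 'a, 'p, 'b) functor_data \<Rightarrow> bool" where
  "fully_faithful_functor C D F \<longleftrightarrow> is_functor C D F \<and> full C D F \<and> faithful C F"

section \<open>Left modules over a not necessarily commutative ring\<close>

text \<open>As in the library locale \<open>module\<close>, but without commutativity of the scalars. The
  library record \<open>module\<close> extends \<open>ring\<close>, so it has fields \<open>mult\<close> and \<open>one\<close>; these play
  no role.\<close>

locale left_module = R?: ring R + M?: abelian_group M
  for R (structure) and M (structure) +
  assumes smult_closed: "\<lbrakk>a \<in> carrier R; x \<in> carrier M\<rbrakk> \<Longrightarrow> a \<odot>\<^bsub>M\<^esub> x \<in> carrier M"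
    and smult_l_distr: "\<lbrakk>a \<in> carrier R; b \<in> carrier R; x \<in> carrier M\<rbrakk>
      \<Longrightarrow> (a \<oplus> b) \<odot>\<^bsub>M\<^esub> x = a \<odot>\<^bsub>M\<^esub> x \<oplus>\<^bsub>M\<^esub> b \<odot>\<^bsub>M\<^esub> x"
    and smult_r_distr: "\<lbrakk>a \<in> carrier R; x \<in> carrier M; y \<in> carrier M\<rbrakk>
      \<Longrightarrow> a \<odot>\<^bsub>M\<^esub> (x \<oplus>\<^bsub>M\<^esub> y) = a \<odot>\<^bsub>M\<^esub> x \<oplus>\<^bsub>M\<^esub> a \<odot>\<^bsub>M\<^esub> y"
    and smult_assoc: "\<lbrakk>a \<in> carrier R; b \<in> carrier R; x \<in> carrier M\<rbrakk>
      \<Longrightarrow> (a \<otimes> b) \<odot>\<^bsub>M\<^esub> x = a \<odot>\<^bsub>M\<^esub> (b \<odot>\<^bsub>M\<^esub> x)"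
    and smult_one: "x \<in> carrier M \<Longrightarrow> \<one> \<odot>\<^bsub>M\<^esub> x = x"

definition left_module_hom :: "'a ring \<Rightarrow> ('a, 'u) module \<Rightarrow> ('a, 'u) module \<Rightarrow> ('u \<Rightarrow> 'u) set" where
  "left_module_hom R M N = {f \<in> carrier M \<rightarrow>\<^sub>E carrier N.
      (\<forall>x \<in> carrier M. \<forall>y \<in> carrier M. f (x \<oplus>\<^bsub>M\<^esub> y) = f x \<oplus>\<^bsub>N\<^esub> f y) \<and>
      (\<forall>a \<in> carrier R. \<forall>x \<in> carrier M. f (a \<odot>\<^bsub>M\<^esub> x) = a \<odot>\<^bsub>N\<^esub> f x)}"

text \<open>The category of all left \<open>R\<close>-modules whose elements are taken from the universe \<open>'u\<close>.\<close>

definition left_module_category :: "'a ring \<Rightarrow> (('a, 'u) module, 'u \<Rightarrow> 'u) category_data" where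
  "left_module_category R = \<lparr>
     Obj = {M. left_module R M},
     Hom = left_module_hom R,
     Ident = (\<lambda>M. \<lambda>x \<in> carrier M. x),
     Comp = (\<lambda>L M N g f. compose (carrier L) g f)\<rparr>"

section \<open>Temperley--Lieb diagrams\<close>

text \<open>\<open>North i\<close> is the vertex \<open>i\<close> and \<open>South i\<close> is the vertex \<open>i'\<close>. A diagram, being
  considered up to isotopy, is the set of its lines, and a line is the set of its two ends.\<close>

datatype vertex = North nat | South nat

type_synonym diagram = "vertex set set"

definition vertices :: "nat \<Rightarrow> vertex set" where
  "vertices n = North ` {1..n} \<union> South ` {1..n}"

text \<open>Positions \<open>1, \<dots>, 2n\<close> along the boundary of the rectangle, clockwise from the north-west
  corner.\<close>

fun boundary_pos :: "nat \<Rightarrow> vertex \<Rightarrow> nat" where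
  "boundary_pos n (North i) = i"
| "boundary_pos n (South i) = 2 * n + 1 - i"

definition crossing :: "nat \<Rightarrow> vertex set \<Rightarrow> vertex set \<Rightarrow> bool" where
  "crossing n k l \<longleftrightarrow> (\<exists>a \<in> k. \<exists>b \<in> k. \<exists>c \<in> l. \<exists>d \<in> l.
      boundary_pos n a < boundary_pos n c \<and> boundary_pos n c < boundary_pos n b \<and>
      boundary_pos n b < boundary_pos n d)"

definition TL_diagrams :: "nat \<Rightarrow> diagram set" where
  "TL_diagrams n = {d. partition_on (vertices n) d \<and> (\<forall>l \<in> d. card l = 2) \<and>
      (\<forall>k \<in> d. \<forall>l \<in> d. \<not> crossing n k l)}"

fun reflect_vertex :: "nat \<Rightarrow> vertex \<Rightarrow> vertex" where
  "reflect_vertex n (North i) = North (n + 1 - i)"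
| "reflect_vertex n (South i) = South (n + 1 - i)"

text \<open>The set written $J^B_{2m}$.\<close>

definition JB :: "nat \<Rightarrow> diagram set" where
  "JB m = {d \<in> TL_diagrams (2 * m). (\<lambda>l. reflect_vertex (2 * m) ` l) ` d = d}"

definition id_diagram :: "nat \<Rightarrow> diagram" where
  "id_diagram n = (\<lambda>i. {North i, South i}) ` {1..n}"

section \<open>Concatenation\<close>

text \<open>In the concatenation of \<open>d\<^sub>1\<close> above \<open>d\<^sub>2\<close>, the \<open>i\<close>-th point of the northern edge, of the
  line where the two diagrams are glued, and of the southern edge is \<open>(0, i)\<close>, \<open>(1, i)\<close> and
  \<open>(2, i)\<close>, respectively.\<close>

type_synonym point = "nat \<times> nat"

fun upper :: "vertex \<Rightarrow> point" where
  "upper (North i) = (0, i)"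
| "upper (South i) = (1, i)"

fun lower :: "vertex \<Rightarrow> point" where
  "lower (North i) = (1, i)"
| "lower (South i) = (2, i)"

fun outer :: "vertex \<Rightarrow> point" where
  "outer (North i) = (0, i)"
| "outer (South i) = (2, i)"

definition pieces :: "diagram \<Rightarrow> diagram \<Rightarrow> point set set" where
  "pieces d1 d2 = (\<lambda>l. upper ` l) ` d1 \<union> (\<lambda>l. lower ` l) ` d2"

definition connected_points :: "diagram \<Rightarrow> diagram \<Rightarrow> (point \<times> point) set" where
  "connected_points d1 d2 = {(p, q). \<exists>l \<in> pieces d1 d2. p \<in> l \<and> q \<in> l}\<^sup>*"

text \<open>The concatenation with its closed loops deleted.\<close>

definition concat_diagram :: "nat \<Rightarrow> diagram \<Rightarrow> diagram \<Rightarrow> diagram" where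
  "concat_diagram n d1 d2 = {{u, v} | u v. u \<in> vertices n \<and> v \<in> vertices n \<and> u \<noteq> v \<and>
      (outer u, outer v) \<in> connected_points d1 d2}"

text \<open>A closed loop is identified with the set of (indices of) points where it meets the
  gluing line.\<close>

definition loops :: "nat \<Rightarrow> diagram \<Rightarrow> diagram \<Rightarrow> nat set set" where
  "loops n d1 d2 = {L. L \<noteq> {} \<and> L \<subseteq> {1..n} \<and>
      (\<forall>i \<in> L. connected_points d1 d2 `` {(1, i)} = Pair 1 ` L)}"

section \<open>Colours of regions and of loops\<close>

text \<open>Gap \<open>k\<close> of the boundary of a rectangle with \<open>n\<close> vertices north and south lies between the
  boundary positions \<open>k\<close> and \<open>k + 1\<close>; the gaps \<open>0\<close> and \<open>2n\<close> are both on the western edge.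
  A line separates two gaps if exactly one of its ends lies between them.\<close>

definition separates :: "nat \<Rightarrow> vertex set \<Rightarrow> nat \<Rightarrow> nat \<Rightarrow> bool" where
  "separates n l j k \<longleftrightarrow> card {v \<in> l. min j k < boundary_pos n v \<and> boundary_pos n v \<le> max j k} = 1"

text \<open>\<open>south_white m d g\<close>: the region of \<open>d\<close>, a diagram on \<open>2m\<close> vertices, touching the southern
  edge between the vertices \<open>g'\<close> and \<open>(g + 1)'\<close> is white. That is gap \<open>4m - g\<close> of the
  boundary, and the colour changes at each line separating it from the white region at the
  northern gap \<open>m\<close>. In the concatenation of \<open>d\<^sub>1\<close> above \<open>d\<^sub>2\<close> the northern edge is that of
  \<open>d\<^sub>1\<close>, so \<open>south_white m d\<^sub>1 g\<close> is the colour of the concatenation along the gluing line.\<close>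

definition south_white :: "nat \<Rightarrow> diagram \<Rightarrow> nat \<Rightarrow> bool" where
  "south_white m d g \<longleftrightarrow> even (card {l \<in> d. separates (2 * m) l m (4 * m - g)})"

definition crosses_centre :: "nat \<Rightarrow> nat set \<Rightarrow> bool" where
  "crosses_centre m L \<longleftrightarrow> (\<exists>i \<in> L. i \<le> m) \<and> (\<exists>i \<in> L. m < i)"

text \<open>The part of the gluing line between the points \<open>g\<close> and \<open>g + 1\<close> lies inside the loop \<open>L\<close>
  iff one crosses \<open>L\<close> an odd number of times when reaching it from the west.\<close>

definition inside_loop :: "nat set \<Rightarrow> nat \<Rightarrow> bool" where
  "inside_loop L g \<longleftrightarrow> odd (card {i \<in> L. i \<le> g})"

definition interior_white :: "nat \<Rightarrow> diagram \<Rightarrow> nat set \<Rightarrow> bool" where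
  "interior_white m d1 L \<longleftrightarrow> (\<exists>i \<in> L. \<exists>g \<in> {i - 1, i}. inside_loop L g \<and> south_white m d1 g)"

definition mirror_pairs :: "nat \<Rightarrow> diagram \<Rightarrow> diagram \<Rightarrow> nat set set set" where
  "mirror_pairs m d1 d2 = (\<lambda>L. {L, (\<lambda>i. 2 * m + 1 - i) ` L}) `
      {L \<in> loops (2 * m) d1 d2. \<not> crosses_centre m L}"

definition white_loops :: "nat \<Rightarrow> diagram \<Rightarrow> diagram \<Rightarrow> nat set set" where
  "white_loops m d1 d2 = {L \<in> loops (2 * m) d1 d2. crosses_centre m L \<and> interior_white m d1 L}"

definition black_loops :: "nat \<Rightarrow> diagram \<Rightarrow> diagram \<Rightarrow> nat set set" where
  "black_loops m d1 d2 = {L \<in> loops (2 * m) d1 d2. crosses_centre m L \<and> \<not> interior_white m d1 L}"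

section \<open>The algebra\<close>

text \<open>\<open>b_prime K m \<alpha> \<beta> \<gamma>\<close> is $b'_{2m}(\alpha,\beta,\gamma)$. An element of the free module on the
  (finite) set \<open>JB m\<close> is given by its family of coefficients.\<close>

definition loop_weight :: "('k, 'z) ring_scheme \<Rightarrow> nat \<Rightarrow> 'k \<Rightarrow> 'k \<Rightarrow> 'k \<Rightarrow> diagram \<Rightarrow> diagram \<Rightarrow> 'k" where
  "loop_weight K m \<alpha> \<beta> \<gamma> d1 d2 =
     \<alpha> [^]\<^bsub>K\<^esub> card (mirror_pairs m d1 d2) \<otimes>\<^bsub>K\<^esub>
     \<beta> [^]\<^bsub>K\<^esub> card (white_loops m d1 d2) \<otimes>\<^bsub>K\<^esub>
     \<gamma> [^]\<^bsub>K\<^esub> card (black_loops m d1 d2)"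

definition b_prime :: "('k, 'z) ring_scheme \<Rightarrow> nat \<Rightarrow> 'k \<Rightarrow> 'k \<Rightarrow> 'k \<Rightarrow> (diagram \<Rightarrow> 'k) ring" where
  "b_prime K m \<alpha> \<beta> \<gamma> = \<lparr>
     carrier = JB m \<rightarrow>\<^sub>E carrier K,
     mult = (\<lambda>f g. \<lambda>c \<in> JB m.
       \<Oplus>\<^bsub>K\<^esub>p \<in> {p \<in> JB m \<times> JB m. concat_diagram (2 * m) (fst p) (snd p) = c}.
         f (fst p) \<otimes>\<^bsub>K\<^esub> g (snd p) \<otimes>\<^bsub>K\<^esub> loop_weight K m \<alpha> \<beta> \<gamma> (fst p) (snd p)),
     one = (\<lambda>d \<in> JB m. if d = id_diagram (2 * m) then \<one>\<^bsub>K\<^esub> else \<zero>\<^bsub>K\<^esub>),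
     zero = (\<lambda>d \<in> JB m. \<zero>\<^bsub>K\<^esub>),
     add = (\<lambda>f g. \<lambda>d \<in> JB m. f d \<oplus>\<^bsub>K\<^esub> g d)\<rparr>"

end

theory Submission
  imports Defs
begin

text \<open>Write \<open>A\<close> for $b'_{2m}(\delta,\kappa,\delta_e)$, \<open>B\<close> for $b'_{2m-2}(\delta,\delta_e,\kappa)$, and
  \<open>e\<close> for $\kappa^{-1}$ times the diagram with a cup and a cap at the two central vertices and
  vertical lines elsewhere. Inserting the central cup and cap into the diagrams of \<open>B\<close> swaps the
  two colours and creates one extra white central loop in every product. Hence inserting them
  and dividing by $\kappa$ identifies \<open>B\<close> with \<open>e A e\<close>, and coinduction \<open>M \<mapsto> Hom\<^sub>B (e A, M)\<close>
  is fully faithful, since \<open>M\<close> is recovered as its part fixed by \<open>e\<close>.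

  That \<open>A\<close> is a ring at all rests on one parity property of non-crossing diagrams (lemma
  \<open>left_of_line\<close>): it shows that concatenation preserves non-crossing, and that the colour
  inside a closed curve of a triple concatenation may be read off at either gluing line.\<close>

section \<open>Concatenation as a union of paths and cycles\<close>

section \<open>Dihedral orbits\<close>

text \<open>The functor has to produce modules whose elements have the same type \<open>'u\<close>,
  and this decides how it is built. An element of Hom(eA, M) is determined by its values on finitely
  many generators of eA over the corner, namely e times each diagram. The whole Hom set therefore
  injects into a finite power of \<open>'u\<close> and, \<open>'u\<close> being infinite, back into
  \<open>'u\<close>, whatever the size of K. For the ring structure the obstacle is associativity of
  the weights. The two bracketings of a triple product remove loops at different gluing lines, where
  the same curve appears as different sets of points and gets its colour from different diagrams.
  Both are compared with the closed curves of the stack of all three diagrams, a curve being the set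
  of its points on the levels of the stack, and inside and outside being told apart by the parity of
  the number of its points to the left. The scalar in e comes from the one loop of the square of the
  cup-cap diagram: it is white, and \<kappa> weighs the white loops of the larger algebra.\<close>

lemma involution_funpow_cancel:
  fixes s t :: "'p \<Rightarrow> 'p"
  assumes s: "\<And>x. s (s x) = x" and t: "\<And>x. t (t x) = x"
  shows "((t \<circ> s) ^^ k) (t (((t \<circ> s) ^^ k) x)) = t x"
proof (induction k arbitrary: x)
  case (Suc k)
  \<comment> \<open>Conjugation by the reflection \<open>t\<close> inverts the rotation r = t s. The
    inverse is avoided by writing this as r^k t r^k = t.\<close>
  have "((t \<circ> s) ^^ Suc k) (t (((t \<circ> s) ^^ Suc k) x))
      = (t \<circ> s) (((t \<circ> s) ^^ k) (t (((t \<circ> s) ^^ k) ((t \<circ> s) x))))"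
    by (simp add: funpow_swap1)
  also have "\<dots> = t x" by (simp add: Suc.IH s t)
  finally show ?case .
qed simp

text \<open>The orbit of \<open>u\<close> is a cycle of \<open>t \<circ> s\<close> on which \<open>s\<close> and \<open>t\<close> act as reflections.\<close>

lemma dihedral_orbit_ends_aux:
  fixes s t :: "'p \<Rightarrow> 'p"
  assumes s: "\<And>x. s (s x) = x" and t: "\<And>x. t (t x) = x"
    and fin: "finite X" and uX: "u \<in> X" and clos: "s ` X \<subseteq> X" "t ` X \<subseteq> X"
    and nofix: "\<And>x. x \<in> X \<Longrightarrow> \<not> (s x = x \<and> t x = x)"
    and u: "t u = u"
    and C: "C = ({(x, s x) |x. True} \<union> {(x, t x) |x. True})\<^sup>* `` {u}"
  shows "card {x \<in> C. s x = x \<or> t x = x} = 2"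
proof -
  define r where "r = t \<circ> s"
  have rX: "(r ^^ k) u \<in> X" for k
    by (induction k) (use uX clos in \<open>auto simp: r_def\<close>)
  have inj: "inj r" by (auto simp: r_def inj_on_def) (metis s t)
  then have injk: "inj (r ^^ k)" for k by (rule inj_fn)
  \<comment> \<open>Pigeonhole in the finite invariant set \<open>X\<close>. Since \<open>r\<close>
    is injective, a repetition can be pulled back to \<open>u\<close> itself, so \<open>u\<close> is
    periodic; \<open>N\<close> is its period.\<close>
  have "\<not> inj (\<lambda>k. (r ^^ k) u)"
    using fin rX by (meson finite_subset image_subsetI infinite_UNIV_nat finite_imageD)
  then obtain i j where "i < j" "(r ^^ i) u = (r ^^ j) u"
    by (auto simp: inj_on_def) (metis linorder_neqE_nat)
  then have "(r ^^ i) ((r ^^ (j - i)) u) = (r ^^ i) u"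
    by (metis add_diff_inverse_nat comp_apply funpow_add not_less_iff_gr_or_eq)
  then have "0 < j - i \<and> (r ^^ (j - i)) u = u" using injk[of i] \<open>i < j\<close> by (auto dest: injD)
  then obtain N where N: "0 < N" "(r ^^ N) u = u" and least: "\<And>k. 0 < k \<Longrightarrow> k < N \<Longrightarrow> (r ^^ k) u \<noteq> u"
    using exists_least_iff[of "\<lambda>k. 0 < k \<and> (r ^^ k) u = u"] by blast
  have dist: "(r ^^ i) u \<noteq> (r ^^ j) u" if "i < j" "j < N" for i j
  proof
    assume "(r ^^ i) u = (r ^^ j) u"
    then have "(r ^^ i) ((r ^^ (j - i)) u) = (r ^^ i) u"
      using that by (metis add_diff_inverse_nat comp_apply funpow_add not_less_iff_gr_or_eq)
    then have "(r ^^ (j - i)) u = u" using injk[of i] by (auto dest: injD)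
    then show False using least[of "j - i"] that by auto
  qed
  \<comment> \<open>Number the cycle by 0, ..., N - 1. Then \<open>t\<close> acts as k to N - k
    modulo N and \<open>s\<close>, in \<open>sr\<close> below, as k to N - 1 - k.\<close>
  have tr: "t ((r ^^ k) u) = (r ^^ (N - k)) u" if "k \<le> N" for k
  proof -
    have "(r ^^ k) (t ((r ^^ k) u)) = u"
      using involution_funpow_cancel[OF s t, of k u] u by (simp add: r_def)
    moreover have "(r ^^ k) ((r ^^ (N - k)) u) = u"
      using N that by (metis comp_apply funpow_add le_add_diff_inverse)
    ultimately show ?thesis using injD[OF injk[of k]] by metis
  qed
  have sr: "s ((r ^^ k) u) = (r ^^ (N - 1 - k)) u" if "k < N" for k
  proof -
    have "s ((r ^^ k) u) = t ((r ^^ Suc k) u)" by (simp add: r_def t)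
    then show ?thesis using tr[of "Suc k"] that by simp
  qed
  have CN: "C = (\<lambda>k. (r ^^ k) u) ` {..<N}"
  proof
    let ?R = "{(x, s x) |x. True} \<union> {(x, t x) |x. True}"
    show "(\<lambda>k. (r ^^ k) u) ` {..<N} \<subseteq> C"
    proof -
      have "(u, (r ^^ k) u) \<in> ?R\<^sup>*" for k
      proof (induction k)
        case (Suc k)
        have "((r ^^ k) u, s ((r ^^ k) u)) \<in> ?R" "(s ((r ^^ k) u), t (s ((r ^^ k) u))) \<in> ?R" by auto
        then have "(u, t (s ((r ^^ k) u))) \<in> ?R\<^sup>*"
          using Suc rtrancl.rtrancl_into_rtrancl by meson
        then show ?case by (simp add: r_def o_def)
      qed simp
      then show ?thesis by (auto simp: C)
    qed
    have "x \<in> (\<lambda>k. (r ^^ k) u) ` {..<N}" if "(u, x) \<in> ?R\<^sup>*" for x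
      using that
    proof (induction rule: rtrancl_induct)
      case base
      show ?case using N by (auto intro!: image_eqI[of _ _ 0])
    next
      case (step y z)
      then obtain k where k: "k < N" "y = (r ^^ k) u" by auto
      show ?case
      proof (cases "z = s y")
        case True
        then show ?thesis using sr[OF k(1)] k by auto
      next
        case False
        then have "z = t y" using step by auto
        show ?thesis
        proof (cases "k = 0")
          case True
          then have "z = (r ^^ 0) u" using k u \<open>z = t y\<close> by simp
          then show ?thesis using N by blast
        next
          case False
          then show ?thesis using tr[of k] k N \<open>z = t y\<close> by auto
        qed
      qed
    qed
    then show "C \<subseteq> (\<lambda>k. (r ^^ k) u) ` {..<N}" by (auto simp: C)
  qed
  have eqN: "(r ^^ i) u = (r ^^ j) u \<longleftrightarrow> i = j" if "i < N" "j < N" for i j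
    using dist[of i j] dist[of j i] that by (cases i j rule: linorder_cases) auto
  have fixt: "t ((r ^^ k) u) = (r ^^ k) u \<longleftrightarrow> k = 0 \<or> 2 * k = N" if "k < N" for k
  proof (cases "k = 0")
    case False
    then show ?thesis using tr[of k] eqN[of "N - k" k] that by auto
  qed (simp add: u)
  have fixs: "s ((r ^^ k) u) = (r ^^ k) u \<longleftrightarrow> 2 * k + 1 = N" if "k < N" for k
    using sr[of k] eqN[of "N - 1 - k" k] that by auto
  \<comment> \<open>On a cycle of length 1 both reflections would fix \<open>u\<close>, against
    \<open>nofix\<close>. This is why the second end differs from the first.\<close>
  have "N \<noteq> 1"
  proof
    assume "N = 1"
    then have "s u = u" using fixs[of 0] by simp
    then show False using nofix[OF uX] u by simp
  qed
  then have N2: "N div 2 \<noteq> 0" "N div 2 < N" using N by auto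
  \<comment> \<open>The second end sits at N div 2; it is fixed by \<open>t\<close> for even N and
    by \<open>s\<close> for odd N.\<close>
  have "{x \<in> C. s x = x \<or> t x = x} = {(r ^^ 0) u, (r ^^ (N div 2)) u}"
  proof -
    have "{x \<in> C. s x = x \<or> t x = x} = (\<lambda>k. (r ^^ k) u) ` {k. k < N \<and> (k = 0 \<or> 2 * k = N \<or> 2 * k + 1 = N)}"
      unfolding CN using fixt fixs by blast
    also have "{k. k < N \<and> (k = 0 \<or> 2 * k = N \<or> 2 * k + 1 = N)} = {0, N div 2}"
      using N2 N by auto
    finally show ?thesis by simp
  qed
  moreover have "(r ^^ 0) u \<noteq> (r ^^ (N div 2)) u" using dist[of 0 "N div 2"] N2 by auto
  ultimately show ?thesis by simp
qed

lemma dihedral_orbit_ends: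
  fixes s t :: "'p \<Rightarrow> 'p"
  assumes "\<And>x. s (s x) = x" and "\<And>x. t (t x) = x"
    and "finite X" and "u \<in> X" and "s ` X \<subseteq> X" "t ` X \<subseteq> X"
    and "\<And>x. x \<in> X \<Longrightarrow> \<not> (s x = x \<and> t x = x)"
    and "s u = u \<or> t u = u"
    and "C = ({(x, s x) |x. True} \<union> {(x, t x) |x. True})\<^sup>* `` {u}"
  shows "card {x \<in> C. s x = x \<or> t x = x} = 2"
  using assms(8)
proof
  assume "t u = u"
  then show ?thesis using dihedral_orbit_ends_aux[of s t X u C] assms by blast
next
  assume "s u = u"
  then have "card {x \<in> C. t x = x \<or> s x = x} = 2"
  proof (intro dihedral_orbit_ends_aux[of t s X u C])
    show "C = ({(x, t x) |x. True} \<union> {(x, s x) |x. True})\<^sup>* `` {u}"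
      unfolding assms(9) by (simp only: Un_commute)
  qed (use assms in blast)+
  then show ?thesis by (simp add: disj_commute)
qed

section \<open>Diagrams placed between two levels\<close>

text \<open>\<open>upper\<close>, \<open>lower\<close> and \<open>outer\<close> are the cases (0,
  1), (1, 2) and (0, 2). Free levels allow the same diagram to be used in stacks of two and of three
  layers, and a concatenation to span several layers at once.\<close>

fun emb :: "nat \<Rightarrow> nat \<Rightarrow> vertex \<Rightarrow> point" where
  "emb a b (North i) = (a, i)"
| "emb a b (South i) = (b, i)"

text \<open>The two points may coincide, so the relation is reflexive at the ends of lines and empty
  elsewhere.\<close>

definition place :: "nat \<Rightarrow> nat \<Rightarrow> diagram \<Rightarrow> (point \<times> point) set" where
  "place a b d = {(p, q). \<exists>l \<in> d. p \<in> emb a b ` l \<and> q \<in> emb a b ` l}"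

definition matching :: "nat \<Rightarrow> diagram \<Rightarrow> bool" where
  "matching n d \<longleftrightarrow> partition_on (vertices n) d \<and> (\<forall>l \<in> d. card l = 2)"

text \<open>A walk along a concatenation alternates between lines of the two diagrams. Extended by
  the identity, the partner map is an involution of all points which fixes exactly those carrying no
  vertex of the diagram, and a component of the concatenation becomes an orbit of two
  involutions.\<close>

definition mate :: "nat \<Rightarrow> nat \<Rightarrow> diagram \<Rightarrow> point \<Rightarrow> point" where
  "mate a b d p = (if \<exists>q. q \<noteq> p \<and> (p, q) \<in> place a b d
     then THE q. q \<noteq> p \<and> (p, q) \<in> place a b d else p)"

lemma upper_eq_emb: "upper = emb 0 1" and lower_eq_emb: "lower = emb 1 2"
  and outer_eq_emb: "outer = emb 0 2"
proof -
  show "upper = emb 0 1" proof fix v show "upper v = emb 0 1 v" by (cases v) auto qed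
  show "lower = emb 1 2" proof fix v show "lower v = emb 1 2 v" by (cases v) auto qed
  show "outer = emb 0 2" proof fix v show "outer v = emb 0 2 v" by (cases v) auto qed
qed

lemma emb_inj: "a \<noteq> b \<Longrightarrow> emb a b u = emb a b v \<longleftrightarrow> u = v"
  by (cases u; cases v) auto

lemma connected_points_place: "connected_points d1 d2 = (place 0 1 d1 \<union> place 1 2 d2)\<^sup>*"
proof -
  have "{(p, q). \<exists>l \<in> pieces d1 d2. p \<in> l \<and> q \<in> l} = place 0 1 d1 \<union> place 1 2 d2"
    unfolding pieces_def place_def upper_eq_emb lower_eq_emb by blast
  then show ?thesis by (simp add: connected_points_def)
qed

lemma finite_vertices [simp]: "finite (vertices n)"
  by (simp add: vertices_def)

lemma sym_place: "sym (place a b d)"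
  by (auto simp: place_def sym_def)

lemma sym_rtrancl_place: "sym ((place a b d1 \<union> place b' c d2)\<^sup>*)"
  by (intro sym_rtrancl sym_Un sym_place)

lemma place_field:
  assumes "matching n d" "(p, q) \<in> place a b d"
  shows "p \<in> emb a b ` vertices n" "q \<in> emb a b ` vertices n"
  using assms partition_onD1[of "vertices n" d] by (auto simp: place_def matching_def)

lemma emb_vertices: "emb a b ` vertices n = {a, b} \<times> {1..n}"
proof -
  have "emb a b ` North ` {1..n} = {a} \<times> {1..n}" "emb a b ` South ` {1..n} = {b} \<times> {1..n}"
    by (auto simp: image_image)
  then show ?thesis by (auto simp: vertices_def image_Un)
qed

lemma matching_line:
  assumes "matching n d" "l \<in> d" "u \<in> l" "v \<in> l" "u \<noteq> v"
  shows "l = {u, v}"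
proof -
  have "card l = 2" using assms by (auto simp: matching_def)
  then obtain x y where "l = {x, y}" "x \<noteq> y" by (auto simp: card_2_iff)
  then show ?thesis using assms by auto
qed

lemma matching_unique:
  assumes "matching n d" "k \<in> d" "l \<in> d" "u \<in> k" "u \<in> l"
  shows "k = l"
  using assms partition_onD2[of "vertices n" d]
  by (auto simp: matching_def disjoint_def)

lemma matching_partner:
  assumes "matching n d" "u \<in> vertices n"
  obtains v where "v \<noteq> u" "{u, v} \<in> d" "v \<in> vertices n"
proof -
  have U: "vertices n = \<Union>d" using assms partition_onD1 by (auto simp: matching_def)
  then obtain l where l: "l \<in> d" "u \<in> l" using assms(2) by auto
  have "card l = 2" using assms l by (auto simp: matching_def)
  then obtain x y where xy: "l = {x, y}" "x \<noteq> y" by (auto simp: card_2_iff)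
  show ?thesis
  proof (cases "u = x")
    case True
    then show ?thesis using that[of y] xy l U by auto
  next
    case False
    then have "u = y" using xy l by auto
    then show ?thesis using that[of x] xy l U by (auto simp: insert_commute)
  qed
qed

lemma place_unique:
  assumes d: "matching n d" and ab: "a \<noteq> b"
    and "(p, q) \<in> place a b d" "(p, q') \<in> place a b d" "q \<noteq> p" "q' \<noteq> p"
  shows "q = q'"
proof -
  obtain l u v where l: "l \<in> d" "u \<in> l" "v \<in> l" "p = emb a b u" "q = emb a b v"
    using assms(3) by (auto simp: place_def)
  obtain l' u' v' where l': "l' \<in> d" "u' \<in> l'" "v' \<in> l'" "p = emb a b u'" "q' = emb a b v'"
    using assms(4) by (auto simp: place_def)
  have uu: "u' = u" using l l' emb_inj[OF ab] by auto
  then have ll: "l' = l" using matching_unique[OF d] l l' by blast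
  have "v \<noteq> u" "v' \<noteq> u" using assms(5,6) l l' uu by auto
  then have "l = {u, v}" "l = {u, v'}"
    using matching_line[OF d, of l] l l' ll by metis+
  then show ?thesis using \<open>v \<noteq> u\<close> \<open>v' \<noteq> u\<close> l l' by (auto simp: doubleton_eq_iff)
qed

lemma place_partner:
  assumes d: "matching n d" and ab: "a \<noteq> b" and p: "p \<in> emb a b ` vertices n"
  obtains q where "q \<noteq> p" "(p, q) \<in> place a b d"
proof -
  obtain u where u: "p = emb a b u" "u \<in> vertices n" using p by auto
  obtain v where v: "v \<noteq> u" "{u, v} \<in> d" using matching_partner[OF d u(2)] by metis
  have "emb a b v \<noteq> p" using u v emb_inj[OF ab] by auto
  moreover have "(p, emb a b v) \<in> place a b d"
    unfolding place_def using u v by (auto intro!: bexI[of _ "{u, v}"])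
  ultimately show ?thesis using that by blast
qed

lemma mate_eqI:
  assumes "matching n d" "a \<noteq> b" "(p, q) \<in> place a b d" "q \<noteq> p"
  shows "mate a b d p = q"
proof -
  have "(THE q. q \<noteq> p \<and> (p, q) \<in> place a b d) = q"
    using assms place_unique[OF assms(1,2)] by (intro the_equality) blast+
  moreover have "\<exists>q. q \<noteq> p \<and> (p, q) \<in> place a b d" using assms by blast
  ultimately show ?thesis by (simp only: mate_def if_True)
qed

lemma mate_mate:
  assumes "matching n d" "a \<noteq> b"
  shows "mate a b d (mate a b d p) = p"
proof (cases "\<exists>q. q \<noteq> p \<and> (p, q) \<in> place a b d")
  case True
  then obtain q where q: "q \<noteq> p" "(p, q) \<in> place a b d" by auto
  then have "(q, p) \<in> place a b d" using sym_place by (auto dest: symD)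
  then show ?thesis using mate_eqI[OF assms] q by metis
next
  case False
  then have "mate a b d p = p" by (simp only: mate_def if_False)
  then show ?thesis by simp
qed

lemma mate_fixed:
  assumes "matching n d" "a \<noteq> b"
  shows "mate a b d p = p \<longleftrightarrow> p \<notin> emb a b ` vertices n"
proof
  assume *: "mate a b d p = p"
  show "p \<notin> emb a b ` vertices n"
  proof
    assume "p \<in> emb a b ` vertices n"
    then obtain q where "q \<noteq> p" "(p, q) \<in> place a b d" using place_partner[OF assms] by blast
    then show False using * mate_eqI[OF assms] by blast
  qed
next
  assume "p \<notin> emb a b ` vertices n"
  then have "\<not> (\<exists>q. q \<noteq> p \<and> (p, q) \<in> place a b d)"
    using place_field[OF assms(1)] by blast
  then show "mate a b d p = p" by (simp only: mate_def if_False)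
qed

lemma mate_place:
  assumes "matching n d" "a \<noteq> b"
  shows "(p, mate a b d p) \<in> (place a b d)\<^sup>="
proof (cases "\<exists>q. q \<noteq> p \<and> (p, q) \<in> place a b d")
  case True
  then obtain q where q: "q \<noteq> p" "(p, q) \<in> place a b d" by blast
  then show ?thesis using mate_eqI[OF assms q(2,1)] by simp
next
  case False
  then have "mate a b d p = p" by (simp only: mate_def if_False)
  then show ?thesis by simp
qed

lemma place_eq_mate:
  assumes "matching n d" "a \<noteq> b"
  shows "(place a b d)\<^sup>= = {(x, mate a b d x) |x. True}\<^sup>="
proof -
  have *: "(p, q) \<in> place a b d \<longleftrightarrow> q = mate a b d p" if "p \<noteq> q" for p q
    using mate_place[OF assms, of p] mate_eqI[OF assms, of p q] that by auto
  then have **: "(p, q) \<in> (place a b d)\<^sup>= \<longleftrightarrow> (p, q) \<in> {(x, mate a b d x) |x. True}\<^sup>=" for p q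
    using *[of p q] by blast
  show ?thesis by (intro equalityI subrelI) (simp_all only: **)
qed

lemma rtrancl_Un_reflcl: "(A\<^sup>= \<union> B\<^sup>=)\<^sup>* = (A \<union> B)\<^sup>*"
proof -
  have "A\<^sup>= \<union> B\<^sup>= = (A \<union> B)\<^sup>=" by blast
  then show ?thesis by (simp only: rtrancl_reflcl)
qed

text \<open>The relation given by the lines and the graph of \<open>mate\<close> differ only on the
  diagonal, which the reflexive closure absorbs. In this form \<open>dihedral_orbit_ends\<close>
  applies.\<close>

lemma connected_points_mates:
  assumes "matching n d1" "matching n d2"
  shows "connected_points d1 d2 = ({(x, mate 0 1 d1 x) |x. True} \<union> {(x, mate 1 2 d2 x) |x. True})\<^sup>*"
proof -
  have "(place 0 1 d1 \<union> place 1 2 d2)\<^sup>* = ((place 0 1 d1)\<^sup>= \<union> (place 1 2 d2)\<^sup>=)\<^sup>*"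
    by (rule rtrancl_Un_reflcl[symmetric])
  also have "\<dots> = ({(x, mate 0 1 d1 x) |x. True}\<^sup>= \<union> {(x, mate 1 2 d2 x) |x. True}\<^sup>=)\<^sup>*"
    using place_eq_mate[OF assms(1), of 0 1] place_eq_mate[OF assms(2), of 1 2] by simp
  also have "\<dots> = ({(x, mate 0 1 d1 x) |x. True} \<union> {(x, mate 1 2 d2 x) |x. True})\<^sup>*"
    by (rule rtrancl_Un_reflcl)
  finally show ?thesis by (simp add: connected_points_place)
qed

lemma connected_points_refl [simp]: "(p, p) \<in> connected_points d1 d2"
  by (simp add: connected_points_def)

lemma connected_points_sym: "(p, q) \<in> connected_points d1 d2 \<Longrightarrow> (q, p) \<in> connected_points d1 d2"
  using sym_rtrancl_place unfolding connected_points_place by (meson symD)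

lemma connected_points_trans:
  "(p, q) \<in> connected_points d1 d2 \<Longrightarrow> (q, r) \<in> connected_points d1 d2 \<Longrightarrow> (p, r) \<in> connected_points d1 d2"
  by (simp add: connected_points_def)

lemma connected_points_levels:
  assumes "matching n d1" "matching n d2" "(p, q) \<in> connected_points d1 d2" "p \<noteq> q"
  shows "q \<in> {0, 1, 2} \<times> {1..n}" "p \<in> {0, 1, 2} \<times> {1..n}"
proof -
  have *: "q \<in> {0, 1, 2} \<times> {1..n}" if "(p, q) \<in> connected_points d1 d2" "p \<noteq> q" for p q
    using that(1)[unfolded connected_points_place] that(2)
  proof (cases rule: rtranclE)
    case (step y)
    then show ?thesis
      using place_field[OF assms(1), of y q 0 1] place_field[OF assms(2), of y q 1 2]
      unfolding emb_vertices by auto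
  qed simp
  show "q \<in> {0, 1, 2} \<times> {1..n}" "p \<in> {0, 1, 2} \<times> {1..n}"
    using *[OF assms(3,4)] *[OF connected_points_sym[OF assms(3)]] assms(4) by auto
qed

definition outer_class :: "nat \<Rightarrow> diagram \<Rightarrow> diagram \<Rightarrow> vertex \<Rightarrow> vertex set" where
  "outer_class n d1 d2 u = {w \<in> vertices n. (outer u, outer w) \<in> connected_points d1 d2}"

lemma outer_inj: "outer u = outer v \<longleftrightarrow> u = v"
  by (simp add: outer_eq_emb emb_inj)

text \<open>Within the three levels the upper involution fixes exactly level 2, the lower one
  exactly level 0, and a middle point is moved by both. So the ends of an orbit are its outer
  vertices.\<close>

lemma card_outer_class:
  assumes d: "matching n d1" "matching n d2" and u: "u \<in> vertices n"
  shows "card (outer_class n d1 d2 u) = 2"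
proof -
  let ?s = "mate 0 1 d1" and ?t = "mate 1 2 d2"
  define X :: "point set" where "X = {0, 1, 2} \<times> {1..n}"
  define C where "C = connected_points d1 d2 `` {outer u}"
  have outX: "outer w \<in> X" if "w \<in> vertices n" for w
    using that by (auto simp: X_def vertices_def)
  have s: "?s p = p \<longleftrightarrow> p \<notin> {0, 1} \<times> {1..n}" for p
    using mate_fixed[OF d(1), of 0 1 p] by (simp add: emb_vertices)
  have t: "?t p = p \<longleftrightarrow> p \<notin> {1, 2} \<times> {1..n}" for p
    using mate_fixed[OF d(2), of 1 2 p] by (simp add: emb_vertices)
  have CX: "C \<subseteq> X"
  proof
    fix p assume "p \<in> C"
    then have "(outer u, p) \<in> connected_points d1 d2" by (simp add: C_def)
    then show "p \<in> X"
      using connected_points_levels(1)[OF d, of "outer u" p] outX[OF u] X_def by metis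
  qed
  have ends: "{x \<in> C. ?s x = x \<or> ?t x = x} = outer ` outer_class n d1 d2 u"
  proof -
    have "x \<in> outer ` vertices n \<longleftrightarrow> ?s x = x \<or> ?t x = x" if "x \<in> X" for x
      using that unfolding s t outer_eq_emb emb_vertices X_def by auto
    then have "{x \<in> C. ?s x = x \<or> ?t x = x} = {x \<in> C. x \<in> outer ` vertices n}" using CX by auto
    also have "\<dots> = outer ` outer_class n d1 d2 u" by (auto simp: C_def outer_class_def)
    finally show ?thesis .
  qed
  have "card {x \<in> C. ?s x = x \<or> ?t x = x} = 2"
  proof (rule dihedral_orbit_ends)
    show "?s (?s x) = x" "?t (?t x) = x" for x
      using mate_mate[OF d(1), of 0 1] mate_mate[OF d(2), of 1 2] by auto
    show "finite X" by (simp add: X_def)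
    show "outer u \<in> X" by (rule outX[OF u])
    have "?s x \<in> X" if "x \<in> X" for x
    proof (cases "?s x = x")
      case False
      then have "(x, ?s x) \<in> place 0 1 d1" using mate_place[OF d(1), of 0 1 x] by simp
      then have "?s x \<in> emb 0 1 ` vertices n" by (rule place_field[OF d(1)])
      then show ?thesis unfolding emb_vertices X_def by auto
    qed (use that in simp)
    then show "?s ` X \<subseteq> X" by (rule image_subsetI)
    have "?t x \<in> X" if "x \<in> X" for x
    proof (cases "?t x = x")
      case False
      then have "(x, ?t x) \<in> place 1 2 d2" using mate_place[OF d(2), of 1 2 x] by simp
      then have "?t x \<in> emb 1 2 ` vertices n" by (rule place_field[OF d(2)])
      then show ?thesis unfolding emb_vertices X_def by auto
    qed (use that in simp)
    then show "?t ` X \<subseteq> X" by (rule image_subsetI)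
    show "\<not> (?s x = x \<and> ?t x = x)" if "x \<in> X" for x
      using that unfolding s t X_def by auto
    have "outer u \<in> {0, 2} \<times> {1..n}" using u emb_vertices[of 0 2 n] by (auto simp: outer_eq_emb)
    then show "?s (outer u) = outer u \<or> ?t (outer u) = outer u" unfolding s t by auto
    show "C = ({(x, ?s x) |x. True} \<union> {(x, ?t x) |x. True})\<^sup>* `` {outer u}"
      unfolding C_def connected_points_mates[OF d] ..
  qed
  then have "card (outer ` outer_class n d1 d2 u) = 2" using ends by simp
  then show ?thesis by (simp add: card_image inj_on_def outer_inj)
qed

text \<open>A line of the concatenation is contained in the class of each of its ends, and both have
  two elements.\<close>

lemma concat_diagram_eq:
  assumes d: "matching n d1" "matching n d2"
  shows "concat_diagram n d1 d2 = outer_class n d1 d2 ` vertices n"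
proof
  let ?E = "outer_class n d1 d2"
  show "concat_diagram n d1 d2 \<subseteq> ?E ` vertices n"
  proof
    fix l assume "l \<in> concat_diagram n d1 d2"
    then obtain u v where uv: "l = {u, v}" "u \<in> vertices n" "v \<in> vertices n" "u \<noteq> v"
      "(outer u, outer v) \<in> connected_points d1 d2" by (auto simp: concat_diagram_def)
    then have "l \<subseteq> ?E u" "card l = card (?E u)"
      using card_outer_class[OF d uv(2)] by (auto simp: outer_class_def)
    then have "l = ?E u" by (intro card_subset_eq) (auto simp: outer_class_def)
    then show "l \<in> ?E ` vertices n" using uv by auto
  qed
  show "?E ` vertices n \<subseteq> concat_diagram n d1 d2"
  proof
    fix l assume "l \<in> ?E ` vertices n"
    then obtain u where u: "u \<in> vertices n" "l = ?E u" by auto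
    have "card l = 2" "u \<in> l" using u card_outer_class[OF d] by (auto simp: outer_class_def)
    then obtain v where "l = {u, v}" "u \<noteq> v" by (auto simp: card_2_iff)
    then show "l \<in> concat_diagram n d1 d2"
      using u by (auto simp: concat_diagram_def outer_class_def)
  qed
qed

lemma matching_concat:
  assumes d: "matching n d1" "matching n d2"
  shows "matching n (concat_diagram n d1 d2)"
proof -
  let ?E = "outer_class n d1 d2"
  have "?E u = ?E v" if "x \<in> ?E u" "x \<in> ?E v" for u v x
    using that by (auto simp: outer_class_def) (meson connected_points_sym connected_points_trans)+
  then have "disjoint (?E ` vertices n)" by (auto simp: disjoint_def)
  moreover have "\<Union>(?E ` vertices n) = vertices n" by (auto simp: outer_class_def)
  moreover have "u \<in> ?E u" if "u \<in> vertices n" for u using that by (auto simp: outer_class_def)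
  ultimately have "partition_on (vertices n) (?E ` vertices n)"
    by (auto simp: partition_on_def) 
  then show ?thesis using card_outer_class[OF d] by (auto simp: matching_def concat_diagram_eq[OF d])
qed

section \<open>Planarity, mirror symmetry and colours expressed by parities\<close>

section \<open>Parity and planarity\<close>

text \<open>For a point off a closed curve \<open>C\<close>, the parity of this number tells on
  which side of \<open>C\<close> the point lies.\<close>

definition left_of :: "point set \<Rightarrow> point \<Rightarrow> nat" where
  "left_of C p = card {j. (fst p, j) \<in> C \<and> j < snd p}"

lemma North_vertices [simp]: "North i \<in> vertices n \<longleftrightarrow> 1 \<le> i \<and> i \<le> n"
  and South_vertices [simp]: "South i \<in> vertices n \<longleftrightarrow> 1 \<le> i \<and> i \<le> n"
  by (auto simp: vertices_def)

lemma matching_Union: "matching n d \<Longrightarrow> vertices n = \<Union>d"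
  using partition_onD1 by (auto simp: matching_def)

lemma TL_matching: "d \<in> TL_diagrams n \<Longrightarrow> matching n d"
  by (simp add: TL_diagrams_def matching_def)

lemma boundary_pos_inj: "inj_on (boundary_pos n) (vertices n)"
proof (rule inj_onI)
  fix x y assume "x \<in> vertices n" "y \<in> vertices n" "boundary_pos n x = boundary_pos n y"
  then show "x = y" by (cases x; cases y) auto
qed

lemma even_card_Union_lines:
  assumes d: "matching n d" and D: "D \<subseteq> d"
  shows "even (card (\<Union>D))"
proof -
  have U: "\<Union>D \<subseteq> vertices n" using d D partition_onD1 by (fastforce simp: matching_def)
  then have "finite (\<Union>D)" by (rule finite_subset) simp
  moreover from this have "finite D" by (rule finite_UnionD)
  ultimately have "2 * card D = card (\<Union>D)"
  proof (intro card_partition)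
    show "card c = 2" if "c \<in> D" for c using d D that by (auto simp: matching_def)
    show "c1 \<inter> c2 = {}" if "c1 \<in> D" "c2 \<in> D" "c1 \<noteq> c2" for c1 c2
      using matching_unique[OF d, of c1 c2] D that by blast
  qed
  then show ?thesis by (metis dvd_triv_left)
qed

lemma even_card_closed:
  assumes d: "matching n d" and S: "S \<subseteq> vertices n" and clos: "\<And>k. k \<in> d \<Longrightarrow> k \<inter> S \<noteq> {} \<Longrightarrow> k \<subseteq> S"
  shows "even (card S)"
proof -
  have "vertices n = \<Union>d" by (rule matching_Union[OF d])
  have "S = \<Union>{k \<in> d. k \<subseteq> S}"
  proof
    show "S \<subseteq> \<Union>{k \<in> d. k \<subseteq> S}"
    proof
      fix x assume x: "x \<in> S"
      then obtain k where "k \<in> d" "x \<in> k" using S \<open>vertices n = \<Union>d\<close> by blast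
      then show "x \<in> \<Union>{k \<in> d. k \<subseteq> S}" using clos[of k] x by blast
    qed
  qed blast
  then show ?thesis using even_card_Union_lines[OF d, of "{k \<in> d. k \<subseteq> S}"] by auto
qed

text \<open>A line of \<open>S\<close> with one end strictly between the ends of {u, v} has its
  other end there too, since otherwise the two lines would cross. So the points counted form a union
  of lines, two to each line.\<close>

lemma even_card_between:
  assumes d: "d \<in> TL_diagrams n" and l: "{u, v} \<in> d" and S: "S \<subseteq> vertices n"
    and clos: "\<And>k. k \<in> d \<Longrightarrow> k \<inter> S \<noteq> {} \<Longrightarrow> k \<subseteq> S" and u: "u \<notin> S"
  shows "even (card {w \<in> S. boundary_pos n u < boundary_pos n w \<and> boundary_pos n w < boundary_pos n v})"
    (is "even (card ?B)")
proof (rule even_card_closed[OF TL_matching[OF d]])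
  have mat: "matching n d" by (rule TL_matching[OF d])
  have nc: "\<And>k l. k \<in> d \<Longrightarrow> l \<in> d \<Longrightarrow> \<not> crossing n k l" using d by (auto simp: TL_diagrams_def)
  have Ud: "vertices n = \<Union>d" by (rule matching_Union[OF mat])
  have v: "v \<notin> S" using clos[OF l] u by blast
  show "?B \<subseteq> vertices n" using S by auto
  fix k assume k: "k \<in> d" "k \<inter> ?B \<noteq> {}"
  then obtain w where w: "w \<in> k" "w \<in> S" "boundary_pos n u < boundary_pos n w"
    "boundary_pos n w < boundary_pos n v" by auto
  have kS: "k \<subseteq> S" using clos[OF k(1)] w by blast
  show "k \<subseteq> ?B"
  proof
    fix x assume x: "x \<in> k"
    then have xS: "x \<in> S" using kS by auto
    have ne: "boundary_pos n x \<noteq> boundary_pos n u" "boundary_pos n x \<noteq> boundary_pos n v"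
      using inj_onD[OF boundary_pos_inj, of n x u] inj_onD[OF boundary_pos_inj, of n x v]
        xS u v S l Ud by blast+
    have "\<not> boundary_pos n x < boundary_pos n u"
    proof
      assume "boundary_pos n x < boundary_pos n u"
      then have "crossing n k {u, v}" unfolding crossing_def using x w by blast
      then show False using nc[OF k(1) l] by simp
    qed
    moreover have "\<not> boundary_pos n v < boundary_pos n x"
    proof
      assume "boundary_pos n v < boundary_pos n x"
      then have "crossing n {u, v} k" unfolding crossing_def using x w by blast
      then show False using nc[OF l k(1)] by simp
    qed
    ultimately show "x \<in> ?B" using ne xS by auto
  qed
qed

text \<open>The counts before the two ends differ by the points between the ends, an even
  number.\<close>

lemma even_card_before:
  assumes d: "d \<in> TL_diagrams n" and l: "{u, v} \<in> d" and S: "S \<subseteq> vertices n"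
    and clos: "\<And>k. k \<in> d \<Longrightarrow> k \<inter> S \<noteq> {} \<Longrightarrow> k \<subseteq> S" and u: "u \<notin> S"
  shows "even (card {w \<in> S. boundary_pos n w < boundary_pos n u}) \<longleftrightarrow>
    even (card {w \<in> S. boundary_pos n w < boundary_pos n v})"
proof -
  have mat: "matching n d" by (rule TL_matching[OF d])
  have Ud: "vertices n = \<Union>d" by (rule matching_Union[OF mat])
  have v: "v \<notin> S" using clos[OF l] u by blast
  have fin: "finite S" by (rule finite_subset[OF S]) simp
  have *: "even (card {w \<in> S. boundary_pos n w < boundary_pos n x}) \<longleftrightarrow>
      even (card {w \<in> S. boundary_pos n w < boundary_pos n y})"
    if xy: "{x, y} \<in> d" "x \<notin> S" "boundary_pos n x \<le> boundary_pos n y" for x y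
  proof -
    let ?B = "{w \<in> S. boundary_pos n x < boundary_pos n w \<and> boundary_pos n w < boundary_pos n y}"
    have "x \<in> vertices n" using xy(1) Ud by blast
    then have ne: "boundary_pos n w \<noteq> boundary_pos n x" if "w \<in> S" for w
      using inj_onD[OF boundary_pos_inj, of n w x] that xy(2) S by blast
    have "{w \<in> S. boundary_pos n w < boundary_pos n y}
        = {w \<in> S. boundary_pos n w < boundary_pos n x} \<union> ?B"
      using xy(3) ne by (force simp: not_less le_less)
    moreover have "{w \<in> S. boundary_pos n w < boundary_pos n x} \<inter> ?B = {}" by auto
    ultimately have "card {w \<in> S. boundary_pos n w < boundary_pos n y}
        = card {w \<in> S. boundary_pos n w < boundary_pos n x} + card ?B"
      using fin by (simp add: card_Un_disjoint)
    then show ?thesis using even_card_between[OF d xy(1) S clos xy(2)] by simp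
  qed
  have "{v, u} \<in> d" using l by (simp add: insert_commute)
  then show ?thesis using *[OF l u] *[of v u] v by (meson nat_le_linear)
qed

text \<open>Boundary positions increase from left to right in the north but decrease in the south.
  The points of \<open>S\<close> before a southern vertex are thus all of \<open>S\<close> except
  the southern ones to its left, and the complement keeps the parity because \<open>S\<close> is
  even.\<close>

lemma even_left_of:
  assumes ab: "a \<noteq> b" and C: "C \<subseteq> UNIV \<times> {1..n}" and S: "S = {w \<in> vertices n. emb a b w \<in> C}"
    and ev: "even (card S)" and w: "w \<in> vertices n" "w \<notin> S"
  shows "even (card {x \<in> S. boundary_pos n x < boundary_pos n w}) \<longleftrightarrow> even (left_of C (emb a b w))"
proof (cases w)
  case (North i)
  have "{x \<in> S. boundary_pos n x < boundary_pos n w} = North ` {j. (a, j) \<in> C \<and> j < i}"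
    (is "?l = ?r")
  proof
    show "?l \<subseteq> ?r"
    proof
      fix x assume "x \<in> ?l"
      then show "x \<in> ?r" using North w by (cases x) (auto simp: S)
    qed
    show "?r \<subseteq> ?l" using North w C by (auto simp: S)
  qed
  then show ?thesis using North by (simp add: left_of_def card_image inj_on_def)
next
  case (South i)
  have i: "1 \<le> i" "i \<le> n" using South w by (auto simp: vertices_def)
  let ?T = "South ` {j. (b, j) \<in> C \<and> j < i}"
  have T: "?T \<subseteq> S" using C by (auto simp: S)
  have "{x \<in> S. boundary_pos n x < boundary_pos n w} = S - ?T"
  proof (rule Set.set_eqI)
    fix x
    show "x \<in> {x \<in> S. boundary_pos n x < boundary_pos n w} \<longleftrightarrow> x \<in> S - ?T"
    proof (cases x)
      case (North j)
      then show ?thesis using South i by (auto simp: S)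
    next
      case X: (South j)
      have "j \<noteq> i" if "x \<in> S" using w that X South by auto
      then show ?thesis using X South i by (auto simp: S)
    qed
  qed
  moreover have "finite S" by (simp add: S)
  moreover have "card ?T = left_of C (emb a b w)" using South by (simp add: left_of_def card_image inj_on_def)
  ultimately have "card {x \<in> S. boundary_pos n x < boundary_pos n w} = card S - left_of C (emb a b w)"
    using card_Diff_subset[OF finite_subset[OF T] T] by simp
  moreover have "left_of C (emb a b w) \<le> card S"
    using card_mono[OF \<open>finite S\<close> T] \<open>card ?T = _\<close> by simp
  ultimately show ?thesis using ev by (simp add: even_diff_nat)
qed

text \<open>A curve that does not meet the line from \<open>p\<close> to \<open>q\<close> crosses the two levels an even number
  of times, in total, to the left of \<open>p\<close> and \<open>q\<close>. All topology of the plane needed here is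
  contained in this lemma.\<close>

lemma left_of_line:
  assumes d: "d \<in> TL_diagrams n" and ab: "a \<noteq> b" and C: "C \<subseteq> UNIV \<times> {1..n}"
    and clos: "\<And>p q. (p, q) \<in> place a b d \<Longrightarrow> p \<in> C \<Longrightarrow> q \<in> C"
    and pq: "(p, q) \<in> place a b d" "p \<notin> C"
  shows "even (left_of C p) \<longleftrightarrow> even (left_of C q)"
proof (cases "p = q")
  case False
  have mat: "matching n d" by (rule TL_matching[OF d])
  have Ud: "vertices n = \<Union>d" by (rule matching_Union[OF mat])
  obtain l u v where l: "l \<in> d" "u \<in> l" "v \<in> l" "p = emb a b u" "q = emb a b v"
    using pq by (auto simp: place_def)
  then have "u \<noteq> v" using False by auto
  then have luv: "l = {u, v}" using matching_line[OF mat] l by blast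
  define S where "S = {w \<in> vertices n. emb a b w \<in> C}"
  have S: "S \<subseteq> vertices n" by (auto simp: S_def)
  have closS: "k \<subseteq> S" if k: "k \<in> d" "k \<inter> S \<noteq> {}" for k
  proof
    fix x assume x: "x \<in> k"
    obtain w where w: "w \<in> k" "w \<in> S" using k by blast
    then have "(emb a b w, emb a b x) \<in> place a b d" using x k by (auto simp: place_def)
    then show "x \<in> S" using clos w x k Ud by (auto simp: S_def)
  qed
  have ev: "even (card S)" by (rule even_card_closed[OF mat S closS])
  have "(q, p) \<in> place a b d" using pq(1) sym_place by (meson symD)
  then have "q \<notin> C" using clos pq(2) by blast
  then have uv: "u \<in> vertices n" "v \<in> vertices n" "u \<notin> S" "v \<notin> S"
    using l pq Ud by (auto simp: S_def)
  show ?thesis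
    using even_card_before[OF d _ S closS uv(3), of v] l luv
      even_left_of[OF ab C S_def ev uv(1,3)] even_left_of[OF ab C S_def ev uv(2,4)] by simp
qed simp

text \<open>By symmetry of \<open>R\<close>, a path starting outside the closed set \<open>C\<close>
  never enters it, so the step hypothesis applies all along the path.\<close>

lemma left_of_rtrancl:
  assumes pq: "(p, q) \<in> R\<^sup>*" and p: "p \<notin> C" and sym: "sym R"
    and clos: "\<And>x y. (x, y) \<in> R \<Longrightarrow> x \<in> C \<Longrightarrow> y \<in> C"
    and step: "\<And>x y. (x, y) \<in> R \<Longrightarrow> x \<notin> C \<Longrightarrow> even (left_of C x) \<longleftrightarrow> even (left_of C y)"
  shows "even (left_of C p) \<longleftrightarrow> even (left_of C q)"
proof -
  have "q \<notin> C \<and> (even (left_of C p) \<longleftrightarrow> even (left_of C q))"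
    using pq
  proof (induction rule: rtrancl_induct)
    case (step y z)
    have "z \<notin> C" using clos[of z y] sym step by (meson symD)
    then show ?case using step assms(5) by blast
  qed (use p in simp)
  then show ?thesis by simp
qed

text \<open>If two lines crossed, the curve carrying the second would be disjoint from the curve
  \<open>C\<close> carrying the first, so \<open>left_of C\<close> would have the same parity at
  both its ends. Interlacing ends make these parities different.\<close>

lemma concat_TL:
  assumes d1: "d1 \<in> TL_diagrams n" and d2: "d2 \<in> TL_diagrams n"
  shows "concat_diagram n d1 d2 \<in> TL_diagrams n"
proof -
  note mat = TL_matching[OF d1] TL_matching[OF d2]
  have mc: "matching n (concat_diagram n d1 d2)" by (rule matching_concat[OF mat])
  have Uc: "vertices n = \<Union>(concat_diagram n d1 d2)"
    by (rule matching_Union[OF mc])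
  have "\<not> crossing n k l" if k: "k \<in> concat_diagram n d1 d2" and l: "l \<in> concat_diagram n d1 d2" for k l
  proof
    assume "crossing n k l"
    then obtain a b c d where abcd: "a \<in> k" "b \<in> k" "c \<in> l" "d \<in> l"
      "boundary_pos n a < boundary_pos n c" "boundary_pos n c < boundary_pos n b"
      "boundary_pos n b < boundary_pos n d" unfolding crossing_def by blast
    have "a \<noteq> b" using abcd(5,6) by auto
    then have kab: "k = {a, b}" by (rule matching_line[OF mc k abcd(1,2)])
    have V: "a \<in> vertices n" "b \<in> vertices n" "c \<in> vertices n" "d \<in> vertices n"
      using abcd k l Uc by auto
    have cls: "k' = outer_class n d1 d2 x" if "k' \<in> concat_diagram n d1 d2" "x \<in> k'" for k' x
    proof -
      have "x \<in> vertices n" using that Uc by auto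
      then have "outer_class n d1 d2 x \<in> concat_diagram n d1 d2" "x \<in> outer_class n d1 d2 x"
        by (auto simp: concat_diagram_eq[OF mat] outer_class_def)
      then show ?thesis using matching_unique[OF mc] that by blast
    qed
    define C where "C = connected_points d1 d2 `` {outer a}"
    have CL: "C \<subseteq> UNIV \<times> {1..n}"
    proof
      fix p assume "p \<in> C"
      then have "p = outer a \<or> p \<in> {0, 1, 2} \<times> {1..n}"
        using connected_points_levels(1)[OF mat, of "outer a" p] by (auto simp: C_def)
      then show "p \<in> UNIV \<times> {1..n}" using V(1) by (cases a) auto
    qed
    have S: "k = {w \<in> vertices n. emb 0 2 w \<in> C}"
      using cls[OF k abcd(1)] by (simp add: C_def outer_class_def outer_eq_emb)
    have ev: "even (card k)" using k mc by (simp add: matching_def)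
    have nk: "c \<notin> k" "d \<notin> k" using kab abcd by auto
    have cd: "(outer c, outer d) \<in> connected_points d1 d2"
      using cls[OF l abcd(3)] abcd(4) by (auto simp: outer_class_def)
    have clos: "y \<in> C" if "(x, y) \<in> place 0 1 d1 \<union> place 1 2 d2" "x \<in> C" for x y
      using that by (auto simp: C_def connected_points_place intro: rtrancl_into_rtrancl)
    have step: "even (left_of C x) \<longleftrightarrow> even (left_of C y)"
      if "(x, y) \<in> place 0 1 d1 \<union> place 1 2 d2" "x \<notin> C" for x y
      using that(1)
    proof
      assume "(x, y) \<in> place 0 1 d1"
      then show ?thesis by (intro left_of_line[OF d1 _ CL _ _ that(2)]) (auto intro: clos)
    next
      assume "(x, y) \<in> place 1 2 d2"
      then show ?thesis by (intro left_of_line[OF d2 _ CL _ _ that(2)]) (auto intro: clos)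
    qed
    have "outer c \<notin> C" using nk(1) V(3) by (subst (asm) S) (simp add: outer_eq_emb)
    then have "even (left_of C (outer c)) \<longleftrightarrow> even (left_of C (outer d))"
      using left_of_rtrancl[OF cd[unfolded connected_points_place] _ _ clos step]
      by (simp add: sym_Un sym_place)
    then have "even (card {x \<in> k. boundary_pos n x < boundary_pos n c})
        \<longleftrightarrow> even (card {x \<in> k. boundary_pos n x < boundary_pos n d})"
      using even_left_of[OF _ CL S ev V(3) nk(1)] even_left_of[OF _ CL S ev V(4) nk(2)]
      by (simp add: outer_eq_emb)
    \<comment> \<open>The boundary order a, c, b, d puts one end of \<open>k\<close> before
      \<open>c\<close> and both before \<open>d\<close>, against the equal parities just
      found.\<close>
    moreover have "{x \<in> k. boundary_pos n x < boundary_pos n c} = {a}"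
      "{x \<in> k. boundary_pos n x < boundary_pos n d} = {a, b}"
      using kab abcd by auto
    moreover have "a \<noteq> b" using abcd by auto
    ultimately show False by simp
  qed
  then show ?thesis using mc by (simp add: TL_diagrams_def matching_def)
qed

section \<open>Reflection\<close>

definition reflect_point :: "nat \<Rightarrow> point \<Rightarrow> point" where
  "reflect_point n p = (fst p, n + 1 - snd p)"

lemma reflect_emb: "emb a b (reflect_vertex n v) = reflect_point n (emb a b v)"
  by (cases v) (auto simp: reflect_point_def)

lemma reflect_vertex_vertices: "v \<in> vertices n \<Longrightarrow> reflect_vertex n v \<in> vertices n"
  by (cases v) auto

lemma reflect_vertex_involutive: "v \<in> vertices n \<Longrightarrow> reflect_vertex n (reflect_vertex n v) = v"
  by (cases v) auto

lemma JB_TL: "d \<in> JB m \<Longrightarrow> d \<in> TL_diagrams (2 * m)"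
  by (simp add: JB_def)

lemma JB_matching: "d \<in> JB m \<Longrightarrow> matching (2 * m) d"
  by (simp add: JB_def TL_matching)

lemma JB_reflect_line: "d \<in> JB m \<Longrightarrow> l \<in> d \<Longrightarrow> reflect_vertex (2 * m) ` l \<in> d"
  by (auto simp: JB_def)

text \<open>Reflection is an involution on the lines, so stability of \<open>d\<close> already gives
  equality with its mirror image.\<close>

lemma JB_I:
  assumes d: "d \<in> TL_diagrams (2 * m)"
    and refl: "\<And>l. l \<in> d \<Longrightarrow> reflect_vertex (2 * m) ` l \<in> d"
  shows "d \<in> JB m"
proof -
  have "l \<in> (\<lambda>l. reflect_vertex (2 * m) ` l) ` d" if l: "l \<in> d" for l
  proof -
    have "l \<subseteq> vertices (2 * m)" using matching_Union[OF TL_matching[OF d]] l by blast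
    then have "reflect_vertex (2 * m) ` reflect_vertex (2 * m) ` l = l"
      using reflect_vertex_involutive by (force simp: image_image)
    then show ?thesis using refl[OF l] by (metis imageI)
  qed
  then show ?thesis using d refl by (auto simp: JB_def)
qed

lemma place_reflect:
  assumes "d \<in> JB m" "(p, q) \<in> place a b d"
  shows "(reflect_point (2 * m) p, reflect_point (2 * m) q) \<in> place a b d"
proof -
  obtain l u v where l: "l \<in> d" "u \<in> l" "v \<in> l" "p = emb a b u" "q = emb a b v"
    using assms by (auto simp: place_def)
  have "reflect_vertex (2 * m) ` l \<in> d" using JB_reflect_line assms l by blast
  then show ?thesis unfolding place_def l reflect_emb[symmetric] using l by blast
qed

lemma rtrancl_map:
  assumes "(p, q) \<in> R\<^sup>*" and "\<And>x y. (x, y) \<in> R \<Longrightarrow> (f x, f y) \<in> S"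
  shows "(f p, f q) \<in> S\<^sup>*"
  using assms(1) by (induction rule: rtrancl_induct) (auto intro: assms(2) rtrancl_into_rtrancl)

lemma concat_JB:
  assumes d: "d1 \<in> JB m" "d2 \<in> JB m"
  shows "concat_diagram (2 * m) d1 d2 \<in> JB m"
proof (rule JB_I)
  show "concat_diagram (2 * m) d1 d2 \<in> TL_diagrams (2 * m)" using concat_TL JB_TL d by blast
  fix l assume "l \<in> concat_diagram (2 * m) d1 d2"
  then obtain u v where uv: "l = {u, v}" "u \<in> vertices (2 * m)" "v \<in> vertices (2 * m)" "u \<noteq> v"
      "(outer u, outer v) \<in> connected_points d1 d2" by (auto simp: concat_diagram_def)
  have "(reflect_point (2 * m) (outer u), reflect_point (2 * m) (outer v)) \<in> connected_points d1 d2"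
    by (rule rtrancl_map[OF uv(5)[unfolded connected_points_place],
          where S = "place 0 1 d1 \<union> place 1 2 d2", folded connected_points_place])
      (use d place_reflect in blast)
  then have "(outer (reflect_vertex (2 * m) u), outer (reflect_vertex (2 * m) v)) \<in> connected_points d1 d2"
    by (simp add: outer_eq_emb reflect_emb)
  moreover have "reflect_vertex (2 * m) u \<noteq> reflect_vertex (2 * m) v"
    using reflect_vertex_involutive uv by metis
  ultimately show "reflect_vertex (2 * m) ` l \<in> concat_diagram (2 * m) d1 d2"
    using uv reflect_vertex_vertices by (auto simp: concat_diagram_def)
qed

text \<open>A line passing the centre meets its mirror image there. Two different lines of a diagram
  do not cross, so the line is its own mirror image and its ends are mirror images of each
  other.\<close>

lemma line_across_centre:
  assumes d: "d \<in> JB m" and pq: "(p, q) \<in> place a b d" and ab: "a \<noteq> b"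
    and side: "snd p \<le> m" "m < snd q"
  shows "q = reflect_point (2 * m) p"
proof -
  have mat: "matching (2 * m) d" using d by (rule JB_matching)
  have Ud: "vertices (2 * m) = \<Union>d" by (rule matching_Union[OF mat])
  obtain l u v where l: "l \<in> d" "u \<in> l" "v \<in> l" "p = emb a b u" "q = emb a b v"
    using pq by (auto simp: place_def)
  have nc: "\<And>k l. k \<in> d \<Longrightarrow> l \<in> d \<Longrightarrow> \<not> crossing (2 * m) k l"
    using JB_TL[OF d] by (auto simp: TL_diagrams_def)
  let ?r = "reflect_vertex (2 * m)"
  have rl: "?r ` l \<in> d" using JB_reflect_line d l by blast
  have V: "u \<in> vertices (2 * m)" "v \<in> vertices (2 * m)" using l Ud by auto
  have cr: "\<not> (boundary_pos (2 * m) x < boundary_pos (2 * m) z \<and>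
      boundary_pos (2 * m) z < boundary_pos (2 * m) y \<and> boundary_pos (2 * m) y < boundary_pos (2 * m) w)"
    if "x \<in> k" "y \<in> k" "z \<in> k'" "w \<in> k'" "k \<in> d" "k' \<in> d" for x y z w k k'
    using nc[of k k'] that unfolding crossing_def by blast
  have m: "?r u \<in> ?r ` l" "?r v \<in> ?r ` l" using l by auto
  \<comment> \<open>Whichever edges the two ends lie on, an asymmetric line and its mirror image
    would interlace in the boundary order.\<close>
  have "v = ?r u"
  proof (cases u; cases v)
    fix i j assume "u = North i" "v = North j"
    then show ?thesis using side l(4,5) V cr[OF l(2,3) m(2,1) l(1) rl] cr[OF m(2,1) l(2,3) rl l(1)]
      by (simp; linarith)
  next
    fix i j assume "u = North i" "v = South j"
    then show ?thesis using side l(4,5) V cr[OF l(2,3) m l(1) rl]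
      by (simp; linarith)
  next
    fix i j assume "u = South i" "v = North j"
    then show ?thesis using side l(4,5) V cr[OF m(2,1) l(3,2) rl l(1)]
      by (simp; linarith)
  next
    fix i j assume "u = South i" "v = South j"
    then show ?thesis using side l(4,5) V cr[OF m l(3,2) rl l(1)] cr[OF l(3,2) m l(1) rl]
      by (simp; linarith)
  qed
  then show ?thesis using l by (simp add: reflect_emb)
qed

section \<open>Colours\<close>

lemma bij_boundary_pos: "bij_betw (boundary_pos n) (vertices n) {1..2 * n}"
proof -
  have "boundary_pos n ` vertices n = {1..2 * n}"
  proof
    show "boundary_pos n ` vertices n \<subseteq> {1..2 * n}"
    proof
      fix x assume "x \<in> boundary_pos n ` vertices n"
      then obtain v where "v \<in> vertices n" "x = boundary_pos n v" by auto
      then show "x \<in> {1..2 * n}" by (cases v) auto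
    qed
    show "{1..2 * n} \<subseteq> boundary_pos n ` vertices n"
    proof
      fix x assume x: "x \<in> {1..2 * n}"
      show "x \<in> boundary_pos n ` vertices n"
      proof (cases "x \<le> n")
        case True
        then show ?thesis using x by (intro image_eqI[of _ _ "North x"]) auto
      next
        case False
        then show ?thesis using x by (intro image_eqI[of _ _ "South (2 * n + 1 - x)"]) auto
      qed
    qed
  qed
  then show ?thesis using boundary_pos_inj by (simp add: bij_betw_def)
qed

text \<open>Each line joins boundary positions of different parity, so the colouring is the
  checkerboard colouring of the gaps whatever the diagram.\<close>

lemma south_white_iff:
  assumes d: "d \<in> TL_diagrams (2 * m)" and g: "g \<le> 2 * m"
  shows "south_white m d g \<longleftrightarrow> even (m + g)"
proof -
  let ?n = "2 * m"
  have mat: "matching ?n d" by (rule TL_matching[OF d])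
  \<comment> \<open>The 3m - g vertices between the two gaps. A line separates the gaps iff exactly
    one of its ends is in \<open>W\<close>, and every other line has none or both there, so the
    number of separating lines has the parity of |W|.\<close>
  define W where "W = {v \<in> vertices ?n. m < boundary_pos ?n v \<and> boundary_pos ?n v \<le> 4 * m - g}"
  have "boundary_pos ?n ` W = {m<..4 * m - g}"
  proof
    show "{m<..4 * m - g} \<subseteq> boundary_pos ?n ` W"
    proof
      fix x assume x: "x \<in> {m<..4 * m - g}"
      then have "x \<in> boundary_pos ?n ` vertices ?n"
        using bij_betw_imp_surj_on[OF bij_boundary_pos, of ?n] by auto
      then show "x \<in> boundary_pos ?n ` W" using x by (auto simp: W_def)
    qed
  qed (auto simp: W_def)
  moreover have "inj_on (boundary_pos ?n) W"
    using boundary_pos_inj by (rule inj_on_subset) (auto simp: W_def)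
  ultimately have cW: "card W = 3 * m - g" using card_image[of "boundary_pos ?n" W] g by simp
  have fin: "finite d"
    using finite_elements[of "vertices ?n" d] mat by (simp add: matching_def)
  have "disjoint_family_on (\<lambda>l. l \<inter> W) d"
    using matching_unique[OF mat] by (auto simp: disjoint_family_on_def)
  moreover have "W = (\<Union>l\<in>d. l \<inter> W)" using matching_Union[OF mat] by (auto simp: W_def)
  moreover have "finite W" by (simp add: W_def)
  ultimately have "card W = (\<Sum>l\<in>d. card (l \<inter> W))"
    using card_UN_disjoint'[of "\<lambda>l. l \<inter> W" d] fin by auto
  then have "even (3 * m - g) \<longleftrightarrow> even (card {l \<in> d. odd (card (l \<inter> W))})"
    using even_sum_iff[OF fin, of "\<lambda>l. card (l \<inter> W)"] cW by simp
  moreover have "odd (card (l \<inter> W)) \<longleftrightarrow> separates ?n l m (4 * m - g)" if l: "l \<in> d" for l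
  proof -
    have "l \<subseteq> vertices ?n" using matching_Union[OF mat] l by blast
    moreover have "min m (4 * m - g) = m" "max m (4 * m - g) = 4 * m - g" using g by auto
    ultimately have "l \<inter> W = {v \<in> l. min m (4 * m - g) < boundary_pos ?n v \<and>
        boundary_pos ?n v \<le> max m (4 * m - g)}" by (auto simp: W_def)
    moreover have c2: "card l = 2" using mat l by (simp add: matching_def)
    then have "card (l \<inter> W) \<le> 2" using card_mono[of l "l \<inter> W"] by (simp add: card_ge_0_finite)
    ultimately show ?thesis
      unfolding separates_def by (auto simp: le_Suc_eq numeral_2_eq_2)
  qed
  ultimately have "south_white m d g \<longleftrightarrow> even (3 * m - g)"
    unfolding south_white_def by (metis (mono_tags, lifting) Collect_cong)
  also have "\<dots> \<longleftrightarrow> even (m + g)" using g by (auto simp: even_diff_nat)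
  finally show ?thesis .
qed

text \<open>Next to a point \<open>i\<close> of the loop exactly one gap is inside: gap i - 1 if an
  odd number of points precede \<open>i\<close>, gap i otherwise. Its colour follows from
  \<open>south_white_iff\<close>, and the two cases merge into one parity.\<close>

lemma interior_white_iff:
  assumes d: "d \<in> TL_diagrams (2 * m)" and L: "L \<subseteq> {1..2 * m}"
  shows "interior_white m d L \<longleftrightarrow> (\<exists>i \<in> L. even (card {j \<in> L. j < i} + i + m))"
proof -
  have "(\<exists>g \<in> {i - 1, i}. inside_loop L g \<and> south_white m d g)
      \<longleftrightarrow> even (card {j \<in> L. j < i} + i + m)" if i: "i \<in> L" for i
  proof -
    have i1: "1 \<le> i" "i \<le> 2 * m" using i L by auto
    have fin: "finite L" by (rule finite_subset[OF L]) simp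
    have "{j \<in> L. j \<le> i - 1} = {j \<in> L. j < i}" using i1 by auto
    moreover have "{j \<in> L. j \<le> i} = insert i {j \<in> L. j < i}" using i by auto
    then have "card {j \<in> L. j \<le> i} = Suc (card {j \<in> L. j < i})" using fin by simp
    moreover have "even (m + (i - 1)) \<longleftrightarrow> odd (m + i)" using i1 by (cases i) auto
    ultimately show ?thesis
      using south_white_iff[OF d, of i] south_white_iff[OF d, of "i - 1"] i1
      by (auto simp: inside_loop_def)
  qed
  then show ?thesis unfolding interior_white_def by blast
qed

section \<open>Stacks of three diagrams and associativity up to loops\<close>

section \<open>Relabelling levels\<close>

lemma place_levels: "(p, q) \<in> place a b d \<Longrightarrow> fst p \<in> {a, b} \<and> fst q \<in> {a, b}"
proof -
  assume "(p, q) \<in> place a b d"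
  then obtain u v where "p = emb a b u" "q = emb a b v" by (auto simp: place_def)
  then show ?thesis by (cases u; cases v) auto
qed

lemma apfst_emb: "apfst s (emb a b v) = emb (s a) (s b) v"
  by (cases v) auto

lemma place_relabel:
  assumes "(p, q) \<in> place a b d"
  shows "(apfst s p, apfst s q) \<in> place (s a) (s b) d"
proof -
  obtain l u v where l: "l \<in> d" "u \<in> l" "v \<in> l" "p = emb a b u" "q = emb a b v"
    using assms by (auto simp: place_def)
  then show ?thesis unfolding place_def l apfst_emb by blast
qed

lemma places_relabel:
  assumes "(p, q) \<in> (place a b d1 \<union> place b c d2)\<^sup>*"
  shows "(apfst s p, apfst s q) \<in> (place (s a) (s b) d1 \<union> place (s b) (s c) d2)\<^sup>*"
  using assms by (rule rtrancl_map) (use place_relabel in blast)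

lemma places_levels:
  assumes "(p, q) \<in> (place a b d1 \<union> place b c d2)\<^sup>*" "fst p \<in> {a, b, c}"
  shows "fst q \<in> {a, b, c}"
  using assms
proof (induction rule: rtrancl_induct)
  case (step y z)
  then show ?case using place_levels[of y z a b d1] place_levels[of y z b c d2] by auto
qed simp

definition level_of :: "nat \<Rightarrow> nat \<Rightarrow> nat \<Rightarrow> nat \<Rightarrow> nat" where
  "level_of a b c x = (if x = 0 then a else if x = 1 then b else c)"

text \<open>Inverse to \<open>level_of\<close> on the three levels. Any other level is sent to 2,
  hence the condition on the levels of \<open>p\<close> and \<open>q\<close> in
  \<open>connected_points_relabel\<close>.\<close>

definition level_to :: "nat \<Rightarrow> nat \<Rightarrow> nat \<Rightarrow> nat \<Rightarrow> nat" where
  "level_to a b c x = (if x = a then 0 else if x = b then 1 else 2)"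

text \<open>Facts about the levels 0, 1, 2 carry over to any two layers with a common level, in
  particular to adjacent layers of a triple stack and to a single layer next to a fused
  pair.\<close>

lemma connected_points_relabel:
  assumes dist: "a \<noteq> b" "b \<noteq> c" "a \<noteq> c" and p: "fst p \<in> {a, b, c}" and q: "fst q \<in> {a, b, c}"
  shows "(p, q) \<in> (place a b d1 \<union> place b c d2)\<^sup>* \<longleftrightarrow>
    (apfst (level_to a b c) p, apfst (level_to a b c) q) \<in> connected_points d1 d2"
proof
  assume "(p, q) \<in> (place a b d1 \<union> place b c d2)\<^sup>*"
  from places_relabel[OF this, of "level_to a b c"]
  show "(apfst (level_to a b c) p, apfst (level_to a b c) q) \<in> connected_points d1 d2"
    using dist by (simp add: connected_points_place level_to_def)
next
  assume "(apfst (level_to a b c) p, apfst (level_to a b c) q) \<in> connected_points d1 d2"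
  from places_relabel[OF this[unfolded connected_points_place], of "level_of a b c"]
  show "(p, q) \<in> (place a b d1 \<union> place b c d2)\<^sup>*"
    using dist p q by (cases p; cases q) (auto simp: level_of_def level_to_def)
qed

lemma loops_relabel:
  assumes dist: "a \<noteq> b" "b \<noteq> c" "a \<noteq> c"
  shows "loops n d1 d2 = {L. L \<noteq> {} \<and> L \<subseteq> {1..n} \<and>
      (\<forall>i \<in> L. (place a b d1 \<union> place b c d2)\<^sup>* `` {(b, i)} = Pair b ` L)}"
proof -
  have "connected_points d1 d2 `` {(1, i)} = Pair 1 ` L \<longleftrightarrow>
      (place a b d1 \<union> place b c d2)\<^sup>* `` {(b, i)} = Pair b ` L" for i L
  proof
    assume *: "connected_points d1 d2 `` {(1, i)} = Pair 1 ` L"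
    show "(place a b d1 \<union> place b c d2)\<^sup>* `` {(b, i)} = Pair b ` L"
    proof (intro Set.set_eqI)
      fix q
      show "q \<in> (place a b d1 \<union> place b c d2)\<^sup>* `` {(b, i)} \<longleftrightarrow> q \<in> Pair b ` L"
      proof (cases "fst q \<in> {a, b, c}")
        case True
        have "q \<in> (place a b d1 \<union> place b c d2)\<^sup>* `` {(b, i)} \<longleftrightarrow>
            apfst (level_to a b c) q \<in> connected_points d1 d2 `` {(1, i)}"
          using connected_points_relabel[OF dist _ True, of "(b, i)"] dist by (simp add: level_to_def)
        also have "\<dots> \<longleftrightarrow> q \<in> Pair b ` L"
          unfolding * using True dist by (cases q) (auto simp: level_to_def)
        finally show ?thesis .
      next
        case False
        then show ?thesis using places_levels[of "(b, i)" q a b d1 c d2] by auto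
      qed
    qed
  next
    assume *: "(place a b d1 \<union> place b c d2)\<^sup>* `` {(b, i)} = Pair b ` L"
    show "connected_points d1 d2 `` {(1, i)} = Pair 1 ` L"
    proof (intro Set.set_eqI)
      fix q
      show "q \<in> connected_points d1 d2 `` {(1, i)} \<longleftrightarrow> q \<in> Pair 1 ` L"
      proof (cases "fst q \<in> {0, 1, 2}")
        case True
        have "apfst (level_to a b c) (apfst (level_of a b c) q) = q"
          using True dist by (cases q) (auto simp: level_to_def level_of_def)
        then have "q \<in> connected_points d1 d2 `` {(1, i)} \<longleftrightarrow>
            apfst (level_of a b c) q \<in> (place a b d1 \<union> place b c d2)\<^sup>* `` {(b, i)}"
          using connected_points_relabel[OF dist, of "(b, i)" "apfst (level_of a b c) q" d1 d2] dist
          by (simp add: level_to_def level_of_def)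
        also have "\<dots> \<longleftrightarrow> q \<in> Pair 1 ` L"
          unfolding * using True dist by (cases q) (auto simp: level_of_def)
        finally show ?thesis .
      next
        case False
        then show ?thesis
          using places_levels[of "(1, i)" q 0 1 d1 2 d2] by (auto simp: connected_points_place)
      qed
    qed
  qed
  then show ?thesis unfolding loops_def by simp
qed

text \<open>Away from the inner level, two layers may be fused into one. The loops lost in the
  fusion meet the inner level only, so no other point notices.\<close>

lemma concat_place:
  assumes mat: "matching n d1" "matching n d2"
    and dist: "a \<noteq> b" "b \<noteq> c" "a \<noteq> c" and pq: "fst p \<noteq> b" "fst q \<noteq> b"
  shows "(p, q) \<in> (place a b d1 \<union> place b c d2)\<^sup>* \<longleftrightarrow> (p, q) \<in> (place a c (concat_diagram n d1 d2))\<^sup>*"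
proof -
  have outer: "apfst (level_to a b c) (emb a c u) = outer u" for u
    using dist by (simp add: apfst_emb level_to_def outer_eq_emb)
  have lev: "fst (emb a c u) \<in> {a, b, c}" for u by (cases u) auto
  have conn: "(emb a c u, emb a c v) \<in> (place a b d1 \<union> place b c d2)\<^sup>* \<longleftrightarrow>
      (outer u, outer v) \<in> connected_points d1 d2" for u v
    using connected_points_relabel[OF dist lev lev, of u v d1 d2] by (simp add: outer)
  show ?thesis
  proof
    assume *: "(p, q) \<in> (place a c (concat_diagram n d1 d2))\<^sup>*"
    have "place a c (concat_diagram n d1 d2) \<subseteq> (place a b d1 \<union> place b c d2)\<^sup>*"
    proof (rule subrelI)
      fix x y assume "(x, y) \<in> place a c (concat_diagram n d1 d2)"
      then obtain l u v where l: "l \<in> concat_diagram n d1 d2" "u \<in> l" "v \<in> l"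
        "x = emb a c u" "y = emb a c v" by (auto simp: place_def)
      then obtain u' v' where "l = {u', v'}" "(outer u', outer v') \<in> connected_points d1 d2"
        by (auto simp: concat_diagram_def)
      then have "(outer u, outer v) \<in> connected_points d1 d2"
        using l(2,3) connected_points_sym[of "outer u'" "outer v'"] by auto
      then show "(x, y) \<in> (place a b d1 \<union> place b c d2)\<^sup>*" using conn l by simp
    qed
    then show "(p, q) \<in> (place a b d1 \<union> place b c d2)\<^sup>*"
      using * by (metis rtrancl_idemp rtrancl_mono subsetD)
  next
    assume *: "(p, q) \<in> (place a b d1 \<union> place b c d2)\<^sup>*"
    show "(p, q) \<in> (place a c (concat_diagram n d1 d2))\<^sup>*"
    proof (cases "p = q")
      case False
      have "q \<in> emb a c ` vertices n"
        using *
      proof (cases rule: rtranclE)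
        case (step y)
        then have "q \<in> emb a b ` vertices n \<or> q \<in> emb b c ` vertices n"
          using place_field(2)[OF mat(1), of y q a b] place_field(2)[OF mat(2), of y q b c] by auto
        then show ?thesis using pq unfolding emb_vertices by auto
      qed (use False in simp)
      moreover have "p \<in> emb a c ` vertices n"
        using *
      proof (cases rule: converse_rtranclE)
        case (step y)
        then have "p \<in> emb a b ` vertices n \<or> p \<in> emb b c ` vertices n"
          using place_field(1)[OF mat(1), of p y a b] place_field(1)[OF mat(2), of p y b c] by auto
        then show ?thesis using pq unfolding emb_vertices by auto
      qed (use False in simp)
      ultimately obtain u v where uv: "u \<in> vertices n" "v \<in> vertices n"
        "p = emb a c u" "q = emb a c v" by auto
      then have "{u, v} \<in> concat_diagram n d1 d2"
        using * conn False by (auto simp: concat_diagram_def)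
      then have "(p, q) \<in> place a c (concat_diagram n d1 d2)"
        unfolding place_def uv by (auto intro!: bexI[of _ "{u, v}"])
      then show ?thesis by auto
    qed simp
  qed
qed

text \<open>The relation \<open>S\<close> lives on \<open>W\<close>, so a path between points of
  \<open>W\<close> breaks up into steps of \<open>S\<close> and excursions along \<open>R\<close>
  that start and end in \<open>W\<close>. Each excursion can be replaced by one along
  \<open>R'\<close>.\<close>

lemma rtrancl_replace:
  assumes W: "\<And>p q. p \<in> W \<Longrightarrow> q \<in> W \<Longrightarrow> (p, q) \<in> R\<^sup>* \<longleftrightarrow> (p, q) \<in> R'\<^sup>*"
    and R': "R' \<subseteq> W \<times> W" and S: "S \<subseteq> W \<times> W" and p: "p \<in> W" and q: "q \<in> W"
  shows "(p, q) \<in> (R \<union> S)\<^sup>* \<longleftrightarrow> (p, q) \<in> (R' \<union> S)\<^sup>*"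
proof
  assume "(p, q) \<in> (R \<union> S)\<^sup>*"
  \<comment> \<open>Invariant of the induction: a path already replaced up to a point
    \<open>w\<close> of \<open>W\<close>, followed by an unfinished excursion along
    \<open>R\<close>.\<close>
  then have "\<exists>w \<in> W. (p, w) \<in> (R' \<union> S)\<^sup>* \<and> (w, q) \<in> R\<^sup>*"
  proof (induction rule: rtrancl_induct)
    case base
    then show ?case using p by auto
  next
    case (step y z)
    then obtain w where w: "w \<in> W" "(p, w) \<in> (R' \<union> S)\<^sup>*" "(w, y) \<in> R\<^sup>*" by blast
    show ?case
    proof (cases "(y, z) \<in> R")
      case True
      then show ?thesis using w by (meson rtrancl_into_rtrancl)
    next
      case False
      then have yz: "(y, z) \<in> S" "y \<in> W" "z \<in> W" using step S by auto
      then have "(w, y) \<in> (R' \<union> S)\<^sup>*" using W w rtrancl_mono[of R' "R' \<union> S"] by blast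
      then have "(p, z) \<in> (R' \<union> S)\<^sup>*"
        using w(2) yz(1) by (meson UnI2 rtrancl_into_rtrancl rtrancl_trans)
      then show ?thesis using yz by blast
    qed
  qed
  then obtain w where w: "w \<in> W" "(p, w) \<in> (R' \<union> S)\<^sup>*" "(w, q) \<in> R\<^sup>*" by blast
  then have "(w, q) \<in> (R' \<union> S)\<^sup>*" using W q rtrancl_mono[of R' "R' \<union> S"] by blast
  then show "(p, q) \<in> (R' \<union> S)\<^sup>*" using w by simp
next
  assume *: "(p, q) \<in> (R' \<union> S)\<^sup>*"
  have "R' \<subseteq> R\<^sup>*" using W R' by auto
  then have "R' \<union> S \<subseteq> (R \<union> S)\<^sup>*" using rtrancl_mono[of R "R \<union> S"] by auto
  then show "(p, q) \<in> (R \<union> S)\<^sup>*" using * by (metis rtrancl_idemp rtrancl_mono subsetD)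
qed

lemma place_concat_left:
  assumes mat: "matching n d1" "matching n d2" and pq: "fst p \<noteq> 1" "fst q \<noteq> 1"
  shows "(p, q) \<in> (place 0 2 (concat_diagram n d1 d2) \<union> place 2 3 d3)\<^sup>* \<longleftrightarrow>
    (p, q) \<in> (place 0 1 d1 \<union> place 1 2 d2 \<union> place 2 3 d3)\<^sup>*"
proof (rule rtrancl_replace[symmetric, where W = "{p. fst p \<noteq> 1}"])
  show "(p, q) \<in> (place 0 1 d1 \<union> place 1 2 d2)\<^sup>* \<longleftrightarrow> (p, q) \<in> (place 0 2 (concat_diagram n d1 d2))\<^sup>*"
    if "p \<in> {p. fst p \<noteq> 1}" "q \<in> {p. fst p \<noteq> 1}" for p q
    using that by (intro concat_place[OF mat]) auto
qed (use pq in \<open>auto dest!: place_levels\<close>)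

lemma place_concat_right:
  assumes mat: "matching n d2" "matching n d3" and pq: "fst p \<noteq> 2" "fst q \<noteq> 2"
  shows "(p, q) \<in> (place 0 1 d1 \<union> place 1 3 (concat_diagram n d2 d3))\<^sup>* \<longleftrightarrow>
    (p, q) \<in> (place 0 1 d1 \<union> place 1 2 d2 \<union> place 2 3 d3)\<^sup>*"
proof -
  have "(p, q) \<in> (place 1 3 (concat_diagram n d2 d3) \<union> place 0 1 d1)\<^sup>* \<longleftrightarrow>
      (p, q) \<in> ((place 1 2 d2 \<union> place 2 3 d3) \<union> place 0 1 d1)\<^sup>*"
  proof (rule rtrancl_replace[symmetric, where W = "{p. fst p \<noteq> 2}"])
    show "(p, q) \<in> (place 1 2 d2 \<union> place 2 3 d3)\<^sup>* \<longleftrightarrow> (p, q) \<in> (place 1 3 (concat_diagram n d2 d3))\<^sup>*"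
      if "p \<in> {p. fst p \<noteq> 2}" "q \<in> {p. fst p \<noteq> 2}" for p q
      using that by (intro concat_place[OF mat]) auto
  qed (use pq in \<open>auto dest!: place_levels\<close>)
  then show ?thesis by (simp add: Un_ac)
qed

text \<open>Both bracketings record which outer points, on levels 0 and 3, are connected in the
  stack of all three diagrams.\<close>

lemma concat_assoc:
  assumes mat: "matching n d1" "matching n d2" "matching n d3"
  shows "concat_diagram n (concat_diagram n d1 d2) d3 = concat_diagram n d1 (concat_diagram n d2 d3)"
proof -
  have lev: "fst (emb 0 3 w) \<in> {0, 2, 3}" "fst (emb 0 3 w) \<in> {0, 1, 3}"
    "fst (emb 0 3 w) \<noteq> 1" "fst (emb 0 3 w) \<noteq> 2" for w :: vertex by (cases w; auto)+
  have "(outer u, outer v) \<in> connected_points (concat_diagram n d1 d2) d3 \<longleftrightarrow>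
      (emb 0 3 u, emb 0 3 v) \<in> (place 0 2 (concat_diagram n d1 d2) \<union> place 2 3 d3)\<^sup>*" for u v
    using connected_points_relabel[of 0 2 3 "emb 0 3 u" "emb 0 3 v"] lev
    by (simp add: apfst_emb level_to_def outer_eq_emb)
  moreover have "(outer u, outer v) \<in> connected_points d1 (concat_diagram n d2 d3) \<longleftrightarrow>
      (emb 0 3 u, emb 0 3 v) \<in> (place 0 1 d1 \<union> place 1 3 (concat_diagram n d2 d3))\<^sup>*" for u v
    using connected_points_relabel[of 0 1 3 "emb 0 3 u" "emb 0 3 v"] lev
    by (simp add: apfst_emb level_to_def outer_eq_emb)
  ultimately have "(outer u, outer v) \<in> connected_points (concat_diagram n d1 d2) d3 \<longleftrightarrow>
      (outer u, outer v) \<in> connected_points d1 (concat_diagram n d2 d3)" for u v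
    using place_concat_left[OF mat(1,2) lev(3,3)] place_concat_right[OF mat(2,3) lev(4,4)] by simp
  then show ?thesis by (simp add: concat_diagram_def[of n "concat_diagram n d1 d2" d3]
    concat_diagram_def[of n d1 "concat_diagram n d2 d3"])
qed

section \<open>Closed curves in a triple concatenation\<close>

definition triple :: "diagram \<Rightarrow> diagram \<Rightarrow> diagram \<Rightarrow> (point \<times> point) set" where
  "triple d1 d2 d3 = place 0 1 d1 \<union> place 1 2 d2 \<union> place 2 3 d3"

definition slice :: "nat \<Rightarrow> point set \<Rightarrow> nat set" where
  "slice a C = {i. (a, i) \<in> C}"

text \<open>Components of the stack that never reach the outer levels 0 and 3. They are what both
  bracketings delete as closed loops.\<close>

definition closed_curves :: "nat \<Rightarrow> diagram \<Rightarrow> diagram \<Rightarrow> diagram \<Rightarrow> point set set" where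
  "closed_curves n d1 d2 d3 = {C. (\<exists>p \<in> {1, 2} \<times> {1..n}. C = (triple d1 d2 d3)\<^sup>* `` {p}) \<and>
     C \<subseteq> {1, 2} \<times> UNIV}"

definition curve_pairs :: "nat \<Rightarrow> point set set \<Rightarrow> point set set set" where
  "curve_pairs m Z = (\<lambda>C. {C, reflect_point (2 * m) ` C}) ` {C \<in> Z. reflect_point (2 * m) ` C \<noteq> C}"

definition curve_white :: "nat \<Rightarrow> point set \<Rightarrow> bool" where
  "curve_white m C \<longleftrightarrow> (\<exists>p \<in> C. even (left_of C p + snd p + m))"

lemma sym_triple: "sym ((triple d1 d2 d3)\<^sup>*)"
  unfolding triple_def by (intro sym_rtrancl sym_Un sym_place)

lemma triple_class_eq:
  assumes "(p, q) \<in> (triple d1 d2 d3)\<^sup>*"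
  shows "(triple d1 d2 d3)\<^sup>* `` {p} = (triple d1 d2 d3)\<^sup>* `` {q}"
proof -
  have "(q, p) \<in> (triple d1 d2 d3)\<^sup>*" using assms sym_triple by (meson symD)
  then show ?thesis using assms by (auto intro: rtrancl_trans)
qed

lemma closed_curve_class:
  assumes "C \<in> closed_curves n d1 d2 d3" "q \<in> C"
  shows "C = (triple d1 d2 d3)\<^sup>* `` {q}"
proof -
  obtain p where "C = (triple d1 d2 d3)\<^sup>* `` {p}" using assms by (auto simp: closed_curves_def)
  then show ?thesis using triple_class_eq assms(2) by blast
qed

lemma closed_curves_disjoint:
  assumes "C \<in> closed_curves n d1 d2 d3" "C' \<in> closed_curves n d1 d2 d3" "q \<in> C" "q \<in> C'"
  shows "C = C'"
  using closed_curve_class[OF assms(1,3)] closed_curve_class[OF assms(2,4)] by simp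

lemma closed_curvesI:
  assumes "C = (triple d1 d2 d3)\<^sup>* `` {q}" "q \<in> {1, 2} \<times> {1..n}" "C \<subseteq> {1, 2} \<times> UNIV"
  shows "C \<in> closed_curves n d1 d2 d3"
  using assms unfolding closed_curves_def by blast

lemma triple_range:
  assumes mat: "matching n d1" "matching n d2" "matching n d3"
    and "(p, q) \<in> (triple d1 d2 d3)\<^sup>*" "snd p \<in> {1..n}"
  shows "snd q \<in> {1..n}"
  using assms(4)
proof (cases rule: rtranclE)
  case (step y)
  then consider "(y, q) \<in> place 0 1 d1" | "(y, q) \<in> place 1 2 d2" | "(y, q) \<in> place 2 3 d3"
    by (auto simp: triple_def)
  then show ?thesis
  proof cases
    case 1
    then have "q \<in> emb 0 1 ` vertices n" by (rule place_field(2)[OF mat(1)])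
    then show ?thesis unfolding emb_vertices by auto
  next
    case 2
    then have "q \<in> emb 1 2 ` vertices n" by (rule place_field(2)[OF mat(2)])
    then show ?thesis unfolding emb_vertices by auto
  next
    case 3
    then have "q \<in> emb 2 3 ` vertices n" by (rule place_field(2)[OF mat(3)])
    then show ?thesis unfolding emb_vertices by auto
  qed
qed (use assms in simp)

lemma reflect_point_involutive: "snd p \<in> {1..n} \<Longrightarrow> reflect_point n (reflect_point n p) = p"
  by (cases p) (auto simp: reflect_point_def)

lemma closed_curve_range:
  assumes mat: "matching n d1" "matching n d2" "matching n d3"
    and C: "C \<in> closed_curves n d1 d2 d3"
  shows "C \<subseteq> {1, 2} \<times> {1..n}"
proof
  fix q assume q: "q \<in> C"
  obtain p where p: "p \<in> {1, 2} \<times> {1..n}" "C = (triple d1 d2 d3)\<^sup>* `` {p}" "C \<subseteq> {1, 2} \<times> UNIV"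
    using C by (auto simp: closed_curves_def)
  then have "(p, q) \<in> (triple d1 d2 d3)\<^sup>*" "snd p \<in> {1..n}" using q by auto
  then have "snd q \<in> {1..n}" by (rule triple_range[OF mat])
  then show "q \<in> {1, 2} \<times> {1..n}" using p(3) q by (cases q) auto
qed

lemma finite_closed_curves: "finite (closed_curves n d1 d2 d3)"
proof (rule finite_subset)
  show "closed_curves n d1 d2 d3 \<subseteq> (\<lambda>p. (triple d1 d2 d3)\<^sup>* `` {p}) ` ({1, 2} \<times> {1..n})"
    unfolding closed_curves_def by blast
qed simp

context
  fixes m :: nat and d1 d2 d3 :: diagram
  assumes d: "d1 \<in> JB m" "d2 \<in> JB m" "d3 \<in> JB m"
begin

lemma triple_reflect:
  "(p, q) \<in> triple d1 d2 d3 \<Longrightarrow> (reflect_point (2 * m) p, reflect_point (2 * m) q) \<in> triple d1 d2 d3"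
  unfolding triple_def using d place_reflect by blast

lemma closed_curve_reflect:
  assumes C: "C \<in> closed_curves (2 * m) d1 d2 d3"
  shows "reflect_point (2 * m) ` C \<in> closed_curves (2 * m) d1 d2 d3"
proof -
  note mat = d[THEN JB_matching]
  let ?r = "reflect_point (2 * m)" and ?T = "(triple d1 d2 d3)\<^sup>*"
  obtain p where p: "p \<in> {1, 2} \<times> {1..2 * m}" "C = ?T `` {p}" "C \<subseteq> {1, 2} \<times> UNIV"
    using C by (auto simp: closed_curves_def)
  have rp: "?r p \<in> {1, 2} \<times> {1..2 * m}" using p(1) by (auto simp: reflect_point_def)
  have map: "(?r x, ?r y) \<in> ?T" if "(x, y) \<in> ?T" for x y
    by (rule rtrancl_map[OF that]) (rule triple_reflect)
  have "?r ` C = ?T `` {?r p}"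
  proof
    show "?r ` C \<subseteq> ?T `` {?r p}" using map by (auto simp: p(2))
    show "?T `` {?r p} \<subseteq> ?r ` C"
    proof
      fix q assume "q \<in> ?T `` {?r p}"
      then have q: "(?r p, q) \<in> ?T" by auto
      then have "(?r (?r p), ?r q) \<in> ?T" by (rule map)
      moreover have "?r (?r p) = p" using p(1) by (intro reflect_point_involutive) auto
      ultimately have "?r q \<in> C" by (simp add: p(2))
      moreover have "snd q \<in> {1..2 * m}" using rp by (intro triple_range[OF mat q]) auto
      then have "?r (?r q) = q" by (rule reflect_point_involutive)
      ultimately show "q \<in> ?r ` C" by (metis imageI)
    qed
  qed
  moreover have "?r ` C \<subseteq> {1, 2} \<times> UNIV" using p(3) by (force simp: reflect_point_def)
  ultimately show ?thesis using rp by (intro closed_curvesI)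
qed

text \<open>If the curve passes the centre, one of its lines does, and by
  \<open>line_across_centre\<close> its two ends are mirror images. Hence the curve and its mirror
  image share a point and coincide. Conversely i and 2m + 1 - i lie on different sides of the
  centre.\<close>

lemma closed_curve_crosses:
  assumes C: "C \<in> closed_curves (2 * m) d1 d2 d3" and ne: "slice a C \<noteq> {}"
  shows "crosses_centre m (slice a C) \<longleftrightarrow> reflect_point (2 * m) ` C = C"
proof
  note mat = d[THEN JB_matching]
  let ?r = "reflect_point (2 * m)" and ?T = "(triple d1 d2 d3)\<^sup>*"
  assume "crosses_centre m (slice a C)"
  then obtain i j where ij: "(a, i) \<in> C" "(a, j) \<in> C" "i \<le> m" "m < j"
    by (auto simp: crosses_centre_def slice_def)
  have "(a, j) \<in> ?T `` {(a, i)}" using closed_curve_class[OF C ij(1)] ij(2) by simp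
  then have "((a, i), (a, j)) \<in> ?T" by auto
  then have "m < snd (a, j) \<longrightarrow> (\<exists>x y. ((a, i), x) \<in> ?T \<and> (x, y) \<in> triple d1 d2 d3 \<and> snd x \<le> m \<and> m < snd y)"
  proof (induction rule: rtrancl_induct)
    case (step y z)
    then show ?case by (meson not_le_imp_less)
  qed (use ij in simp)
  then obtain x y where xy: "((a, i), x) \<in> ?T" "(x, y) \<in> triple d1 d2 d3" "snd x \<le> m" "m < snd y"
    using ij by auto
  have "y = ?r x"
    using xy(2) line_across_centre[OF d(1) _ _ xy(3,4)] line_across_centre[OF d(2) _ _ xy(3,4)]
      line_across_centre[OF d(3) _ _ xy(3,4)] unfolding triple_def
    by (metis UnE numeral_eq_iff n_not_Suc_n numeral_2_eq_2 One_nat_def numeral_3_eq_3)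
  moreover have "x \<in> C" using closed_curve_class[OF C ij(1)] xy by auto
  moreover have "((a, i), y) \<in> ?T" using xy by auto
  then have "y \<in> C" using closed_curve_class[OF C ij(1)] by auto
  ultimately show "?r ` C = C"
    using closed_curves_disjoint[OF closed_curve_reflect[OF C] C, of y] by auto
next
  let ?r = "reflect_point (2 * m)"
  assume *: "?r ` C = C"
  obtain i where i: "(a, i) \<in> C" using ne by (auto simp: slice_def)
  then have "(a, 2 * m + 1 - i) \<in> C" using * by (force simp: reflect_point_def)
  moreover have "1 \<le> i" "i \<le> 2 * m" using closed_curve_range[OF d[THEN JB_matching] C] i by auto
  ultimately show "crosses_centre m (slice a C)"
    using i by (cases "i \<le> m") (auto simp: crosses_centre_def slice_def intro!: bexI[of _ i] bexI[of _ "2 * m + 1 - i"])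
qed

text \<open>Positions start at 1, so snd p - 1 of them lie to the left of \<open>p\<close>, each in
  \<open>C\<close> or in its complement.\<close>

lemma left_of_complement:
  assumes "C \<subseteq> UNIV \<times> {1..n}" "snd p \<in> {1..n}"
  shows "left_of C p + left_of (UNIV \<times> {1..n} - C) p + 1 = snd p"
proof -
  have "{j. (fst p, j) \<in> C \<and> j < snd p} \<union> {j. (fst p, j) \<in> UNIV \<times> {1..n} - C \<and> j < snd p} = {1..<snd p}"
    using assms by auto
  moreover have "{j. (fst p, j) \<in> C \<and> j < snd p} \<inter> {j. (fst p, j) \<in> UNIV \<times> {1..n} - C \<and> j < snd p} = {}"
    by auto
  ultimately have "left_of C p + left_of (UNIV \<times> {1..n} - C) p = card {1..<snd p}"
    unfolding left_of_def by (metis (no_types, lifting) card_Un_disjoint finite_Un finite_atLeastLessThan)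
  then show ?thesis using assms by auto
qed

text \<open>The complementary set of curves is not met by \<open>C\<close>, so \<open>left_of_line\<close> applies to it.\<close>

lemma closed_curve_colour:
  assumes C: "C \<in> closed_curves (2 * m) d1 d2 d3" and pq: "p \<in> C" "q \<in> C"
  shows "even (left_of C p + snd p) \<longleftrightarrow> even (left_of C q + snd q)"
proof -
  note mat = d[THEN JB_matching]
  note TL = d[THEN JB_TL]
  have ran: "C \<subseteq> {1, 2} \<times> {1..2 * m}" by (rule closed_curve_range[OF mat C])
  \<comment> \<open>\<open>left_of_line\<close> speaks of points off the set, so it cannot be
    applied to \<open>C\<close> along \<open>C\<close> itself. The complement is avoided by the walk
    from \<open>p\<close> to \<open>q\<close>, and \<open>left_of_complement\<close> translates the
    result back, the position entering as the difference.\<close>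
  define C' where "C' = UNIV \<times> {1..2 * m} - C"
  have C': "C' \<subseteq> UNIV \<times> {1..2 * m}" by (auto simp: C'_def)
  have clos: "y \<in> C'" if "(x, y) \<in> triple d1 d2 d3" "x \<in> C'" for x y
  proof -
    have xy: "(x, y) \<in> (triple d1 d2 d3)\<^sup>*" using that by auto
    moreover have "snd x \<in> {1..2 * m}" using that by (auto simp: C'_def)
    ultimately have "snd y \<in> {1..2 * m}" by (rule triple_range[OF mat])
    moreover have "y \<notin> C"
    proof
      assume "y \<in> C"
      moreover have "(y, x) \<in> (triple d1 d2 d3)\<^sup>*" using xy sym_triple by (meson symD)
      ultimately have "x \<in> C" using closed_curve_class[OF C] by blast
      then show False using that by (simp add: C'_def)
    qed
    ultimately show ?thesis by (cases y) (auto simp: C'_def)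
  qed
  have step: "even (left_of C' x) \<longleftrightarrow> even (left_of C' y)"
    if xy: "(x, y) \<in> triple d1 d2 d3" "x \<notin> C'" for x y
  proof -
    consider "(x, y) \<in> place 0 1 d1" | "(x, y) \<in> place 1 2 d2" | "(x, y) \<in> place 2 3 d3"
      using xy(1) by (auto simp: triple_def)
    then show ?thesis
    proof cases
      case 1
      then show ?thesis by (intro left_of_line[OF TL(1) _ C' _ _ xy(2)]) (auto intro: clos simp: triple_def)
    next
      case 2
      then show ?thesis by (intro left_of_line[OF TL(2) _ C' _ _ xy(2)]) (auto intro: clos simp: triple_def)
    next
      case 3
      then show ?thesis by (intro left_of_line[OF TL(3) _ C' _ _ xy(2)]) (auto intro: clos simp: triple_def)
    qed
  qed
  have pqT: "(p, q) \<in> (triple d1 d2 d3)\<^sup>*" using closed_curve_class[OF C pq(1)] pq(2) by blast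
  have pC': "p \<notin> C'" using pq by (simp add: C'_def)
  have "sym (triple d1 d2 d3)" unfolding triple_def by (intro sym_Un sym_place)
  from left_of_rtrancl[OF pqT pC' this clos step]
  have "even (left_of C' p) \<longleftrightarrow> even (left_of C' q)" .
  moreover have "left_of C x + left_of C' x + 1 = snd x" if "x \<in> C" for x
    unfolding C'_def using ran that by (intro left_of_complement) auto
  from this[OF pq(1)] this[OF pq(2)] have "snd p = left_of C p + left_of C' p + 1"
    "snd q = left_of C q + left_of C' q + 1" by simp_all
  ultimately show ?thesis by auto
qed

text \<open>Treats at once the four products occurring in the two bracketings: \<open>Z\<close> is
  the set of curves removed by one of them and \<open>a\<close> the gluing line on which they appear
  as loops. Different curves are disjoint and each curve of \<open>Z\<close> meets that line, so
  \<open>slice a\<close> is injective on \<open>Z\<close>.\<close>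

lemma slice_counts:
  assumes Z: "Z \<subseteq> closed_curves (2 * m) d1 d2 d3" and refl: "\<forall>C \<in> Z. reflect_point (2 * m) ` C \<in> Z"
    and ne: "\<forall>C \<in> Z. slice a C \<noteq> {}"
    and loops: "loops (2 * m) e1 e2 = slice a ` Z" and e1: "e1 \<in> TL_diagrams (2 * m)"
  shows "card (mirror_pairs m e1 e2) = card (curve_pairs m Z)"
    "card (white_loops m e1 e2) = card {C \<in> Z. reflect_point (2 * m) ` C = C \<and> curve_white m C}"
    "card (black_loops m e1 e2) = card {C \<in> Z. reflect_point (2 * m) ` C = C \<and> \<not> curve_white m C}"
proof -
  note mat = d[THEN JB_matching]
  let ?r = "reflect_point (2 * m)"
  have inj: "inj_on (slice a) Z"
  proof (rule inj_onI)
    fix C C' assume CC: "C \<in> Z" "C' \<in> Z" "slice a C = slice a C'"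
    then obtain i where "(a, i) \<in> C" "(a, i) \<in> C'" using ne by (fastforce simp: slice_def)
    then show "C = C'" using closed_curves_disjoint CC Z by blast
  qed
  have cross: "crosses_centre m (slice a C) \<longleftrightarrow> ?r ` C = C" if "C \<in> Z" for C
    using closed_curve_crosses[of C a] ne Z that by blast
  have white: "interior_white m e1 (slice a C) \<longleftrightarrow> curve_white m C" if "C \<in> Z" for C
  proof -
    have C: "C \<in> closed_curves (2 * m) d1 d2 d3" using that Z by blast
    then have "slice a C \<subseteq> {1..2 * m}" using closed_curve_range[OF mat C] by (auto simp: slice_def)
    then have "interior_white m e1 (slice a C) \<longleftrightarrow>
        (\<exists>i \<in> slice a C. even (card {j \<in> slice a C. j < i} + i + m))" by (rule interior_white_iff[OF e1])
    also have "\<dots> \<longleftrightarrow> (\<exists>p \<in> C. fst p = a \<and> even (left_of C p + snd p + m))"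
    proof -
      have "card {j \<in> slice a C. j < i} = left_of C (a, i)" for i by (simp add: slice_def left_of_def)
      then have "(\<exists>i \<in> slice a C. even (card {j \<in> slice a C. j < i} + i + m)) \<longleftrightarrow>
          (\<exists>i. (a, i) \<in> C \<and> even (left_of C (a, i) + i + m))" by (auto simp: slice_def)
      then show ?thesis by (simp add: Bex_def)
    qed
    also have "\<dots> \<longleftrightarrow> curve_white m C"
    proof
      assume "curve_white m C"
      then obtain p where p: "p \<in> C" "even (left_of C p + snd p + m)" by (auto simp: curve_white_def)
      \<comment> \<open>\<open>interior_white\<close> inspects only points on level
        \<open>a\<close>. A witness on the other level is exchanged for one here, which has the same
        parity.\<close>
      have "slice a C \<noteq> {}" using ne that by blast
      then obtain i where i: "(a, i) \<in> C" by (auto simp: slice_def)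
      then show "\<exists>p \<in> C. fst p = a \<and> even (left_of C p + snd p + m)"
        using closed_curve_colour[OF C p(1) i] p(2) by (intro bexI[OF _ i]) auto
    qed (auto simp: curve_white_def)
    finally show ?thesis .
  qed
  have sr: "slice a (?r ` C) = (\<lambda>i. 2 * m + 1 - i) ` slice a C" for C
    by (auto simp: slice_def reflect_point_def image_iff Bex_def)
  have "mirror_pairs m e1 e2 = (\<lambda>L. {L, (\<lambda>i. 2 * m + 1 - i) ` L}) ` slice a ` {C \<in> Z. ?r ` C \<noteq> C}"
    unfolding mirror_pairs_def loops using cross by (intro arg_cong[where f = "image _"]) auto
  also have "\<dots> = image (slice a) ` curve_pairs m Z"
    unfolding curve_pairs_def by (simp add: image_image sr)
  finally have "mirror_pairs m e1 e2 = image (slice a) ` curve_pairs m Z" .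
  \<comment> \<open>Mirror pairs are subsets of \<open>Z\<close>, as \<open>Z\<close> is closed
    under reflection, so injectivity on \<open>Z\<close> passes to them.\<close>
  moreover have "inj_on (image (slice a)) (curve_pairs m Z)"
    by (rule inj_on_subset[OF inj_on_image_Pow[OF inj]]) (use refl in \<open>auto simp: curve_pairs_def\<close>)
  ultimately show "card (mirror_pairs m e1 e2) = card (curve_pairs m Z)" by (simp add: card_image)
  have "white_loops m e1 e2 = slice a ` {C \<in> Z. ?r ` C = C \<and> curve_white m C}"
    unfolding white_loops_def loops using cross white by auto
  then show "card (white_loops m e1 e2) = card {C \<in> Z. ?r ` C = C \<and> curve_white m C}"
    using inj_on_subset[OF inj] by (simp add: card_image)
  have "black_loops m e1 e2 = slice a ` {C \<in> Z. ?r ` C = C \<and> \<not> curve_white m C}"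
    unfolding black_loops_def loops using cross white by auto
  then show "card (black_loops m e1 e2) = card {C \<in> Z. ?r ` C = C \<and> \<not> curve_white m C}"
    using inj_on_subset[OF inj] by (simp add: card_image)
qed

text \<open>Reflection preserves levels, so sorting curves by whether they meet level
  \<open>a\<close> separates no mirror pair. The choices a = 2 and a = 1 correspond to the two
  bracketings.\<close>

lemma card_curves_split:
  fixes a :: nat
  defines "Z \<equiv> closed_curves (2 * m) d1 d2 d3"
  defines "Z1 \<equiv> {C \<in> Z. slice a C = {}}" and "Z2 \<equiv> {C \<in> Z. slice a C \<noteq> {}}"
  shows "card (curve_pairs m Z) = card (curve_pairs m Z1) + card (curve_pairs m Z2)"
    "card {C \<in> Z. P C} = card {C \<in> Z1. P C} + card {C \<in> Z2. P C}"
    "\<forall>C \<in> Z1. reflect_point (2 * m) ` C \<in> Z1"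
    "\<forall>C \<in> Z2. reflect_point (2 * m) ` C \<in> Z2"
proof -
  have fin: "finite Z" by (simp add: Z_def finite_closed_curves)
  have sr: "slice a (reflect_point (2 * m) ` C) = {} \<longleftrightarrow> slice a C = {}" for C
    by (force simp: slice_def reflect_point_def)
  show r1: "\<forall>C \<in> Z1. reflect_point (2 * m) ` C \<in> Z1"
    using closed_curve_reflect by (simp add: Z1_def Z_def sr)
  show r2: "\<forall>C \<in> Z2. reflect_point (2 * m) ` C \<in> Z2"
    using closed_curve_reflect by (simp add: Z2_def Z_def sr)
  have Z: "Z = Z1 \<union> Z2" "Z1 \<inter> Z2 = {}" "finite Z1" "finite Z2"
    using fin by (auto simp: Z1_def Z2_def)
  have "{C \<in> Z. P C} = {C \<in> Z1. P C} \<union> {C \<in> Z2. P C}" using Z by auto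
  then show "card {C \<in> Z. P C} = card {C \<in> Z1. P C} + card {C \<in> Z2. P C}"
    using Z by (simp add: card_Un_disjoint disjoint_iff)
  have "curve_pairs m Z = curve_pairs m Z1 \<union> curve_pairs m Z2" using Z(1) by (auto simp: curve_pairs_def)
  moreover have "curve_pairs m Z1 \<inter> curve_pairs m Z2 = {}"
  proof -
    have "D \<subseteq> Z1" if "D \<in> curve_pairs m Z1" for D using that r1 by (auto simp: curve_pairs_def)
    moreover have "D \<subseteq> Z2" "D \<noteq> {}" if "D \<in> curve_pairs m Z2" for D
      using that r2 by (auto simp: curve_pairs_def)
    ultimately show ?thesis using Z(2) by blast
  qed
  moreover have "finite (curve_pairs m Z1)" "finite (curve_pairs m Z2)"
    using Z(3,4) by (auto simp: curve_pairs_def)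
  ultimately show "card (curve_pairs m Z) = card (curve_pairs m Z1) + card (curve_pairs m Z2)"
    by (simp add: card_Un_disjoint)
qed

text \<open>A curve confined to level \<open>a\<close> runs only through the two layers meeting
  there. \<open>P\<close> is the relation of these layers, and the hypotheses \<open>T\<close> say
  that every step of the stack leaving level \<open>a\<close> belongs to \<open>P\<close>.\<close>

lemma loops_one_level:
  assumes ab: "a \<in> {1, 2}" "b \<in> {1, 2}" "a \<noteq> b"
    and P: "P \<subseteq> triple d1 d2 d3"
    and T: "\<And>x y. (x, y) \<in> triple d1 d2 d3 \<Longrightarrow> fst x = a \<Longrightarrow> fst y = a \<or> (x, y) \<in> P"
      "\<And>x y. (x, y) \<in> triple d1 d2 d3 \<Longrightarrow> fst x = a \<Longrightarrow> fst y = a \<Longrightarrow> (x, y) \<in> P"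
  shows "{L. L \<noteq> {} \<and> L \<subseteq> {1..2 * m} \<and> (\<forall>i \<in> L. P\<^sup>* `` {(a, i)} = Pair a ` L)} =
    slice a ` {C \<in> closed_curves (2 * m) d1 d2 d3. slice b C = {}}"
proof
  note mat = d[THEN JB_matching]
  let ?T = "triple d1 d2 d3"
  show "{L. L \<noteq> {} \<and> L \<subseteq> {1..2 * m} \<and> (\<forall>i \<in> L. P\<^sup>* `` {(a, i)} = Pair a ` L)} \<subseteq>
    slice a ` {C \<in> closed_curves (2 * m) d1 d2 d3. slice b C = {}}"
  proof
    fix L assume "L \<in> {L. L \<noteq> {} \<and> L \<subseteq> {1..2 * m} \<and> (\<forall>i \<in> L. P\<^sup>* `` {(a, i)} = Pair a ` L)}"
    then have L: "L \<noteq> {}" "L \<subseteq> {1..2 * m}" "\<And>i. i \<in> L \<Longrightarrow> P\<^sup>* `` {(a, i)} = Pair a ` L" by auto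
    then obtain i where i: "i \<in> L" by auto
    have "?T\<^sup>* `` {(a, i)} = Pair a ` L"
    proof
      show "Pair a ` L \<subseteq> ?T\<^sup>* `` {(a, i)}" using L(3)[OF i] rtrancl_mono[OF P] by auto
      have "q \<in> Pair a ` L" if "((a, i), q) \<in> ?T\<^sup>*" for q
        using that
      proof (induction rule: rtrancl_induct)
        case (step y z)
        then obtain j where j: "y = (a, j)" "j \<in> L" by auto
        have "(y, z) \<in> P" using T(1)[OF step(2)] T(2)[OF step(2)] j by auto
        then show ?case using L(3)[OF j(2)] j(1) by auto
      qed (use i in auto)
      then show "?T\<^sup>* `` {(a, i)} \<subseteq> Pair a ` L" by auto
    qed
    moreover from this have "Pair a ` L \<in> closed_curves (2 * m) d1 d2 d3"
      using ab i L(2) by (intro closed_curvesI[of _ _ _ _ "(a, i)"]) auto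
    moreover have "slice a (Pair a ` L) = L" "slice b (Pair a ` L) = {}"
      using ab by (auto simp: slice_def)
    ultimately show "L \<in> slice a ` {C \<in> closed_curves (2 * m) d1 d2 d3. slice b C = {}}"
      by (metis (mono_tags, lifting) imageI mem_Collect_eq)
  qed
  show "slice a ` {C \<in> closed_curves (2 * m) d1 d2 d3. slice b C = {}} \<subseteq>
    {L. L \<noteq> {} \<and> L \<subseteq> {1..2 * m} \<and> (\<forall>i \<in> L. P\<^sup>* `` {(a, i)} = Pair a ` L)}"
  proof (rule image_subsetI)
    fix C assume "C \<in> {C \<in> closed_curves (2 * m) d1 d2 d3. slice b C = {}}"
    then have C: "C \<in> closed_curves (2 * m) d1 d2 d3" "slice b C = {}" by auto
    have ran: "C \<subseteq> {1, 2} \<times> {1..2 * m}" by (rule closed_curve_range[OF mat C(1)])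
    have levC: "fst x = a" if "x \<in> C" for x
    proof -
      have "fst x \<noteq> b" using C(2) that by (cases x) (auto simp: slice_def)
      then show ?thesis using ran that ab by auto
    qed
    have CL: "C = Pair a ` slice a C"
    proof (intro equalityI subsetI)
      fix x assume x: "x \<in> C"
      then have "x = (a, snd x)" using levC[OF x] by (simp add: prod_eq_iff)
      then show "x \<in> Pair a ` slice a C" using x by (auto simp: slice_def)
    qed (auto simp: slice_def)
    have "C \<noteq> {}" using C(1) by (auto simp: closed_curves_def)
    then have "slice a C \<noteq> {}" using CL by auto
    moreover have "slice a C \<subseteq> {1..2 * m}" using ran by (auto simp: slice_def)
    moreover have "P\<^sup>* `` {(a, i)} = Pair a ` slice a C" if "i \<in> slice a C" for i
    proof -
      have i: "(a, i) \<in> C" using that by (simp add: slice_def)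
      note cl = closed_curve_class[OF C(1) i]
      have "((a, i), q) \<in> P\<^sup>*" if "((a, i), q) \<in> ?T\<^sup>*" for q
        using that
      proof (induction rule: rtrancl_induct)
        case (step y z)
        have "y \<in> C" "z \<in> C" using step cl by auto
        then have "(y, z) \<in> P" using T(2)[OF step(2)] levC by blast
        then show ?case using step by auto
      qed simp
      then have "P\<^sup>* `` {(a, i)} = ?T\<^sup>* `` {(a, i)}" using rtrancl_mono[OF P] by auto
      then show ?thesis using cl CL by simp
    qed
    ultimately show "slice a C \<in> {L. L \<noteq> {} \<and> L \<subseteq> {1..2 * m} \<and> (\<forall>i \<in> L. P\<^sup>* `` {(a, i)} = Pair a ` L)}"
      by blast
  qed
qed

text \<open>\<open>P\<close> is the stack in which the layers meeting at level \<open>b\<close> have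
  been fused. It keeps the connections between points off level \<open>b\<close>, so its loops are
  the traces on level \<open>a\<close> of all curves that meet this level, including those that also
  run through level \<open>b\<close>.\<close>

lemma loops_two_levels:
  assumes ab: "a \<in> {1, 2}" "b \<in> {1, 2}" "a \<noteq> b"
    and P: "\<And>p q. fst p \<noteq> b \<Longrightarrow> fst q \<noteq> b \<Longrightarrow> (p, q) \<in> P\<^sup>* \<longleftrightarrow> (p, q) \<in> (triple d1 d2 d3)\<^sup>*"
    and lev: "\<And>p q. (p, q) \<in> P \<Longrightarrow> fst q \<noteq> b"
  shows "{L. L \<noteq> {} \<and> L \<subseteq> {1..2 * m} \<and> (\<forall>i \<in> L. P\<^sup>* `` {(a, i)} = Pair a ` L)} =
    slice a ` {C \<in> closed_curves (2 * m) d1 d2 d3. slice a C \<noteq> {}}"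
proof
  note mat = d[THEN JB_matching]
  let ?T = "triple d1 d2 d3"
  have PT: "P\<^sup>* `` {(a, i)} = {q \<in> ?T\<^sup>* `` {(a, i)}. fst q \<noteq> b}" for i
  proof -
    have "fst q \<noteq> b" if "((a, i), q) \<in> P\<^sup>*" for q
      using that by (cases rule: rtranclE) (use ab lev in auto)
    then show ?thesis using P[of "(a, i)"] ab by auto
  qed
  show "{L. L \<noteq> {} \<and> L \<subseteq> {1..2 * m} \<and> (\<forall>i \<in> L. P\<^sup>* `` {(a, i)} = Pair a ` L)} \<subseteq>
    slice a ` {C \<in> closed_curves (2 * m) d1 d2 d3. slice a C \<noteq> {}}"
  proof
    fix L assume "L \<in> {L. L \<noteq> {} \<and> L \<subseteq> {1..2 * m} \<and> (\<forall>i \<in> L. P\<^sup>* `` {(a, i)} = Pair a ` L)}"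
    then have L: "L \<noteq> {}" "L \<subseteq> {1..2 * m}" "\<And>i. i \<in> L \<Longrightarrow> P\<^sup>* `` {(a, i)} = Pair a ` L" by auto
    then obtain i where i: "i \<in> L" by auto
    let ?C = "?T\<^sup>* `` {(a, i)}"
    have eq: "{q \<in> ?C. fst q \<noteq> b} = Pair a ` L" using L(3)[OF i] PT[of i] by simp
    have "slice a ?C = L"
    proof -
      have "(a, j) \<in> ?C \<longleftrightarrow> j \<in> L" for j
      proof -
        have "(a, j) \<in> ?C \<longleftrightarrow> (a, j) \<in> {q \<in> ?C. fst q \<noteq> b}" using ab by simp
        also have "\<dots> \<longleftrightarrow> j \<in> L" unfolding eq by auto
        finally show ?thesis .
      qed
      then show ?thesis by (auto simp: slice_def)
    qed
    moreover have "?C \<in> closed_curves (2 * m) d1 d2 d3"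
    proof (rule closed_curvesI[OF refl])
      show "(a, i) \<in> {1, 2} \<times> {1..2 * m}" using ab i L(2) by auto
      show "?C \<subseteq> {1, 2} \<times> UNIV"
      proof
        fix q assume q: "q \<in> ?C"
        have "fst q = a \<or> fst q = b"
        proof (cases "fst q = b")
          case False
          then have "q \<in> Pair a ` L" using q eq by blast
          then show ?thesis by auto
        qed simp
        then show "q \<in> {1, 2} \<times> UNIV" using ab by (cases q) auto
      qed
    qed
    ultimately show "L \<in> slice a ` {C \<in> closed_curves (2 * m) d1 d2 d3. slice a C \<noteq> {}}"
      using L(1) by (metis (mono_tags, lifting) imageI mem_Collect_eq)
  qed
  show "slice a ` {C \<in> closed_curves (2 * m) d1 d2 d3. slice a C \<noteq> {}} \<subseteq>
    {L. L \<noteq> {} \<and> L \<subseteq> {1..2 * m} \<and> (\<forall>i \<in> L. P\<^sup>* `` {(a, i)} = Pair a ` L)}"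
  proof (rule image_subsetI)
    fix C assume "C \<in> {C \<in> closed_curves (2 * m) d1 d2 d3. slice a C \<noteq> {}}"
    then have C: "C \<in> closed_curves (2 * m) d1 d2 d3" "slice a C \<noteq> {}" by auto
    have ran: "C \<subseteq> {1, 2} \<times> {1..2 * m}" by (rule closed_curve_range[OF mat C(1)])
    have "slice a C \<subseteq> {1..2 * m}" using ran by (auto simp: slice_def)
    moreover have "P\<^sup>* `` {(a, i)} = Pair a ` slice a C" if "i \<in> slice a C" for i
    proof -
      have i: "(a, i) \<in> C" using that by (simp add: slice_def)
      have "P\<^sup>* `` {(a, i)} = {q \<in> C. fst q \<noteq> b}" using PT[of i] closed_curve_class[OF C(1) i] by simp
      also have "\<dots> = {q \<in> C. fst q = a}" using ran ab by auto
      also have "\<dots> = Pair a ` slice a C" by (force simp: slice_def)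
      finally show ?thesis .
    qed
    ultimately show "slice a C \<in> {L. L \<noteq> {} \<and> L \<subseteq> {1..2 * m} \<and> (\<forall>i \<in> L. P\<^sup>* `` {(a, i)} = Pair a ` L)}"
      using C(2) by blast
  qed
qed

text \<open>The first product removes the curves confined to its own gluing line. Every other curve
  meets the remaining line and is removed by the second product.\<close>

lemma loops_as_slices:
  shows "loops (2 * m) d1 d2 = slice 1 ` {C \<in> closed_curves (2 * m) d1 d2 d3. slice 2 C = {}}"
    and "loops (2 * m) (concat_diagram (2 * m) d1 d2) d3 =
      slice 2 ` {C \<in> closed_curves (2 * m) d1 d2 d3. slice 2 C \<noteq> {}}"
    and "loops (2 * m) d2 d3 = slice 2 ` {C \<in> closed_curves (2 * m) d1 d2 d3. slice 1 C = {}}"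
    and "loops (2 * m) d1 (concat_diagram (2 * m) d2 d3) =
      slice 1 ` {C \<in> closed_curves (2 * m) d1 d2 d3. slice 1 C \<noteq> {}}"
proof -
  note mat = d[THEN JB_matching]
  have "loops (2 * m) d1 d2 = {L. L \<noteq> {} \<and> L \<subseteq> {1..2 * m} \<and>
      (\<forall>i \<in> L. (place 0 1 d1 \<union> place 1 2 d2)\<^sup>* `` {(1, i)} = Pair 1 ` L)}"
    by (rule loops_relabel) auto
  also have "\<dots> = slice 1 ` {C \<in> closed_curves (2 * m) d1 d2 d3. slice 2 C = {}}"
    by (rule loops_one_level) (auto simp: triple_def dest: place_levels)
  finally show "loops (2 * m) d1 d2 = slice 1 ` {C \<in> closed_curves (2 * m) d1 d2 d3. slice 2 C = {}}" .
  have "loops (2 * m) d2 d3 = {L. L \<noteq> {} \<and> L \<subseteq> {1..2 * m} \<and>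
      (\<forall>i \<in> L. (place 1 2 d2 \<union> place 2 3 d3)\<^sup>* `` {(2, i)} = Pair 2 ` L)}"
    by (rule loops_relabel) auto
  also have "\<dots> = slice 2 ` {C \<in> closed_curves (2 * m) d1 d2 d3. slice 1 C = {}}"
    by (rule loops_one_level) (auto simp: triple_def dest: place_levels)
  finally show "loops (2 * m) d2 d3 = slice 2 ` {C \<in> closed_curves (2 * m) d1 d2 d3. slice 1 C = {}}" .
  have "loops (2 * m) (concat_diagram (2 * m) d1 d2) d3 = {L. L \<noteq> {} \<and> L \<subseteq> {1..2 * m} \<and>
      (\<forall>i \<in> L. (place 0 2 (concat_diagram (2 * m) d1 d2) \<union> place 2 3 d3)\<^sup>* `` {(2, i)} = Pair 2 ` L)}"
    by (rule loops_relabel) auto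
  also have "\<dots> = slice 2 ` {C \<in> closed_curves (2 * m) d1 d2 d3. slice 2 C \<noteq> {}}"
  proof (rule loops_two_levels)
    show "(p, q) \<in> (place 0 2 (concat_diagram (2 * m) d1 d2) \<union> place 2 3 d3)\<^sup>* \<longleftrightarrow>
        (p, q) \<in> (triple d1 d2 d3)\<^sup>*" if "fst p \<noteq> 1" "fst q \<noteq> 1" for p q
      unfolding triple_def by (rule place_concat_left[OF mat(1,2) that])
  qed (auto dest: place_levels)
  finally show "loops (2 * m) (concat_diagram (2 * m) d1 d2) d3 =
      slice 2 ` {C \<in> closed_curves (2 * m) d1 d2 d3. slice 2 C \<noteq> {}}" .
  have "loops (2 * m) d1 (concat_diagram (2 * m) d2 d3) = {L. L \<noteq> {} \<and> L \<subseteq> {1..2 * m} \<and>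
      (\<forall>i \<in> L. (place 0 1 d1 \<union> place 1 3 (concat_diagram (2 * m) d2 d3))\<^sup>* `` {(1, i)} = Pair 1 ` L)}"
    by (rule loops_relabel) auto
  also have "\<dots> = slice 1 ` {C \<in> closed_curves (2 * m) d1 d2 d3. slice 1 C \<noteq> {}}"
  proof (rule loops_two_levels)
    show "(p, q) \<in> (place 0 1 d1 \<union> place 1 3 (concat_diagram (2 * m) d2 d3))\<^sup>* \<longleftrightarrow>
        (p, q) \<in> (triple d1 d2 d3)\<^sup>*" if "fst p \<noteq> 2" "fst q \<noteq> 2" for p q
      unfolding triple_def by (rule place_concat_right[OF mat(2,3) that])
  qed (auto dest: place_levels)
  finally show "loops (2 * m) d1 (concat_diagram (2 * m) d2 d3) =
      slice 1 ` {C \<in> closed_curves (2 * m) d1 d2 d3. slice 1 C \<noteq> {}}" .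
qed

text \<open>Each side counts every closed curve of the triple stack once, and mirror type and colour
  belong to the curve, not to the gluing line at which it is removed.\<close>

lemma loop_counts_assoc:
  fixes d12 d23 :: diagram
  defines "d12 \<equiv> concat_diagram (2 * m) d1 d2" and "d23 \<equiv> concat_diagram (2 * m) d2 d3"
  shows "card (mirror_pairs m d1 d2) + card (mirror_pairs m d12 d3)
      = card (mirror_pairs m d2 d3) + card (mirror_pairs m d1 d23)"
    and "card (white_loops m d1 d2) + card (white_loops m d12 d3)
      = card (white_loops m d2 d3) + card (white_loops m d1 d23)"
    and "card (black_loops m d1 d2) + card (black_loops m d12 d3)
      = card (black_loops m d2 d3) + card (black_loops m d1 d23)"
proof -
  note mat = d[THEN JB_matching]
  let ?Z = "closed_curves (2 * m) d1 d2 d3"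
  have ne: "slice 1 C \<noteq> {} \<or> slice 2 C \<noteq> {}" if "C \<in> ?Z" for C
  proof -
    have "C \<noteq> {}" using that by (auto simp: closed_curves_def)
    then show ?thesis using closed_curve_range[OF mat that] by (force simp: slice_def)
  qed
  have TL: "d1 \<in> TL_diagrams (2 * m)" "d2 \<in> TL_diagrams (2 * m)" "d12 \<in> TL_diagrams (2 * m)"
    using d JB_TL concat_TL by (auto simp: d12_def)
  note L = loops_as_slices[folded d12_def d23_def]
  have sub: "{C \<in> ?Z. slice a C = {}} \<subseteq> ?Z" "{C \<in> ?Z. slice a C \<noteq> {}} \<subseteq> ?Z" for a by auto
  have ne1: "\<forall>C \<in> {C \<in> ?Z. slice 2 C = {}}. slice 1 C \<noteq> {}" using ne by auto
  have ne2: "\<forall>C \<in> {C \<in> ?Z. slice 1 C = {}}. slice 2 C \<noteq> {}" using ne by auto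
  have ne3: "\<forall>C \<in> {C \<in> ?Z. slice a C \<noteq> {}}. slice a C \<noteq> {}" for a by auto
  note c1 = slice_counts[OF sub(1) card_curves_split(3) ne1 L(1) TL(1)]
  note c2 = slice_counts[OF sub(2) card_curves_split(4) ne3 L(2) TL(3)]
  note c3 = slice_counts[OF sub(1) card_curves_split(3) ne2 L(3) TL(2)]
  note c4 = slice_counts[OF sub(2) card_curves_split(4) ne3 L(4) TL(1)]
  show "card (mirror_pairs m d1 d2) + card (mirror_pairs m d12 d3)
      = card (mirror_pairs m d2 d3) + card (mirror_pairs m d1 d23)"
    unfolding c1(1) c2(1) c3(1) c4(1)
    by (rule trans[OF card_curves_split(1)[symmetric] card_curves_split(1)])
  show "card (white_loops m d1 d2) + card (white_loops m d12 d3)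
      = card (white_loops m d2 d3) + card (white_loops m d1 d23)"
    unfolding c1(2) c2(2) c3(2) c4(2)
    by (rule trans[OF card_curves_split(2)[symmetric] card_curves_split(2)])
  show "card (black_loops m d1 d2) + card (black_loops m d12 d3)
      = card (black_loops m d2 d3) + card (black_loops m d1 d23)"
    unfolding c1(3) c2(3) c3(3) c4(3)
    by (rule trans[OF card_curves_split(2)[symmetric] card_curves_split(2)])
qed

end

section \<open>Unit and ring axioms\<close>

section \<open>The identity diagram\<close>

lemma id_diagram_JB: "id_diagram (2 * m) \<in> JB m"
proof (rule JB_I)
  let ?n = "2 * m"
  have "partition_on (vertices ?n) (id_diagram ?n)"
    by (rule partition_onI) (auto simp: id_diagram_def vertices_def disjnt_def)
  moreover have "\<not> crossing ?n k l" if "k \<in> id_diagram ?n" "l \<in> id_diagram ?n" for k l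
    using that by (auto simp: id_diagram_def crossing_def)
  moreover have "card l = 2" if "l \<in> id_diagram ?n" for l
    using that by (auto simp: id_diagram_def)
  ultimately show "id_diagram ?n \<in> TL_diagrams ?n" by (simp add: TL_diagrams_def)
  show "reflect_vertex ?n ` l \<in> id_diagram ?n" if l: "l \<in> id_diagram ?n" for l
  proof -
    obtain i where "i \<in> {1..?n}" "l = {North i, South i}" using l by (auto simp: id_diagram_def)
    then show ?thesis by (auto simp: id_diagram_def intro!: image_eqI[of _ _ "?n + 1 - i"])
  qed
qed

lemma placeI: "l \<in> d \<Longrightarrow> u \<in> l \<Longrightarrow> v \<in> l \<Longrightarrow> (emb a b u, emb a b v) \<in> place a b d"
  unfolding place_def by blast

lemma place_id_diagram: "(p, q) \<in> place a b (id_diagram n) \<longleftrightarrow>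
  (\<exists>i \<in> {1..n}. p \<in> {(a, i), (b, i)} \<and> q \<in> {(a, i), (b, i)})"
  unfolding place_def id_diagram_def by auto

lemma same_line_rtrancl:
  assumes d: "matching n d" and uv: "(u, v) \<in> {(u, v). \<exists>l \<in> d. u \<in> l \<and> v \<in> l}\<^sup>*" "u \<noteq> v"
  shows "{u, v} \<in> d"
proof -
  have "u = v \<or> (\<exists>l \<in> d. u \<in> l \<and> v \<in> l)"
    using uv(1)
  proof (induction rule: rtrancl_induct)
    case (step y z)
    then obtain l where "l \<in> d" "y \<in> l" "z \<in> l" by auto
    then show ?case using step.IH matching_unique[OF d] by metis
  qed simp
  then obtain l where l: "l \<in> d" "u \<in> l" "v \<in> l" using uv(2) by auto
  then have "l = {u, v}" using matching_line[OF d] uv(2) by blast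
  then show ?thesis using l by simp
qed

text \<open>\<open>f\<close> retracts the stack onto the boundary, collapsing each piece to a vertex
  or into a line of \<open>d\<close>. Hence connected outer points lie on a common line of
  \<open>d\<close>; the last hypothesis gives the converse.\<close>

lemma concat_eqI:
  assumes d: "matching n d"
    and f: "\<And>p q. (p, q) \<in> place 0 1 d1 \<union> place 1 2 d2 \<Longrightarrow> f p = f q \<or> (\<exists>l \<in> d. f p \<in> l \<and> f q \<in> l)"
    and outer: "\<And>u. f (outer u) = u"
    and conn: "\<And>u v. {u, v} \<in> d \<Longrightarrow> u \<in> vertices n \<Longrightarrow> v \<in> vertices n \<Longrightarrow>
      (outer u, outer v) \<in> connected_points d1 d2"
  shows "concat_diagram n d1 d2 = d"
proof
  let ?D = "{(u, v). \<exists>l \<in> d. u \<in> l \<and> v \<in> l}"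
  show "concat_diagram n d1 d2 \<subseteq> d"
  proof
    fix l assume "l \<in> concat_diagram n d1 d2"
    then obtain u v where uv: "l = {u, v}" "u \<noteq> v" "(outer u, outer v) \<in> connected_points d1 d2"
      by (auto simp: concat_diagram_def)
    have "(f (outer u), f (outer v)) \<in> (?D\<^sup>=)\<^sup>*"
      by (rule rtrancl_map[OF uv(3)[unfolded connected_points_place]]) (use f in blast)
    then have "(u, v) \<in> ?D\<^sup>*" by (simp add: outer)
    then show "l \<in> d" using same_line_rtrancl[OF d] uv by simp
  qed
  show "d \<subseteq> concat_diagram n d1 d2"
  proof
    fix l assume l: "l \<in> d"
    then have "card l = 2" using d by (simp add: matching_def)
    then obtain u v where uv: "l = {u, v}" "u \<noteq> v" by (auto simp: card_2_iff)
    have "u \<in> vertices n" "v \<in> vertices n" using matching_Union[OF d] uv l by blast+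
    then show "l \<in> concat_diagram n d1 d2" using conn uv l unfolding concat_diagram_def by blast
  qed
qed

lemma concat_id_left:
  assumes d: "matching n d"
  shows "concat_diagram n (id_diagram n) d = d"
\<comment> \<open>The strands of the identity are contracted upwards: levels 0 and 1 both become the
  northern edge.\<close>
proof (rule concat_eqI[OF d, where f = "\<lambda>p. if fst p = 2 then South (snd p) else North (snd p)"])
  let ?f = "\<lambda>p. if fst p = 2 then South (snd p) else North (snd p)"
  have emb: "?f (emb 1 2 u) = u" "?f (outer u) = u" for u by (cases u; simp)+
  show "?f (outer u) = u" for u by (rule emb)
  fix p q assume "(p, q) \<in> place 0 1 (id_diagram n) \<union> place 1 2 d"
  then show "?f p = ?f q \<or> (\<exists>l \<in> d. ?f p \<in> l \<and> ?f q \<in> l)"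
  proof
    assume "(p, q) \<in> place 1 2 d"
    then obtain l u v where l: "l \<in> d" "u \<in> l" "v \<in> l" "p = emb 1 2 u" "q = emb 1 2 v"
      by (auto simp: place_def)
    have "?f p = u" "?f q = v" unfolding l(4,5) by (rule emb)+
    then show ?thesis using l(1-3) by metis
  next
    assume "(p, q) \<in> place 0 1 (id_diagram n)"
    then obtain i where "p \<in> {(0, i), (1, i)}" "q \<in> {(0, i), (1, i)}"
      unfolding place_id_diagram by blast
    then have "?f p = ?f q" by auto
    then show ?thesis by (rule disjI1)
  qed
next
  have *: "(outer u, emb 1 2 u) \<in> connected_points (id_diagram n) d" if "u \<in> vertices n" for u
  proof (cases u)
    case (North i)
    then have "(outer u, emb 1 2 u) \<in> place 0 1 (id_diagram n)"
      using \<open>u \<in> vertices n\<close> by (simp add: place_id_diagram)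
    then show ?thesis unfolding connected_points_place by (intro r_into_rtrancl UnI1)
  qed simp
  fix u v assume uv: "{u, v} \<in> d" "u \<in> vertices n" "v \<in> vertices n"
  have "(emb 1 2 u, emb 1 2 v) \<in> place 1 2 d" by (rule placeI[OF uv(1)]) simp_all
  then have "(emb 1 2 u, emb 1 2 v) \<in> connected_points (id_diagram n) d"
    unfolding connected_points_place by (intro r_into_rtrancl UnI2)
  then show "(outer u, outer v) \<in> connected_points (id_diagram n) d"
    using *[OF uv(2)] connected_points_sym[OF *[OF uv(3)]] connected_points_trans by blast
qed

lemma concat_id_right:
  assumes d: "matching n d"
  shows "concat_diagram n d (id_diagram n) = d"
\<comment> \<open>Here the strands are contracted downwards: levels 1 and 2 both become the southern
  edge.\<close>
proof (rule concat_eqI[OF d, where f = "\<lambda>p. if fst p = 0 then North (snd p) else South (snd p)"])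
  let ?f = "\<lambda>p. if fst p = 0 then North (snd p) else South (snd p)"
  have emb: "?f (emb 0 1 u) = u" "?f (outer u) = u" for u by (cases u; simp)+
  show "?f (outer u) = u" for u by (rule emb)
  fix p q assume "(p, q) \<in> place 0 1 d \<union> place 1 2 (id_diagram n)"
  then show "?f p = ?f q \<or> (\<exists>l \<in> d. ?f p \<in> l \<and> ?f q \<in> l)"
  proof
    assume "(p, q) \<in> place 0 1 d"
    then obtain l u v where l: "l \<in> d" "u \<in> l" "v \<in> l" "p = emb 0 1 u" "q = emb 0 1 v"
      by (auto simp: place_def)
    have "?f p = u" "?f q = v" unfolding l(4,5) by (rule emb)+
    then show ?thesis using l(1-3) by metis
  next
    assume "(p, q) \<in> place 1 2 (id_diagram n)"
    then obtain i where "p \<in> {(1, i), (2, i)}" "q \<in> {(1, i), (2, i)}"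
      unfolding place_id_diagram by blast
    then have "?f p = ?f q" by auto
    then show ?thesis by (rule disjI1)
  qed
next
  have *: "(outer u, emb 0 1 u) \<in> connected_points d (id_diagram n)" if "u \<in> vertices n" for u
  proof (cases u)
    case (South i)
    then have "(outer u, emb 0 1 u) \<in> place 1 2 (id_diagram n)"
      using \<open>u \<in> vertices n\<close> by (simp add: place_id_diagram)
    then show ?thesis unfolding connected_points_place by (intro r_into_rtrancl UnI2)
  qed simp
  fix u v assume uv: "{u, v} \<in> d" "u \<in> vertices n" "v \<in> vertices n"
  have "(emb 0 1 u, emb 0 1 v) \<in> place 0 1 d" by (rule placeI[OF uv(1)]) simp_all
  then have "(emb 0 1 u, emb 0 1 v) \<in> connected_points d (id_diagram n)"
    unfolding connected_points_place by (intro r_into_rtrancl UnI1)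
  then show "(outer u, outer v) \<in> connected_points d (id_diagram n)"
    using *[OF uv(2)] connected_points_sym[OF *[OF uv(3)]] connected_points_trans by blast
qed

text \<open>A strand of the identity leads from each middle point straight to an outer edge, so no
  component stays on the gluing line.\<close>

lemma loops_id: "loops n (id_diagram n) d = {}" "loops n d (id_diagram n) = {}"
proof -
  have 1: "((1, i), (0, i)) \<in> connected_points (id_diagram n) d"
    "((1, i), (2, i)) \<in> connected_points d (id_diagram n)" if "i \<in> {1..n}" for i
    using that by (auto simp: connected_points_place place_id_diagram intro!: r_into_rtrancl)
  show "loops n (id_diagram n) d = {}"
  proof (rule equals0I)
    fix L assume L: "L \<in> loops n (id_diagram n) d"
    then have "L \<noteq> {}" "L \<subseteq> {1..n}" by (auto simp: loops_def)
    then obtain i where i: "i \<in> L" "i \<in> {1..n}" by blast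
    then have "connected_points (id_diagram n) d `` {(1, i)} = Pair 1 ` L" using L by (simp add: loops_def)
    then have "(0, i) \<in> Pair (1 :: nat) ` L" using 1(1)[OF i(2)] by (simp add: set_eq_iff)
    then show False by auto
  qed
  show "loops n d (id_diagram n) = {}"
  proof (rule equals0I)
    fix L assume L: "L \<in> loops n d (id_diagram n)"
    then have "L \<noteq> {}" "L \<subseteq> {1..n}" by (auto simp: loops_def)
    then obtain i where i: "i \<in> L" "i \<in> {1..n}" by blast
    then have "connected_points d (id_diagram n) `` {(1, i)} = Pair 1 ` L" using L by (simp add: loops_def)
    then have "(2, i) \<in> Pair (1 :: nat) ` L" using 1(2)[OF i(2)] by (simp add: set_eq_iff)
    then show False by auto
  qed
qed

section \<open>Iterated finite sums\<close>

context abelian_monoid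
begin

lemma finsum_swap:
  assumes "finite A" "finite B" and "\<And>a b. a \<in> A \<Longrightarrow> b \<in> B \<Longrightarrow> f a b \<in> carrier G"
  shows "(\<Oplus>a\<in>A. \<Oplus>b\<in>B. f a b) = (\<Oplus>b\<in>B. \<Oplus>a\<in>A. f a b)"
  using assms(1,3)
proof (induction A)
  case (insert x A)
  have "(\<Oplus>b\<in>B. \<Oplus>a\<in>insert x A. f a b) = (\<Oplus>b\<in>B. f x b \<oplus> (\<Oplus>a\<in>A. f a b))"
    using insert by (intro finsum_cong') (auto intro!: finsum_closed)
  also have "\<dots> = (\<Oplus>b\<in>B. f x b) \<oplus> (\<Oplus>b\<in>B. \<Oplus>a\<in>A. f a b)"
    using insert by (intro finsum_addf) (auto intro!: finsum_closed)
  finally show ?case using insert by (simp add: finsum_closed Pi_def)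
qed (simp add: finsum_zero)

lemma finsum_Times:
  assumes "finite A" "finite B" and "\<And>a b. a \<in> A \<Longrightarrow> b \<in> B \<Longrightarrow> f (a, b) \<in> carrier G"
  shows "(\<Oplus>p\<in>A \<times> B. f p) = (\<Oplus>a\<in>A. \<Oplus>b\<in>B. f (a, b))"
  using assms(1,3)
proof (induction A)
  case (insert x A)
  have "(\<Oplus>p\<in>Pair x ` B. f p) = (\<Oplus>b\<in>B. f (x, b))"
    using insert by (intro finsum_reindex) (auto simp: inj_on_def)
  moreover have "(\<Oplus>p\<in>Pair x ` B \<union> A \<times> B. f p) = (\<Oplus>p\<in>Pair x ` B. f p) \<oplus> (\<Oplus>p\<in>A \<times> B. f p)"
    using insert assms(2) by (intro finsum_Un_disjoint) auto
  moreover have "insert x A \<times> B = Pair x ` B \<union> A \<times> B" by auto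
  ultimately show ?case using insert by (simp add: finsum_closed Pi_def)
qed simp

lemma finsum_filter:
  assumes "finite A" and "\<And>a. a \<in> A \<Longrightarrow> f a \<in> carrier G"
  shows "(\<Oplus>a\<in>{a \<in> A. P a}. f a) = (\<Oplus>a\<in>A. if P a then f a else \<zero>)"
  using assms by (intro add.finprod_mono_neutral_cong_left) (auto simp: Pi_def)

lemma finsum_add_add:
  assumes "\<And>a b. a \<in> A \<Longrightarrow> b \<in> B \<Longrightarrow> f a b \<in> carrier G" "\<And>a b. a \<in> A \<Longrightarrow> b \<in> B \<Longrightarrow> g a b \<in> carrier G"
  shows "(\<Oplus>a\<in>A. \<Oplus>b\<in>B. f a b \<oplus> g a b) = (\<Oplus>a\<in>A. \<Oplus>b\<in>B. f a b) \<oplus> (\<Oplus>a\<in>A. \<Oplus>b\<in>B. g a b)"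
proof -
  have "(\<Oplus>a\<in>A. \<Oplus>b\<in>B. f a b \<oplus> g a b) = (\<Oplus>a\<in>A. (\<Oplus>b\<in>B. f a b) \<oplus> (\<Oplus>b\<in>B. g a b))"
    using assms by (intro finsum_cong' finsum_addf) (auto intro!: finsum_closed)
  also have "\<dots> = (\<Oplus>a\<in>A. \<Oplus>b\<in>B. f a b) \<oplus> (\<Oplus>a\<in>A. \<Oplus>b\<in>B. g a b)"
    using assms by (intro finsum_addf) (auto intro!: finsum_closed)
  finally show ?thesis .
qed

lemma finsum_delta:
  assumes "finite A" "x \<in> A" and "f x \<in> carrier G"
  shows "(\<Oplus>a\<in>A. if a = x then f a else \<zero>) = f x"
proof -
  have "(\<Oplus>a\<in>A. if a = x then f a else \<zero>) = (\<Oplus>a\<in>A. if x = a then f x else \<zero>)"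
    using assms by (intro finsum_cong') auto
  also have "\<dots> = f x" using finsum_singleton[of x A "\<lambda>_. f x"] assms by simp
  finally show ?thesis .
qed

end

section \<open>The ring structure\<close>

lemma finite_JB: "finite (JB m)"
proof (rule finite_subset)
  show "JB m \<subseteq> Pow (Pow (vertices (2 * m)))"
    using matching_Union[OF JB_matching] by blast
qed simp

context cring
begin

context
  fixes m :: nat and \<alpha> \<beta> \<gamma> :: 'a
  assumes params: "\<alpha> \<in> carrier R" "\<beta> \<in> carrier R" "\<gamma> \<in> carrier R"
begin

abbreviation (input) "diags \<equiv> JB m"
abbreviation (input) "wt \<equiv> loop_weight R m \<alpha> \<beta> \<gamma>"
abbreviation (input) "cat \<equiv> concat_diagram (2 * m)"
abbreviation (input) "alg \<equiv> b_prime R m \<alpha> \<beta> \<gamma>"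

lemma weight_closed [simp]: "wt a b \<in> carrier R"
  using params by (simp add: loop_weight_def)

text \<open>The exponents agree by \<open>loop_counts_assoc\<close>. This is the 2-cocycle condition
  that makes the weighted product associative.\<close>

lemma weight_cocycle:
  assumes "a \<in> diags" "b \<in> diags" "c \<in> diags"
  shows "wt a b \<otimes> wt (cat a b) c = wt b c \<otimes> wt a (cat b c)"
proof -
  have *: "(\<alpha> [^] k1 \<otimes> \<beta> [^] k2 \<otimes> \<gamma> [^] k3) \<otimes> (\<alpha> [^] l1 \<otimes> \<beta> [^] l2 \<otimes> \<gamma> [^] l3) =
      \<alpha> [^] (k1 + l1) \<otimes> \<beta> [^] (k2 + l2) \<otimes> \<gamma> [^] (k3 + l3)" for k1 k2 k3 l1 l2 l3 :: nat
    using params by (simp add: nat_pow_mult[symmetric] m_ac)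
  show ?thesis unfolding loop_weight_def * loop_counts_assoc[OF assms] ..
qed

lemma weight_id: "wt (id_diagram (2 * m)) b = \<one>" "wt a (id_diagram (2 * m)) = \<one>"
  by (simp_all add: loop_weight_def mirror_pairs_def white_loops_def black_loops_def loops_id)

lemma mult_eq:
  assumes f: "f \<in> diags \<rightarrow>\<^sub>E carrier R" and g: "g \<in> diags \<rightarrow>\<^sub>E carrier R" and c: "c \<in> diags"
  shows "(f \<otimes>\<^bsub>alg\<^esub> g) c = (\<Oplus>a\<in>diags. \<Oplus>b\<in>diags. if cat a b = c then f a \<otimes> g b \<otimes> wt a b else \<zero>)"
proof -
  have fg: "a \<in> diags \<Longrightarrow> f a \<in> carrier R" "a \<in> diags \<Longrightarrow> g a \<in> carrier R" for a using f g by auto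
  have "(f \<otimes>\<^bsub>alg\<^esub> g) c = (\<Oplus>p\<in>{p \<in> diags \<times> diags. cat (fst p) (snd p) = c}.
      f (fst p) \<otimes> g (snd p) \<otimes> wt (fst p) (snd p))" using c by (simp add: b_prime_def)
  also have "\<dots> = (\<Oplus>p\<in>diags \<times> diags. if cat (fst p) (snd p) = c then
      f (fst p) \<otimes> g (snd p) \<otimes> wt (fst p) (snd p) else \<zero>)"
    using fg by (intro finsum_filter) (auto simp: finite_JB)
  also have "\<dots> = (\<Oplus>a\<in>diags. \<Oplus>b\<in>diags. if cat a b = c then f a \<otimes> g b \<otimes> wt a b else \<zero>)"
    using fg by (subst finsum_Times) (auto simp: finite_JB cong: if_cong)
  finally show ?thesis .
qed

lemma b_carrier: "carrier alg = diags \<rightarrow>\<^sub>E carrier R" by (simp add: b_prime_def)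

lemma mult_closed:
  assumes f: "f \<in> diags \<rightarrow>\<^sub>E carrier R" and g: "g \<in> diags \<rightarrow>\<^sub>E carrier R"
  shows "f \<otimes>\<^bsub>alg\<^esub> g \<in> diags \<rightarrow>\<^sub>E carrier R"
proof (rule PiE_I)
  fix c assume c: "c \<in> diags"
  have "f a \<in> carrier R" "g a \<in> carrier R" if "a \<in> diags" for a using f g that by auto
  then show "(f \<otimes>\<^bsub>alg\<^esub> g) c \<in> carrier R" unfolding mult_eq[OF f g c] by (intro finsum_closed) auto
qed (simp add: b_prime_def)

text \<open>Summing a product against a test function removes the condition on the concatenation.
  Each bracketing of a triple product can then be expanded into a sum over three independent
  diagrams.\<close>

lemma mult_pairing:
  assumes f: "f \<in> diags \<rightarrow>\<^sub>E carrier R" and g: "g \<in> diags \<rightarrow>\<^sub>E carrier R"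
    and \<psi>: "\<And>c. c \<in> diags \<Longrightarrow> \<psi> c \<in> carrier R"
  shows "(\<Oplus>c\<in>diags. (f \<otimes>\<^bsub>alg\<^esub> g) c \<otimes> \<psi> c) = (\<Oplus>a\<in>diags. \<Oplus>b\<in>diags. f a \<otimes> g b \<otimes> wt a b \<otimes> \<psi> (cat a b))"
proof -
  have fg [simp]: "a \<in> diags \<Longrightarrow> f a \<in> carrier R" "a \<in> diags \<Longrightarrow> g a \<in> carrier R" for a using f g by auto
  have cat [simp]: "a \<in> diags \<Longrightarrow> b \<in> diags \<Longrightarrow> cat a b \<in> diags" for a b by (rule concat_JB)
  have "(f \<otimes>\<^bsub>alg\<^esub> g) c \<otimes> \<psi> c = (\<Oplus>a\<in>diags. \<Oplus>b\<in>diags. if c = cat a b then f a \<otimes> g b \<otimes> wt a b \<otimes> \<psi> c else \<zero>)"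
    if c: "c \<in> diags" for c
  proof -
    have "(f \<otimes>\<^bsub>alg\<^esub> g) c \<otimes> \<psi> c = (\<Oplus>a\<in>diags. (\<Oplus>b\<in>diags. if cat a b = c then f a \<otimes> g b \<otimes> wt a b else \<zero>) \<otimes> \<psi> c)"
      unfolding mult_eq[OF f g c] using c \<psi> by (intro finsum_ldistr finite_JB) (auto intro!: finsum_closed)
    also have "\<dots> = (\<Oplus>a\<in>diags. \<Oplus>b\<in>diags. (if cat a b = c then f a \<otimes> g b \<otimes> wt a b else \<zero>) \<otimes> \<psi> c)"
      using c \<psi> by (intro finsum_cong' finsum_ldistr finite_JB) (auto intro!: finsum_closed)
    also have "\<dots> = (\<Oplus>a\<in>diags. \<Oplus>b\<in>diags. if c = cat a b then f a \<otimes> g b \<otimes> wt a b \<otimes> \<psi> c else \<zero>)"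
      using c \<psi> by (intro finsum_cong') (auto intro!: finsum_closed)
    finally show ?thesis .
  qed
  then have "(\<Oplus>c\<in>diags. (f \<otimes>\<^bsub>alg\<^esub> g) c \<otimes> \<psi> c) =
      (\<Oplus>c\<in>diags. \<Oplus>a\<in>diags. \<Oplus>b\<in>diags. if c = cat a b then f a \<otimes> g b \<otimes> wt a b \<otimes> \<psi> c else \<zero>)"
    using \<psi> by (intro finsum_cong') (auto intro!: finsum_closed)
  also have "\<dots> = (\<Oplus>a\<in>diags. \<Oplus>c\<in>diags. \<Oplus>b\<in>diags. if c = cat a b then f a \<otimes> g b \<otimes> wt a b \<otimes> \<psi> c else \<zero>)"
    using \<psi> by (intro finsum_swap finite_JB finsum_closed) auto
  also have "\<dots> = (\<Oplus>a\<in>diags. \<Oplus>b\<in>diags. \<Oplus>c\<in>diags. if c = cat a b then f a \<otimes> g b \<otimes> wt a b \<otimes> \<psi> c else \<zero>)"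
    using \<psi> by (intro finsum_cong' finsum_swap finite_JB) (auto intro!: finsum_closed)
  also have "\<dots> = (\<Oplus>a\<in>diags. \<Oplus>b\<in>diags. f a \<otimes> g b \<otimes> wt a b \<otimes> \<psi> (cat a b))"
    using \<psi> by (intro finsum_cong' finsum_delta finite_JB) (auto intro!: finsum_closed)
  finally show ?thesis .
qed

lemma mult_assoc_b:
  assumes f: "f \<in> diags \<rightarrow>\<^sub>E carrier R" and g: "g \<in> diags \<rightarrow>\<^sub>E carrier R" and h: "h \<in> diags \<rightarrow>\<^sub>E carrier R"
  shows "(f \<otimes>\<^bsub>alg\<^esub> g) \<otimes>\<^bsub>alg\<^esub> h = f \<otimes>\<^bsub>alg\<^esub> (g \<otimes>\<^bsub>alg\<^esub> h)"
proof (rule PiE_ext[OF mult_closed[OF mult_closed[OF f g] h] mult_closed[OF f mult_closed[OF g h]]])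
  fix c assume c: "c \<in> diags"
  have fgh [simp]: "a \<in> diags \<Longrightarrow> f a \<in> carrier R" "a \<in> diags \<Longrightarrow> g a \<in> carrier R" "a \<in> diags \<Longrightarrow> h a \<in> carrier R" for a
    using f g h by auto
  have m [simp]: "a \<in> diags \<Longrightarrow> (f \<otimes>\<^bsub>alg\<^esub> g) a \<in> carrier R" "a \<in> diags \<Longrightarrow> (g \<otimes>\<^bsub>alg\<^esub> h) a \<in> carrier R" for a
    using mult_closed[OF f g] mult_closed[OF g h] by auto
  have cat [simp]: "a \<in> diags \<Longrightarrow> b \<in> diags \<Longrightarrow> cat a b \<in> diags" for a b by (rule concat_JB)
  \<comment> \<open>The indicator of \<open>c\<close>. With it as part of the test function, the
    coefficient at \<open>c\<close> becomes an unrestricted sum to which \<open>mult_pairing\<close>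
    applies.\<close>
  define \<chi> where "\<chi> d = (if d = c then \<one> else \<zero>)" for d
  have \<chi> [simp]: "\<chi> d \<in> carrier R" for d by (simp add: \<chi>_def)
  have "((f \<otimes>\<^bsub>alg\<^esub> g) \<otimes>\<^bsub>alg\<^esub> h) c =
      (\<Oplus>x\<in>diags. \<Oplus>z\<in>diags. (f \<otimes>\<^bsub>alg\<^esub> g) x \<otimes> (h z \<otimes> wt x z \<otimes> \<chi> (cat x z)))"
    unfolding mult_eq[OF mult_closed[OF f g] h c]
    by (intro finsum_cong') (auto intro!: finsum_closed simp: \<chi>_def m_assoc)
  also have "\<dots> = (\<Oplus>z\<in>diags. \<Oplus>x\<in>diags. (f \<otimes>\<^bsub>alg\<^esub> g) x \<otimes> (h z \<otimes> wt x z \<otimes> \<chi> (cat x z)))"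
    by (intro finsum_swap finite_JB) auto
  also have "\<dots> = (\<Oplus>z\<in>diags. \<Oplus>a\<in>diags. \<Oplus>b\<in>diags. f a \<otimes> g b \<otimes> wt a b \<otimes>
      (h z \<otimes> wt (cat a b) z \<otimes> \<chi> (cat (cat a b) z)))"
    by (intro finsum_cong' mult_pairing[OF f g]) (auto intro!: finsum_closed)
  also have "\<dots> = (\<Oplus>a\<in>diags. \<Oplus>z\<in>diags. \<Oplus>b\<in>diags. f a \<otimes> g b \<otimes> wt a b \<otimes>
      (h z \<otimes> wt (cat a b) z \<otimes> \<chi> (cat (cat a b) z)))"
    by (intro finsum_swap finite_JB finsum_closed) auto
  also have "\<dots> = (\<Oplus>a\<in>diags. \<Oplus>b\<in>diags. \<Oplus>z\<in>diags. f a \<otimes> g b \<otimes> wt a b \<otimes>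
      (h z \<otimes> wt (cat a b) z \<otimes> \<chi> (cat (cat a b) z)))"
    by (intro finsum_cong' finsum_swap finite_JB) (auto intro!: finsum_closed)
  also have "\<dots> = (\<Oplus>a\<in>diags. \<Oplus>b\<in>diags. \<Oplus>z\<in>diags. g b \<otimes> h z \<otimes> wt b z \<otimes>
      (f a \<otimes> wt a (cat b z) \<otimes> \<chi> (cat a (cat b z))))"
  proof (intro finsum_cong' Pi_I finsum_closed refl)
    \<comment> \<open>The two triple sums agree term by term, by associativity of concatenation and
      the cocycle identity.\<close>
    fix a b z assume abz: "a \<in> diags" "b \<in> diags" "z \<in> diags"
    have assoc: "cat (cat a b) z = cat a (cat b z)"
      by (rule concat_assoc) (use abz JB_matching in auto)
    have "f a \<otimes> g b \<otimes> wt a b \<otimes> (h z \<otimes> wt (cat a b) z \<otimes> \<chi> (cat (cat a b) z))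
        = f a \<otimes> g b \<otimes> h z \<otimes> (wt a b \<otimes> wt (cat a b) z) \<otimes> \<chi> (cat (cat a b) z)"
      using abz by (simp add: m_ac)
    also have "\<dots> = f a \<otimes> g b \<otimes> h z \<otimes> (wt b z \<otimes> wt a (cat b z)) \<otimes> \<chi> (cat (cat a b) z)"
      by (simp only: weight_cocycle[OF abz])
    also have "\<dots> = g b \<otimes> h z \<otimes> wt b z \<otimes> (f a \<otimes> wt a (cat b z) \<otimes> \<chi> (cat a (cat b z)))"
      using abz by (simp add: m_ac assoc)
    finally show "f a \<otimes> g b \<otimes> wt a b \<otimes> (h z \<otimes> wt (cat a b) z \<otimes> \<chi> (cat (cat a b) z)) =
        g b \<otimes> h z \<otimes> wt b z \<otimes> (f a \<otimes> wt a (cat b z) \<otimes> \<chi> (cat a (cat b z)))" .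
  qed auto
  also have "\<dots> = (\<Oplus>a\<in>diags. \<Oplus>y\<in>diags. (g \<otimes>\<^bsub>alg\<^esub> h) y \<otimes> (f a \<otimes> wt a y \<otimes> \<chi> (cat a y)))"
    by (intro finsum_cong' mult_pairing[OF g h, symmetric]) (auto intro!: finsum_closed)
  also have "\<dots> = (f \<otimes>\<^bsub>alg\<^esub> (g \<otimes>\<^bsub>alg\<^esub> h)) c"
    unfolding mult_eq[OF f mult_closed[OF g h] c]
    by (intro finsum_cong') (auto intro!: finsum_closed simp: \<chi>_def m_ac)
  finally show "((f \<otimes>\<^bsub>alg\<^esub> g) \<otimes>\<^bsub>alg\<^esub> h) c = (f \<otimes>\<^bsub>alg\<^esub> (g \<otimes>\<^bsub>alg\<^esub> h)) c" .
qed

lemma one_closed_b: "\<one>\<^bsub>alg\<^esub> \<in> diags \<rightarrow>\<^sub>E carrier R"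
  by (auto simp: b_prime_def)

lemma mult_one_left:
  assumes f: "f \<in> diags \<rightarrow>\<^sub>E carrier R"
  shows "\<one>\<^bsub>alg\<^esub> \<otimes>\<^bsub>alg\<^esub> f = f"
proof (rule PiE_ext[OF mult_closed[OF one_closed_b f] f])
  fix c assume c: "c \<in> diags"
  have [simp]: "a \<in> diags \<Longrightarrow> f a \<in> carrier R" for a using f by auto
  let ?id = "id_diagram (2 * m)"
  have cid: "cat ?id b = b" if "b \<in> diags" for b using concat_id_left JB_matching that by blast
  have "(\<one>\<^bsub>alg\<^esub> \<otimes>\<^bsub>alg\<^esub> f) c =
      (\<Oplus>a\<in>diags. if a = ?id then (\<Oplus>b\<in>diags. if b = c then f b else \<zero>) else \<zero>)"
    unfolding mult_eq[OF one_closed_b f c]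
  proof (intro finsum_cong' Pi_I refl)
    fix a assume a: "a \<in> diags"
    show "(\<Oplus>b\<in>diags. if cat a b = c then \<one>\<^bsub>alg\<^esub> a \<otimes> f b \<otimes> wt a b else \<zero>)
        = (if a = ?id then (\<Oplus>b\<in>diags. if b = c then f b else \<zero>) else \<zero>)"
    proof (cases "a = ?id")
      case True
      have "(\<Oplus>b\<in>diags. if cat a b = c then \<one>\<^bsub>alg\<^esub> a \<otimes> f b \<otimes> wt a b else \<zero>) =
          (\<Oplus>b\<in>diags. if b = c then f b else \<zero>)"
        using True cid a by (intro finsum_cong') (auto simp: b_prime_def weight_id)
      then show ?thesis using True by simp
    next
      case False
      then have "(\<Oplus>b\<in>diags. if cat a b = c then \<one>\<^bsub>alg\<^esub> a \<otimes> f b \<otimes> wt a b else \<zero>) = (\<Oplus>b\<in>diags. \<zero>)"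
        using a by (intro finsum_cong') (auto simp: b_prime_def)
      then show ?thesis using False by (simp add: finsum_zero)
    qed
  qed (auto intro!: finsum_closed)
  also have "\<dots> = (\<Oplus>b\<in>diags. if b = c then f b else \<zero>)"
    by (intro finsum_delta finite_JB id_diagram_JB finsum_closed) auto
  also have "\<dots> = f c" using c by (intro finsum_delta finite_JB) auto
  finally show "(\<one>\<^bsub>alg\<^esub> \<otimes>\<^bsub>alg\<^esub> f) c = f c" .
qed

lemma mult_one_right:
  assumes f: "f \<in> diags \<rightarrow>\<^sub>E carrier R"
  shows "f \<otimes>\<^bsub>alg\<^esub> \<one>\<^bsub>alg\<^esub> = f"
proof (rule PiE_ext[OF mult_closed[OF f one_closed_b] f])
  fix c assume c: "c \<in> diags"
  have [simp]: "a \<in> diags \<Longrightarrow> f a \<in> carrier R" for a using f by auto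
  let ?id = "id_diagram (2 * m)"
  have cid: "cat b ?id = b" if "b \<in> diags" for b using concat_id_right JB_matching that by blast
  have "(f \<otimes>\<^bsub>alg\<^esub> \<one>\<^bsub>alg\<^esub>) c = (\<Oplus>a\<in>diags. if a = c then f a else \<zero>)"
    unfolding mult_eq[OF f one_closed_b c]
  proof (intro finsum_cong' Pi_I refl)
    fix a assume a: "a \<in> diags"
    have "(\<Oplus>b\<in>diags. if cat a b = c then f a \<otimes> \<one>\<^bsub>alg\<^esub> b \<otimes> wt a b else \<zero>)
        = (\<Oplus>b\<in>diags. if b = ?id then (if a = c then f a else \<zero>) else \<zero>)"
      using a cid by (intro finsum_cong') (auto simp: b_prime_def weight_id)
    also have "\<dots> = (if a = c then f a else \<zero>)"
      using a by (intro finsum_delta finite_JB id_diagram_JB) auto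
    finally show "(\<Oplus>b\<in>diags. if cat a b = c then f a \<otimes> \<one>\<^bsub>alg\<^esub> b \<otimes> wt a b else \<zero>)
        = (if a = c then f a else \<zero>)" .
  qed (auto intro!: finsum_closed)
  also have "\<dots> = f c" using c by (intro finsum_delta finite_JB) auto
  finally show "(f \<otimes>\<^bsub>alg\<^esub> \<one>\<^bsub>alg\<^esub>) c = f c" .
qed

lemma b_add: "f \<oplus>\<^bsub>alg\<^esub> g = (\<lambda>d\<in>diags. f d \<oplus> g d)" and b_zero: "\<zero>\<^bsub>alg\<^esub> = (\<lambda>d\<in>diags. \<zero>)"
  by (simp_all add: b_prime_def)

lemma b_mem [simp]: "f \<in> carrier alg \<Longrightarrow> a \<in> diags \<Longrightarrow> f a \<in> carrier R"
  by (auto simp: b_carrier)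

lemma b_ext:
  assumes "f \<in> carrier alg" "g \<in> carrier alg" "\<And>c. c \<in> diags \<Longrightarrow> f c = g c"
  shows "f = g"
  using assms unfolding b_carrier by (intro PiE_ext)

lemma abelian_group_b: "abelian_group alg"
proof (rule abelian_groupI)
  show add: "f \<oplus>\<^bsub>alg\<^esub> g \<in> carrier alg" if "f \<in> carrier alg" "g \<in> carrier alg" for f g
    using that b_mem by (auto simp: b_carrier b_add)
  show zero: "\<zero>\<^bsub>alg\<^esub> \<in> carrier alg" by (auto simp: b_carrier b_zero)
  show "(f \<oplus>\<^bsub>alg\<^esub> g) \<oplus>\<^bsub>alg\<^esub> h = f \<oplus>\<^bsub>alg\<^esub> (g \<oplus>\<^bsub>alg\<^esub> h)"
    if "f \<in> carrier alg" "g \<in> carrier alg" "h \<in> carrier alg" for f g h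
    using that by (intro b_ext add) (simp_all add: b_add a_assoc)
  show "f \<oplus>\<^bsub>alg\<^esub> g = g \<oplus>\<^bsub>alg\<^esub> f" if "f \<in> carrier alg" "g \<in> carrier alg" for f g
    using that by (intro b_ext add) (simp_all add: b_add a_comm)
  show "\<zero>\<^bsub>alg\<^esub> \<oplus>\<^bsub>alg\<^esub> f = f" if "f \<in> carrier alg" for f
    using that by (intro b_ext add zero) (simp_all add: b_add b_zero)
  show "\<exists>g\<in>carrier alg. g \<oplus>\<^bsub>alg\<^esub> f = \<zero>\<^bsub>alg\<^esub>" if f: "f \<in> carrier alg" for f
  proof
    show neg: "(\<lambda>d\<in>diags. \<ominus> f d) \<in> carrier alg" using f by (auto simp: b_carrier)
    show "(\<lambda>d\<in>diags. \<ominus> f d) \<oplus>\<^bsub>alg\<^esub> f = \<zero>\<^bsub>alg\<^esub>"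
      using f by (intro b_ext add neg zero) (simp_all add: b_add b_zero l_neg)
  qed
qed

lemma mult_distrib_b:
  assumes f: "f \<in> carrier alg" and g: "g \<in> carrier alg" and h: "h \<in> carrier alg"
  shows "(f \<oplus>\<^bsub>alg\<^esub> g) \<otimes>\<^bsub>alg\<^esub> h = f \<otimes>\<^bsub>alg\<^esub> h \<oplus>\<^bsub>alg\<^esub> g \<otimes>\<^bsub>alg\<^esub> h"
    "h \<otimes>\<^bsub>alg\<^esub> (f \<oplus>\<^bsub>alg\<^esub> g) = h \<otimes>\<^bsub>alg\<^esub> f \<oplus>\<^bsub>alg\<^esub> h \<otimes>\<^bsub>alg\<^esub> g"
proof -
  have add: "x \<oplus>\<^bsub>alg\<^esub> y \<in> carrier alg" if "x \<in> carrier alg" "y \<in> carrier alg" for x y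
    using abelian_monoid.a_closed[OF abelian_group.axioms(1)[OF abelian_group_b]] that by blast
  note cl = mult_closed[folded b_carrier] and eq = mult_eq[folded b_carrier]
  show "(f \<oplus>\<^bsub>alg\<^esub> g) \<otimes>\<^bsub>alg\<^esub> h = f \<otimes>\<^bsub>alg\<^esub> h \<oplus>\<^bsub>alg\<^esub> g \<otimes>\<^bsub>alg\<^esub> h"
  proof (rule b_ext)
    fix c assume c: "c \<in> diags"
    have "((f \<oplus>\<^bsub>alg\<^esub> g) \<otimes>\<^bsub>alg\<^esub> h) c =
        (\<Oplus>a\<in>diags. \<Oplus>b\<in>diags. (if cat a b = c then f a \<otimes> h b \<otimes> wt a b else \<zero>) \<oplus>
          (if cat a b = c then g a \<otimes> h b \<otimes> wt a b else \<zero>))"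
      unfolding eq[OF add[OF f g] h c] using f g h
      by (intro finsum_cong') (auto intro!: finsum_closed simp: b_add l_distr)
    also have "\<dots> = (f \<otimes>\<^bsub>alg\<^esub> h \<oplus>\<^bsub>alg\<^esub> g \<otimes>\<^bsub>alg\<^esub> h) c"
      using c f g h by (subst finsum_add_add) (auto simp: b_add eq)
    finally show "((f \<oplus>\<^bsub>alg\<^esub> g) \<otimes>\<^bsub>alg\<^esub> h) c = (f \<otimes>\<^bsub>alg\<^esub> h \<oplus>\<^bsub>alg\<^esub> g \<otimes>\<^bsub>alg\<^esub> h) c" .
  qed (use f g h in \<open>auto intro!: add cl\<close>)
  show "h \<otimes>\<^bsub>alg\<^esub> (f \<oplus>\<^bsub>alg\<^esub> g) = h \<otimes>\<^bsub>alg\<^esub> f \<oplus>\<^bsub>alg\<^esub> h \<otimes>\<^bsub>alg\<^esub> g"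
  proof (rule b_ext)
    fix c assume c: "c \<in> diags"
    have "(h \<otimes>\<^bsub>alg\<^esub> (f \<oplus>\<^bsub>alg\<^esub> g)) c =
        (\<Oplus>a\<in>diags. \<Oplus>b\<in>diags. (if cat a b = c then h a \<otimes> f b \<otimes> wt a b else \<zero>) \<oplus>
          (if cat a b = c then h a \<otimes> g b \<otimes> wt a b else \<zero>))"
      unfolding eq[OF h add[OF f g] c] using f g h
      by (intro finsum_cong') (auto intro!: finsum_closed simp: b_add l_distr r_distr)
    also have "\<dots> = (h \<otimes>\<^bsub>alg\<^esub> f \<oplus>\<^bsub>alg\<^esub> h \<otimes>\<^bsub>alg\<^esub> g) c"
      using c f g h by (subst finsum_add_add) (auto simp: b_add eq)
    finally show "(h \<otimes>\<^bsub>alg\<^esub> (f \<oplus>\<^bsub>alg\<^esub> g)) c = (h \<otimes>\<^bsub>alg\<^esub> f \<oplus>\<^bsub>alg\<^esub> h \<otimes>\<^bsub>alg\<^esub> g) c" .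
  qed (use f g h in \<open>auto intro!: add cl\<close>)
qed

theorem ring_b_prime: "ring alg"
proof (rule ringI)
  show "abelian_group alg" by (rule abelian_group_b)
  show "monoid alg"
    by (rule monoidI) (simp_all add: b_carrier mult_closed one_closed_b mult_assoc_b mult_one_left mult_one_right)
qed (rule mult_distrib_b; assumption)+

end

end

section \<open>Diagrams with both arcs in the centre\<close>

section \<open>Inserting a central cup and cap\<close>

text \<open>The values k + 1 and k + 2 are left out; they are the two central positions among 2k +
  2.\<close>

definition shift :: "nat \<Rightarrow> nat \<Rightarrow> nat" where
  "shift k i = (if i \<le> k then i else i + 2)"

fun shift_vertex :: "nat \<Rightarrow> vertex \<Rightarrow> vertex" where
  "shift_vertex k (North i) = North (shift k i)"
| "shift_vertex k (South i) = South (shift k i)"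

definition cup :: "nat \<Rightarrow> vertex set" where "cup k = {North (k + 1), North (k + 2)}"

definition cap :: "nat \<Rightarrow> vertex set" where "cap k = {South (k + 1), South (k + 2)}"

definition widen :: "nat \<Rightarrow> diagram \<Rightarrow> diagram" where
  "widen k d = insert (cup k) (insert (cap k) ((\<lambda>l. shift_vertex k ` l) ` d))"

lemma shift_inj: "shift k i = shift k j \<longleftrightarrow> i = j"
  by (auto simp: shift_def)

lemma shift_vertex_inj: "shift_vertex k u = shift_vertex k v \<longleftrightarrow> u = v"
  by (cases u; cases v) (auto simp: shift_inj)

lemma shift_vertex_vertices: "shift_vertex k v \<in> vertices (2 * Suc k) \<longleftrightarrow> v \<in> vertices (2 * k)"
  by (cases v) (auto simp: shift_def)

lemma shift_surj:
  assumes "i \<noteq> k + 1" "i \<noteq> k + 2" obtains j where "i = shift k j"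
proof (cases "i \<le> k")
  case True
  then show ?thesis using that[of i] by (simp add: shift_def)
next
  case False
  then have "i = shift k (i - 2)" using assms by (auto simp: shift_def)
  then show ?thesis by (rule that)
qed

lemma shift_mid: "shift k i \<noteq> Suc k" "shift k i \<noteq> Suc (Suc k)"
  by (auto simp: shift_def)

lemma shift_not_cup: "shift_vertex k v \<notin> cup k" "shift_vertex k v \<notin> cap k"
  by (cases v; simp add: cup_def cap_def shift_mid)+

lemma vertices_cases:
  assumes "v \<in> vertices (2 * Suc k)"
  obtains (cup) "v \<in> cup k" | (cap) "v \<in> cap k" | (shift) u where "u \<in> vertices (2 * k)" "v = shift_vertex k u"
proof (cases "v \<in> cup k \<or> v \<in> cap k")
  case True
  then show ?thesis using that by blast
next
  case False
  have "\<exists>u. v = shift_vertex k u"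
  proof (cases v)
    case (North i)
    then have "i \<noteq> k + 1" "i \<noteq> k + 2" using False by (auto simp: cup_def)
    then obtain j where "i = shift k j" by (rule shift_surj)
    then show ?thesis using North by (intro exI[of _ "North j"]) simp
  next
    case (South i)
    then have "i \<noteq> k + 1" "i \<noteq> k + 2" using False by (auto simp: cap_def)
    then obtain j where "i = shift k j" by (rule shift_surj)
    then show ?thesis using South by (intro exI[of _ "South j"]) simp
  qed
  then obtain u where "v = shift_vertex k u" by blast
  then show ?thesis using that(3)[of u] assms shift_vertex_vertices by simp
qed

lemma cup_cap_vertices: "cup k \<subseteq> vertices (2 * Suc k)" "cap k \<subseteq> vertices (2 * Suc k)"
  by (auto simp: cup_def cap_def)

lemma boundary_pos_shift:
  assumes "u \<in> vertices (2 * k)" "v \<in> vertices (2 * k)"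
  shows "boundary_pos (2 * Suc k) (shift_vertex k u) < boundary_pos (2 * Suc k) (shift_vertex k v)
    \<longleftrightarrow> boundary_pos (2 * k) u < boundary_pos (2 * k) v"
  using assms by (cases u; cases v) (auto simp: shift_def)

lemma crossing_shift:
  assumes "l \<subseteq> vertices (2 * k)" "l' \<subseteq> vertices (2 * k)"
  shows "crossing (2 * Suc k) (shift_vertex k ` l) (shift_vertex k ` l') \<longleftrightarrow> crossing (2 * k) l l'"
proof -
  have "boundary_pos (2 * Suc k) (shift_vertex k u) < boundary_pos (2 * Suc k) (shift_vertex k v)
      \<longleftrightarrow> boundary_pos (2 * k) u < boundary_pos (2 * k) v" if "u \<in> l \<union> l'" "v \<in> l \<union> l'" for u v
    using that assms by (intro boundary_pos_shift) auto
  then show ?thesis unfolding crossing_def by auto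
qed

text \<open>The ends of a central arc are neighbours in the boundary order, so no end of another
  line fits strictly between them.\<close>

lemma crossing_cup_cap:
  "\<not> crossing (2 * Suc k) (cup k) l" "\<not> crossing (2 * Suc k) (cap k) l"
  "\<not> crossing (2 * Suc k) l (cup k)" "\<not> crossing (2 * Suc k) l (cap k)"
  by (auto simp: crossing_def cup_def cap_def)

lemma reflect_shift:
  assumes "v \<in> vertices (2 * k)"
  shows "reflect_vertex (2 * Suc k) (shift_vertex k v) = shift_vertex k (reflect_vertex (2 * k) v)"
  using assms by (cases v) (auto simp: shift_def)

lemma reflect_cup_cap: "reflect_vertex (2 * Suc k) ` cup k = cup k" "reflect_vertex (2 * Suc k) ` cap k = cap k"
  by (auto simp: cup_def cap_def)

lemma widen_cup_cap: "cup k \<in> widen k d" "cap k \<in> widen k d"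
  by (simp_all add: widen_def)

lemma shift_line_widen:
  "shift_vertex k ` l \<in> widen k d \<longleftrightarrow> l \<in> d"
proof -
  have "North (k + 1) \<noteq> shift_vertex k v" "South (k + 1) \<noteq> shift_vertex k v" for v
    by (cases v; auto simp: shift_def)+
  then have "North (k + 1) \<notin> shift_vertex k ` l" "South (k + 1) \<notin> shift_vertex k ` l" by blast+
  then have "shift_vertex k ` l \<noteq> cup k" "shift_vertex k ` l \<noteq> cap k"
    by (auto simp: cup_def cap_def)
  moreover have "inj (shift_vertex k)" by (rule injI) (simp add: shift_vertex_inj)
  then have "inj (image (shift_vertex k))" by (intro injI) (simp add: inj_image_eq_iff)
  then have "shift_vertex k ` l \<in> image (shift_vertex k) ` d \<longleftrightarrow> l \<in> d" by (rule inj_image_mem_iff)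
  ultimately show ?thesis by (simp add: widen_def)
qed

lemma widen_inj: "widen k d = widen k d' \<Longrightarrow> d = d'"
  using shift_line_widen by blast

lemma widen_JB:
  assumes d: "d \<in> JB k"
  shows "widen k d \<in> JB (Suc k)"
proof (rule JB_I)
  let ?n = "2 * Suc k" and ?s = "shift_vertex k"
  have mat: "matching (2 * k) d" by (rule JB_matching[OF d])
  have sub: "l \<subseteq> vertices (2 * k)" if "l \<in> d" for l using matching_Union[OF mat] that by blast
  have nc: "\<not> crossing (2 * k) l l'" if "l \<in> d" "l' \<in> d" for l l'
    using JB_TL[OF d] that by (auto simp: TL_diagrams_def)
  have card: "card (?s ` l) = 2" if "l \<in> d" for l
  proof -
    have "card (?s ` l) = card l" by (rule card_image) (auto simp: inj_on_def shift_vertex_inj)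
    then show ?thesis using mat that by (simp add: matching_def)
  qed
  have cardw: "card l = 2" if "l \<in> widen k d" for l
  proof -
    have "card (cup k) = 2" "card (cap k) = 2" by (simp_all add: cup_def cap_def)
    then show ?thesis using that card by (auto simp: widen_def)
  qed
  have "partition_on (vertices ?n) (widen k d)"
  proof (rule partition_onI)
    show "\<Union>(widen k d) = vertices ?n"
    proof
      show "\<Union>(widen k d) \<subseteq> vertices ?n"
      proof
        fix v assume "v \<in> \<Union>(widen k d)"
        then consider "v \<in> cup k" | "v \<in> cap k" | l u where "l \<in> d" "u \<in> l" "v = ?s u"
          by (auto simp: widen_def)
        then show "v \<in> vertices ?n"
        proof cases
          case 3
          then have "u \<in> vertices (2 * k)" using sub by blast
          then show ?thesis unfolding 3 by (simp only: shift_vertex_vertices)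
        qed (use cup_cap_vertices[of k] in blast)+
      qed
      show "vertices ?n \<subseteq> \<Union>(widen k d)"
      proof
        fix v assume "v \<in> vertices ?n"
        then show "v \<in> \<Union>(widen k d)"
        proof (cases rule: vertices_cases)
          case (shift u)
          then obtain l where l: "l \<in> d" "u \<in> l" using matching_Union[OF mat] by blast
          then have "?s ` l \<in> widen k d" "v \<in> ?s ` l" using shift by (simp_all add: widen_def)
          then show ?thesis by blast
        qed (simp_all add: widen_def)
      qed
    qed
    show "disjnt p q" if "p \<in> widen k d" "q \<in> widen k d" "p \<noteq> q" for p q
    proof -
      have dl: "disjnt (?s ` l) (?s ` l')" if "l \<in> d" "l' \<in> d" "?s ` l \<noteq> ?s ` l'" for l l'
      proof -
        have "l \<inter> l' = {}" using matching_unique[OF mat that(1,2)] that(3) by blast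
        then show ?thesis by (auto simp: disjnt_def shift_vertex_inj)
      qed
      have dc: "disjnt (?s ` l) (cup k)" "disjnt (?s ` l) (cap k)" for l
        using shift_not_cup by (auto simp: disjnt_def)
      have dcc: "disjnt (cup k) (cap k)" by (auto simp: disjnt_def cup_def cap_def)
      have "p = cup k \<or> p = cap k \<or> (\<exists>l \<in> d. p = ?s ` l)" "q = cup k \<or> q = cap k \<or> (\<exists>l \<in> d. q = ?s ` l)"
        using that(1,2) by (auto simp: widen_def)
      then show ?thesis
        using that(3) by (elim disjE bexE) (metis dl dc dcc disjnt_sym)+
    qed
    show "{} \<notin> widen k d" using cardw by fastforce
  qed
  moreover have "\<not> crossing ?n l l'" if "l \<in> widen k d" "l' \<in> widen k d" for l l'
    using that crossing_cup_cap[of k] crossing_shift[OF sub sub] nc by (auto simp: widen_def simp del: mult_Suc_right)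
  ultimately show "widen k d \<in> TL_diagrams ?n" using cardw by (simp add: TL_diagrams_def)
  show "reflect_vertex ?n ` l \<in> widen k d" if "l \<in> widen k d" for l
  proof -
    have "reflect_vertex ?n ` ?s ` l' = ?s ` reflect_vertex (2 * k) ` l'" if "l' \<in> d" for l'
      unfolding image_image using sub[OF that] by (intro image_cong refl reflect_shift) auto
    then show ?thesis
      using that reflect_cup_cap[of k] JB_reflect_line[OF d] by (auto simp: widen_def simp del: mult_Suc_right)
  qed
qed

text \<open>No other line ends at one of the four central vertices, so deleting the two arcs and
  closing the gap inverts \<open>widen\<close>. Elements fixed by e on both sides are supported on
  these diagrams, which makes this the source of surjectivity onto the corner.\<close>

lemma widen_onto:
  assumes c: "c \<in> JB (Suc k)" and cup: "cup k \<in> c" and cap: "cap k \<in> c"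
  obtains d where "d \<in> JB k" "c = widen k d"
proof -
  let ?n = "2 * Suc k" and ?s = "shift_vertex k"
  define d where "d = {l. ?s ` l \<in> c}"
  have mat: "matching ?n c" by (rule JB_matching[OF c])
  have lines: "\<exists>l'. l = ?s ` l'" if l: "l \<in> c" "l \<noteq> cup k" "l \<noteq> cap k" for l
  proof -
    have "v \<in> range ?s" if v: "v \<in> l" for v
    proof -
      have "v \<in> vertices ?n" using matching_Union[OF mat] l(1) v by blast
      then show ?thesis
      proof (cases rule: vertices_cases)
        case cup
        then show ?thesis using matching_unique[OF mat l(1) \<open>cup k \<in> c\<close> v] l(2) by blast
      next
        case cap
        then show ?thesis using matching_unique[OF mat l(1) \<open>cap k \<in> c\<close> v] l(3) by blast
      qed auto
    qed
    then have "l = ?s ` (?s -` l)" by blast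
    then show ?thesis by blast
  qed
  have cd: "c = widen k d"
  proof
    show "c \<subseteq> widen k d" using lines by (auto simp: widen_def d_def)
    show "widen k d \<subseteq> c" using cup cap by (auto simp: widen_def d_def)
  qed
  have sub: "l \<subseteq> vertices (2 * k)" if "l \<in> d" for l
  proof
    fix v assume "v \<in> l"
    then have "?s v \<in> vertices ?n" using that matching_Union[OF mat] unfolding d_def by blast
    then show "v \<in> vertices (2 * k)" by (simp only: shift_vertex_vertices)
  qed
  have "d \<in> JB k"
  proof (rule JB_I)
    have "partition_on (vertices (2 * k)) d"
    proof (rule partition_onI)
      show "\<Union>d = vertices (2 * k)"
      proof
        show "vertices (2 * k) \<subseteq> \<Union>d"
        proof
          fix v assume "v \<in> vertices (2 * k)"
          then have "?s v \<in> vertices ?n" by (simp only: shift_vertex_vertices)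
          then obtain l where l: "l \<in> c" "?s v \<in> l" using matching_Union[OF mat] by blast
          then have "l \<noteq> cup k" "l \<noteq> cap k" using shift_not_cup by blast+
          then obtain l' where l': "l = ?s ` l'" using lines l by blast
          then have "v \<in> l'" "l' \<in> d" using l by (auto simp: shift_vertex_inj d_def)
          then show "v \<in> \<Union>d" by blast
        qed
      qed (use sub in blast)
      show "disjnt p q" if "p \<in> d" "q \<in> d" "p \<noteq> q" for p q
      proof (rule ccontr)
        assume "\<not> disjnt p q"
        then obtain x where "x \<in> p" "x \<in> q" by (auto simp: disjnt_def)
        then have "?s ` p = ?s ` q"
          using matching_unique[OF mat, of "?s ` p" "?s ` q" "?s x"] that by (auto simp: d_def)
        then have "p = q" by (metis inj_image_eq_iff injI shift_vertex_inj)
        then show False using that by simp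
      qed
      show "{} \<notin> d"
      proof
        assume "{} \<in> d"
        then have "{} \<in> c" by (simp add: d_def)
        then show False using mat by (auto simp: matching_def partition_on_def)
      qed
    qed
    moreover have "card l = 2" if "l \<in> d" for l
    proof -
      have "card (?s ` l) = card l" by (rule card_image) (auto simp: inj_on_def shift_vertex_inj)
      then show ?thesis using mat that by (simp add: matching_def d_def)
    qed
    moreover have "\<not> crossing (2 * k) l l'" if "l \<in> d" "l' \<in> d" for l l'
      using JB_TL[OF c] that crossing_shift[OF sub sub, OF that]
      by (auto simp: TL_diagrams_def d_def simp del: mult_Suc_right)
    ultimately show "d \<in> TL_diagrams (2 * k)" by (simp add: TL_diagrams_def)
    show "reflect_vertex (2 * k) ` l \<in> d" if "l \<in> d" for l
    proof -
      have "reflect_vertex ?n ` ?s ` l = ?s ` reflect_vertex (2 * k) ` l"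
        unfolding image_image using sub[OF that] by (intro image_cong refl reflect_shift) auto
      then show ?thesis using JB_reflect_line[OF c, of "?s ` l"] that by (simp add: d_def)
    qed
  qed
  then show ?thesis using that cd by blast
qed

section \<open>Concatenation of widened diagrams\<close>

definition shift_point :: "nat \<Rightarrow> point \<Rightarrow> point" where
  "shift_point k p = (fst p, shift k (snd p))"

lemma shift_point_inj: "shift_point k p = shift_point k q \<longleftrightarrow> p = q"
  by (cases p; cases q) (auto simp: shift_point_def shift_inj)

lemma emb_shift: "emb a b (shift_vertex k v) = shift_point k (emb a b v)"
  by (cases v) (auto simp: shift_point_def)

lemma outer_shift: "outer (shift_vertex k v) = shift_point k (outer v)"
  by (simp add: outer_eq_emb emb_shift)

text \<open>Central arcs stay on one level and share no point with shifted lines. So a path in a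
  stack of widened diagrams visits either shifted points only or central points of a single level
  only.\<close>

lemma place_widen:
  assumes "(p, q) \<in> place a b (widen k d)"
  shows "(\<exists>p' q'. p = shift_point k p' \<and> q = shift_point k q' \<and> (p', q') \<in> place a b d) \<or>
    (fst p = fst q \<and> snd p \<in> {k + 1, k + 2} \<and> snd q \<in> {k + 1, k + 2})"
proof -
  obtain l u v where l: "l \<in> widen k d" "u \<in> l" "v \<in> l" "p = emb a b u" "q = emb a b v"
    using assms by (auto simp: place_def)
  consider "l = cup k" | "l = cap k" | l' where "l' \<in> d" "l = shift_vertex k ` l'"
    using l(1) by (auto simp: widen_def)
  then show ?thesis
  proof cases
    case 3
    then obtain u' v' where uv: "u' \<in> l'" "v' \<in> l'" "u = shift_vertex k u'" "v = shift_vertex k v'"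
      using l by blast
    then have "(emb a b u', emb a b v') \<in> place a b d" using placeI 3 by blast
    then show ?thesis using l uv emb_shift by blast
  qed (use l in \<open>auto simp: cup_def cap_def\<close>)
qed

lemma place_widenI: "(p, q) \<in> place a b d \<Longrightarrow> (shift_point k p, shift_point k q) \<in> place a b (widen k d)"
proof -
  assume "(p, q) \<in> place a b d"
  then obtain l u v where l: "l \<in> d" "u \<in> l" "v \<in> l" "p = emb a b u" "q = emb a b v"
    by (auto simp: place_def)
  have "shift_vertex k ` l \<in> widen k d" using l(1) by (simp add: shift_line_widen)
  then show ?thesis unfolding l emb_shift[symmetric] by (rule placeI) (use l in auto)
qed

lemma connected_widen:
  "(shift_point k p, q) \<in> connected_points (widen k d1) (widen k d2) \<longleftrightarrow>
    (\<exists>q'. q = shift_point k q' \<and> (p, q') \<in> connected_points d1 d2)"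
proof
  assume "(shift_point k p, q) \<in> connected_points (widen k d1) (widen k d2)"
  then show "\<exists>q'. q = shift_point k q' \<and> (p, q') \<in> connected_points d1 d2"
    unfolding connected_points_place
  proof (induction rule: rtrancl_induct)
    case (step y z)
    then obtain y' where y': "y = shift_point k y'" "(p, y') \<in> (place 0 1 d1 \<union> place 1 2 d2)\<^sup>*" by blast
    have "snd y \<noteq> k + 1" "snd y \<noteq> k + 2" by (simp_all add: y' shift_point_def shift_mid)
    then obtain y'' z' where yz: "y = shift_point k y''" "z = shift_point k z'"
      "(y'', z') \<in> place 0 1 d1 \<union> place 1 2 d2"
      using step(2) place_widen[of y z 0 1 k d1] place_widen[of y z 1 2 k d2] by blast
    then have "y'' = y'" using y' by (simp add: shift_point_inj)
    then have "(p, z') \<in> (place 0 1 d1 \<union> place 1 2 d2)\<^sup>*" using y'(2) yz(3) by (simp add: rtrancl_into_rtrancl)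
    then show ?case using yz(2) by (intro exI[of _ z'] conjI)
  qed (intro exI[of _ p], simp)
next
  assume "\<exists>q'. q = shift_point k q' \<and> (p, q') \<in> connected_points d1 d2"
  then obtain q' where q': "q = shift_point k q'" "(p, q') \<in> (place 0 1 d1 \<union> place 1 2 d2)\<^sup>*"
    unfolding connected_points_place by blast
  show "(shift_point k p, q) \<in> connected_points (widen k d1) (widen k d2)"
    unfolding connected_points_place q'(1)
    by (rule rtrancl_map[OF q'(2)]) (use place_widenI in blast)
qed

lemma connected_mid:
  assumes "(p, q) \<in> connected_points (widen k d1) (widen k d2)" "snd p \<in> {k + 1, k + 2}"
  shows "fst q = fst p \<and> snd q \<in> {k + 1, k + 2}"
  using assms(1) unfolding connected_points_place
proof (induction rule: rtrancl_induct)
  case (step y z)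
  have "y \<noteq> shift_point k y'" for y' using step(3) shift_mid[of k "snd y'"] by (auto simp: shift_point_def)
  then have "fst y = fst z \<and> snd z \<in> {k + 1, k + 2}"
    using step(2) place_widen[of y z 0 1 k d1] place_widen[of y z 1 2 k d2] by blast
  then show ?case using step(3) by simp
qed (use assms(2) in simp)

lemma connected_midI:
  assumes "cup k \<in> d1 \<and> a = 0 \<or> cap k \<in> d1 \<and> a = 1 \<or> cup k \<in> d2 \<and> a = 1 \<or> cap k \<in> d2 \<and> a = 2"
    and "i \<in> {k + 1, k + 2}" "j \<in> {k + 1, k + 2}"
  shows "((a, i), (a, j)) \<in> connected_points d1 d2"
proof -
  consider "cup k \<in> d1" "a = 0" | "cap k \<in> d1" "a = 1" | "cup k \<in> d2" "a = 1" | "cap k \<in> d2" "a = 2"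
    using assms(1) by blast
  then have "((a, i), (a, j)) \<in> place 0 1 d1 \<union> place 1 2 d2"
  proof cases
    case 1
    then have "(emb 0 1 (North i), emb 0 1 (North j)) \<in> place 0 1 d1"
      by (intro placeI[of "cup k"]) (use assms(2,3) in \<open>auto simp: cup_def\<close>)
    then show ?thesis using 1 by simp
  next
    case 2
    then have "(emb 0 1 (South i), emb 0 1 (South j)) \<in> place 0 1 d1"
      by (intro placeI[of "cap k"]) (use assms(2,3) in \<open>auto simp: cap_def\<close>)
    then show ?thesis using 2 by simp
  next
    case 3
    then have "(emb 1 2 (North i), emb 1 2 (North j)) \<in> place 1 2 d2"
      by (intro placeI[of "cup k"]) (use assms(2,3) in \<open>auto simp: cup_def\<close>)
    then show ?thesis using 3 by simp
  next
    case 4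
    then have "(emb 1 2 (South i), emb 1 2 (South j)) \<in> place 1 2 d2"
      by (intro placeI[of "cap k"]) (use assms(2,3) in \<open>auto simp: cap_def\<close>)
    then show ?thesis using 4 by simp
  qed
  then show ?thesis unfolding connected_points_place by (rule r_into_rtrancl)
qed

lemma concat_lineI:
  assumes "u \<in> vertices n" "v \<in> vertices n" "u \<noteq> v" "(outer u, outer v) \<in> connected_points d1 d2"
  shows "{u, v} \<in> concat_diagram n d1 d2"
  using assms unfolding concat_diagram_def by blast

text \<open>An arc of the upper diagram on the northern edge survives concatenation. Consequently e
  A is supported on diagrams with the central cup, and A e, by the mirrored statement below, on
  those with the central cap.\<close>

lemma cup_concat:
  assumes "cup k \<in> d1"
  shows "cup k \<in> concat_diagram (2 * Suc k) d1 d2"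
  unfolding cup_def
proof (rule concat_lineI)
  show "(outer (North (k + 1)), outer (North (k + 2))) \<in> connected_points d1 d2"
    using connected_midI[of k d1 0 d2 "k + 1" "k + 2"] assms by simp
qed simp_all

lemma cap_concat:
  assumes "cap k \<in> d2"
  shows "cap k \<in> concat_diagram (2 * Suc k) d1 d2"
  unfolding cap_def
proof (rule concat_lineI)
  show "(outer (South (k + 1)), outer (South (k + 2))) \<in> connected_points d1 d2"
    using connected_midI[of k d1 2 d2 "k + 1" "k + 2"] assms by simp
qed simp_all

text \<open>Every line of the larger matching shares a vertex with a line of the smaller one and so
  equals it. A single inclusion thus suffices for \<open>concat_widen\<close>.\<close>

lemma matching_subset_eq:
  assumes d: "matching n d" and d': "matching n d'" and sub: "d \<subseteq> d'"
  shows "d = d'"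
proof
  show "d' \<subseteq> d"
  proof
    fix l assume l: "l \<in> d'"
    then have "l \<noteq> {}" using d' by (auto simp: matching_def partition_on_def)
    then obtain v where v: "v \<in> l" by blast
    then have "v \<in> vertices n" using matching_Union[OF d'] l by blast
    then obtain l' where "l' \<in> d" "v \<in> l'" using matching_Union[OF d] by blast
    then show "l \<in> d" using matching_unique[OF d' l, of l' v] sub v by blast
  qed
qed (rule sub)

lemma concat_widen:
  assumes d: "d1 \<in> JB k" "d2 \<in> JB k"
  shows "concat_diagram (2 * Suc k) (widen k d1) (widen k d2) = widen k (concat_diagram (2 * k) d1 d2)"
proof (rule matching_subset_eq[symmetric])
  let ?c = "concat_diagram (2 * Suc k) (widen k d1) (widen k d2)"
  show "matching (2 * Suc k) (widen k (concat_diagram (2 * k) d1 d2))"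
    using d by (intro JB_matching widen_JB concat_JB)
  show "matching (2 * Suc k) ?c" using d by (intro JB_matching widen_JB concat_JB)
  have "shift_vertex k ` l \<in> ?c" if l: "l \<in> concat_diagram (2 * k) d1 d2" for l
  proof -
    obtain u v where uv: "l = {u, v}" "u \<in> vertices (2 * k)" "v \<in> vertices (2 * k)" "u \<noteq> v"
      "(outer u, outer v) \<in> connected_points d1 d2" using l by (auto simp: concat_diagram_def)
    then have "(outer (shift_vertex k u), outer (shift_vertex k v)) \<in> connected_points (widen k d1) (widen k d2)"
      unfolding outer_shift connected_widen by blast
    moreover have "shift_vertex k u \<in> vertices (2 * Suc k)" "shift_vertex k v \<in> vertices (2 * Suc k)"
      using uv by (simp_all only: shift_vertex_vertices)
    moreover have "shift_vertex k u \<noteq> shift_vertex k v" using uv by (simp add: shift_vertex_inj)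
    ultimately show ?thesis unfolding concat_diagram_def uv(1) by blast
  qed
  then have "image (shift_vertex k) ` concat_diagram (2 * k) d1 d2 \<subseteq> ?c" by (rule image_subsetI)
  moreover have "cup k \<in> ?c" by (rule cup_concat[OF widen_cup_cap(1)])
  moreover have "cap k \<in> ?c" by (rule cap_concat[OF widen_cup_cap(2)])
  ultimately show "widen k (concat_diagram (2 * k) d1 d2) \<subseteq> ?c"
    unfolding widen_def[of k "concat_diagram (2 * k) d1 d2"] by (simp only: insert_subset)
qed

text \<open>At the gluing line the cap of the upper diagram and the cup of the lower one close up to
  a loop through k + 1 and k + 2. Nothing else reaches these points, and the old loops persist after
  shifting.\<close>

lemma loops_widen:
  "loops (2 * Suc k) (widen k d1) (widen k d2) = insert {k + 1, k + 2} (image (shift k) ` loops (2 * k) d1 d2)"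
proof
  let ?c = "connected_points d1 d2" and ?c' = "connected_points (widen k d1) (widen k d2)"
  have shiftp: "shift_point k (1, i) = (1, shift k i)" for i by (simp add: shift_point_def)
  have cls: "?c' `` {(1, shift k i)} = shift_point k ` (?c `` {(1, i)})" for i
    using connected_widen[of k "(1, i)"] unfolding shiftp by blast
  have mid: "?c' `` {(1, i)} = Pair 1 ` {k + 1, k + 2}" if i: "i \<in> {k + 1, k + 2}" for i
  proof
    show "?c' `` {(1, i)} \<subseteq> Pair 1 ` {k + 1, k + 2}"
    proof
      fix q assume "q \<in> ?c' `` {(1, i)}"
      then have "fst q = 1 \<and> snd q \<in> {k + 1, k + 2}" using connected_mid[of "(1, i)" q] i by simp
      then show "q \<in> Pair 1 ` {k + 1, k + 2}" by (cases q) simp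
    qed
    show "Pair 1 ` {k + 1, k + 2} \<subseteq> ?c' `` {(1, i)}"
      using connected_midI[of k "widen k d1" 1 "widen k d2" i] widen_cup_cap i by blast
  qed
  have injP: "X = Y" if "Pair (1 :: nat) ` X = Pair 1 ` Y" for X Y :: "nat set"
    using that by (simp add: inj_image_eq_iff inj_on_def)
  have ran: "shift k i \<in> {1..2 * Suc k} \<longleftrightarrow> i \<in> {1..2 * k}" for i by (auto simp: shift_def)
  have pair: "Pair 1 ` shift k ` L = shift_point k ` Pair 1 ` L" for L
    by (simp add: image_image shift_point_def)
  have inj: "shift_point k ` X = shift_point k ` Y \<Longrightarrow> X = Y" for X Y
    by (simp add: inj_image_eq_iff inj_on_def shift_point_inj)
  show "loops (2 * Suc k) (widen k d1) (widen k d2) \<subseteq> insert {k + 1, k + 2} (image (shift k) ` loops (2 * k) d1 d2)"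
  proof
    fix L assume L: "L \<in> loops (2 * Suc k) (widen k d1) (widen k d2)"
    then have L1: "L \<noteq> {}" "L \<subseteq> {1..2 * Suc k}" "\<And>i. i \<in> L \<Longrightarrow> ?c' `` {(1, i)} = Pair 1 ` L"
      by (auto simp: loops_def)
    then obtain i where i: "i \<in> L" by blast
    show "L \<in> insert {k + 1, k + 2} (image (shift k) ` loops (2 * k) d1 d2)"
    proof (cases "i \<in> {k + 1, k + 2}")
      case True
      then have "Pair (1 :: nat) ` L = Pair 1 ` {k + 1, k + 2}" using mid[OF True] L1(3)[OF i] by simp
      then have "L = {k + 1, k + 2}" by (rule injP)
      then show ?thesis by simp
    next
      case False
      then obtain i' where i': "i = shift k i'" using shift_surj[of i k] by auto
      define L' where "L' = {j. (1, j) \<in> ?c `` {(1, i')}}"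
      have eq: "shift_point k ` (?c `` {(1, i')}) = Pair 1 ` L" using cls[of i'] L1(3)[OF i] i' by simp
      have c': "?c `` {(1, i')} = Pair 1 ` L'"
      proof (intro equalityI subsetI)
        fix q assume q: "q \<in> ?c `` {(1, i')}"
        then have "shift_point k q \<in> Pair 1 ` L" using eq by blast
        then have "fst q = 1" by (auto simp: shift_point_def)
        then show "q \<in> Pair 1 ` L'" using q by (cases q) (auto simp: L'_def)
      qed (auto simp: L'_def)
      then have "Pair (1 :: nat) ` L = Pair 1 ` shift k ` L'" using eq pair by simp
      then have LL: "L = shift k ` L'" by (rule injP)
      have "?c `` {(1, j)} = Pair 1 ` L'" if "j \<in> L'" for j
      proof (rule inj)
        have "shift k j \<in> L" using LL that by simp
        then show "shift_point k ` (?c `` {(1, j)}) = shift_point k ` Pair 1 ` L'"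
          using cls[of j] L1(3)[of "shift k j"] LL pair[of L'] by simp
      qed
      moreover have "L' \<noteq> {}" using LL L1 by blast
      moreover have "L' \<subseteq> {1..2 * k}" using LL L1(2) ran by blast
      ultimately have "L' \<in> loops (2 * k) d1 d2" by (simp add: loops_def)
      then show ?thesis using LL by blast
    qed
  qed
  show "insert {k + 1, k + 2} (image (shift k) ` loops (2 * k) d1 d2) \<subseteq> loops (2 * Suc k) (widen k d1) (widen k d2)"
  proof
    fix L assume "L \<in> insert {k + 1, k + 2} (image (shift k) ` loops (2 * k) d1 d2)"
    then consider "L = {k + 1, k + 2}" | L' where "L' \<in> loops (2 * k) d1 d2" "L = shift k ` L'" by blast
    then show "L \<in> loops (2 * Suc k) (widen k d1) (widen k d2)"
    proof cases
      case 1
      then show ?thesis using mid by (simp add: loops_def)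
    next
      case 2
      then have L': "L' \<noteq> {}" "L' \<subseteq> {1..2 * k}" "\<And>i. i \<in> L' \<Longrightarrow> ?c `` {(1, i)} = Pair 1 ` L'"
        by (auto simp: loops_def)
      have "?c' `` {(1, i)} = Pair 1 ` L" if "i \<in> L" for i
      proof -
        obtain j where j: "j \<in> L'" "i = shift k j" using \<open>i \<in> L\<close> 2 by blast
        show ?thesis unfolding j(2) 2(2) cls L'(3)[OF j(1)] pair ..
      qed
      moreover have "L \<subseteq> {1..2 * Suc k}" using 2 L'(2) ran by blast
      moreover have "L \<noteq> {}" using 2 L' by simp
      ultimately show ?thesis unfolding loops_def by blast
    qed
  qed
qed

text \<open>A loop between \<open>d1\<close> and \<open>d2\<close> is a closed curve of any triple
  stack beginning with them, so \<open>closed_curve_colour\<close> applies. The third layer is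
  filled with a copy of \<open>d2\<close>, which the curve never meets.\<close>

lemma loop_colour:
  assumes d: "d1 \<in> JB m" "d2 \<in> JB m" and L: "L \<in> loops (2 * m) d1 d2" and ij: "i \<in> L" "j \<in> L"
  shows "even (card {x \<in> L. x < i} + i) \<longleftrightarrow> even (card {x \<in> L. x < j} + j)"
proof -
  obtain C where C: "C \<in> closed_curves (2 * m) d1 d2 d2" "L = slice 1 C"
    using L loops_as_slices(1)[OF d d(2)] by blast
  have "left_of C (1, i) = card {x \<in> L. x < i}" for i by (simp add: C(2) left_of_def slice_def)
  then show ?thesis
    using closed_curve_colour[OF d d(2) C(1), of "(1, i)" "(1, j)"] ij by (simp add: C(2) slice_def)
qed

text \<open>The white region at the middle of the northern edge is cut off by the cup, so below it the
  colours are interchanged.\<close>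

lemma loop_counts_widen:
  assumes d: "d1 \<in> JB k" "d2 \<in> JB k"
  shows "card (mirror_pairs (Suc k) (widen k d1) (widen k d2)) = card (mirror_pairs k d1 d2)"
    and "card (white_loops (Suc k) (widen k d1) (widen k d2)) = Suc (card (black_loops k d1 d2))"
    and "card (black_loops (Suc k) (widen k d1) (widen k d2)) = card (white_loops k d1 d2)"
proof -
  let ?L = "loops (2 * k) d1 d2" and ?L' = "loops (2 * Suc k) (widen k d1) (widen k d2)"
  have ran: "L \<subseteq> {1..2 * k}" if "L \<in> ?L" for L using that by (auto simp: loops_def)
  have ne: "L \<noteq> {}" if "L \<in> ?L" for L using that by (auto simp: loops_def)
  have inj: "inj_on (image (shift k)) X" for X
    by (rule inj_onI) (simp add: inj_image_eq_iff inj_on_def shift_inj)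
  have cross: "crosses_centre (Suc k) (shift k ` L) \<longleftrightarrow> crosses_centre k L" for L
  proof -
    have "shift k i \<le> Suc k \<longleftrightarrow> i \<le> k" "Suc k < shift k i \<longleftrightarrow> k < i" for i by (auto simp: shift_def)
    then show ?thesis by (simp add: crosses_centre_def)
  qed
  have crossm: "crosses_centre (Suc k) {k + 1, k + 2}" by (simp add: crosses_centre_def)
  have refl: "(\<lambda>i. 2 * Suc k + 1 - i) ` shift k ` L = shift k ` (\<lambda>i. 2 * k + 1 - i) ` L" if "L \<in> ?L" for L
    unfolding image_image by (rule image_cong) (use ran[OF that] in \<open>auto simp: shift_def\<close>)
  have fin: "finite ?L" by (rule finite_subset[of _ "Pow {1..2 * k}"]) (auto simp: loops_def)
  have TL: "d1 \<in> TL_diagrams (2 * k)" "widen k d1 \<in> TL_diagrams (2 * Suc k)"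
    using d widen_JB JB_TL by blast+
  have white: "interior_white (Suc k) (widen k d1) (shift k ` L) \<longleftrightarrow> \<not> interior_white k d1 L" if L: "L \<in> ?L" for L
  proof -
    have sub: "shift k ` L \<subseteq> {1..2 * Suc k}" using ran[OF L] by (force simp: shift_def)
    have c: "card {j \<in> shift k ` L. j < shift k i} = card {j \<in> L. j < i}" for i
    proof -
      have "{j \<in> shift k ` L. j < shift k i} = shift k ` {j \<in> L. j < i}"
        by (auto simp: shift_def split: if_splits)
      then show ?thesis by (simp add: card_image inj_on_def shift_inj)
    qed
    have s: "even (shift k i) \<longleftrightarrow> even i" for i by (simp add: shift_def)
    \<comment> \<open>\<open>shift\<close> preserves order and parity of positions, so in the
      criterion only k is replaced by \<open>Suc k\<close>, and this flips the parity.\<close>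
    have 1: "interior_white (Suc k) (widen k d1) (shift k ` L) \<longleftrightarrow> (\<exists>i \<in> L. odd (card {j \<in> L. j < i} + i + k))"
      unfolding interior_white_iff[OF TL(2) sub] by (simp add: c s)
    have 2: "interior_white k d1 L \<longleftrightarrow> (\<exists>i \<in> L. even (card {j \<in> L. j < i} + i + k))"
      by (rule interior_white_iff[OF TL(1) ran[OF L]])
    obtain i0 where i0: "i0 \<in> L" using ne[OF L] by blast
    \<comment> \<open>\<open>interior_white\<close> asks for one witness. Its negation becomes the
      opposite parity at one point because all points of the loop agree.\<close>
    have const: "even (card {j \<in> L. j < i} + i + k) \<longleftrightarrow> even (card {j \<in> L. j < i0} + i0 + k)" if "i \<in> L" for i
      using loop_colour[OF d L that i0] by (simp only: even_add)
    have "(\<exists>i \<in> L. odd (card {j \<in> L. j < i} + i + k)) \<longleftrightarrow> odd (card {j \<in> L. j < i0} + i0 + k)"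
      using const i0 by blast
    moreover have "(\<exists>i \<in> L. even (card {j \<in> L. j < i} + i + k)) \<longleftrightarrow> even (card {j \<in> L. j < i0} + i0 + k)"
      using const i0 by blast
    ultimately show ?thesis unfolding 1 2 by simp
  qed
  have whitem: "interior_white (Suc k) (widen k d1) {k + 1, k + 2}"
  proof -
    have sub: "{k + 1, k + 2} \<subseteq> {1..2 * Suc k}" by auto
    have empty: "{j \<in> {k + 1, k + 2}. j < k + 1} = {}" by auto
    \<comment> \<open>No point of the new loop precedes k + 1, and (k + 1) + Suc k is even.\<close>
    have "even (card {j \<in> {k + 1, k + 2}. j < k + 1} + (k + 1) + Suc k)" unfolding empty by simp
    then show ?thesis unfolding interior_white_iff[OF TL(2) sub] by blast
  qed
  have new: "{k + 1, k + 2} \<notin> image (shift k) ` X" for X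
  proof
    assume "{k + 1, k + 2} \<in> image (shift k) ` X"
    then obtain j where "k + 1 = shift k j" by blast
    then show False by (simp add: shift_def split: if_splits)
  qed
  have "mirror_pairs (Suc k) (widen k d1) (widen k d2) =
      (\<lambda>L. {L, (\<lambda>i. 2 * Suc k + 1 - i) ` L}) ` image (shift k) ` {L \<in> ?L. \<not> crosses_centre k L}"
    unfolding mirror_pairs_def loops_widen using cross crossm by (intro arg_cong[where f = "image _"]) auto
  also have "\<dots> = image (image (shift k)) ` mirror_pairs k d1 d2"
    unfolding mirror_pairs_def image_image using refl by (intro image_cong) (auto simp: image_image)
  finally show "card (mirror_pairs (Suc k) (widen k d1) (widen k d2)) = card (mirror_pairs k d1 d2)"
    using inj_on_subset[OF inj_on_image_Pow[OF inj[of UNIV]]] by (simp add: card_image)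
  have "white_loops (Suc k) (widen k d1) (widen k d2) = insert {k + 1, k + 2} (image (shift k) ` black_loops k d1 d2)"
    unfolding white_loops_def black_loops_def loops_widen using cross crossm white whitem by auto
  moreover have "finite (black_loops k d1 d2)" using fin by (simp add: black_loops_def)
  ultimately show "card (white_loops (Suc k) (widen k d1) (widen k d2)) = Suc (card (black_loops k d1 d2))"
    using new[of "black_loops k d1 d2"] by (simp add: card_image[OF inj])
  have "black_loops (Suc k) (widen k d1) (widen k d2) = image (shift k) ` white_loops k d1 d2"
    unfolding white_loops_def black_loops_def loops_widen using cross crossm white whitem by auto
  then show "card (black_loops (Suc k) (widen k d1) (widen k d2)) = card (white_loops k d1 d2)"
    by (simp add: card_image[OF inj])
qed

section \<open>Modules over a ring and over its corner\<close>

section \<open>Coinduction from a corner ring\<close>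

lemma is_category_left_modules: "is_category (left_module_category R)"
proof
  fix L M N f g
  assume "L \<in> Obj (left_module_category R)" "M \<in> Obj (left_module_category R)"
    "N \<in> Obj (left_module_category R)" "f \<in> Hom (left_module_category R) L M"
    "g \<in> Hom (left_module_category R) M N"
  then have f: "f \<in> left_module_hom R L M" and g: "g \<in> left_module_hom R M N"
    and L: "left_module R L" by (simp_all add: left_module_category_def)
  interpret L: left_module R L by (rule L)
  have [simp]: "f x \<in> carrier M" if "x \<in> carrier L" for x using f that by (auto simp: left_module_hom_def)
  have [simp]: "g x \<in> carrier N" if "x \<in> carrier M" for x using g that by (auto simp: left_module_hom_def)
  show "Comp (left_module_category R) L M N g f \<in> Hom (left_module_category R) L N"
    using f g L.smult_closed
    by (auto simp: left_module_category_def left_module_hom_def compose_def)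
next
  fix M assume "M \<in> Obj (left_module_category R)"
  then interpret M: left_module R M by (simp add: left_module_category_def)
  show "Ident (left_module_category R) M \<in> Hom (left_module_category R) M M"
    using M.smult_closed by (auto simp: left_module_category_def left_module_hom_def)
next
  fix M N f assume "f \<in> Hom (left_module_category R) M N"
  then have "f \<in> carrier M \<rightarrow>\<^sub>E carrier N" by (auto simp: left_module_category_def left_module_hom_def)
  then show "Comp (left_module_category R) M M N f (Ident (left_module_category R) M) = f"
    "Comp (left_module_category R) M N N (Ident (left_module_category R) N) f = f"
    by (auto simp: left_module_category_def compose_def PiE_iff extensional_def fun_eq_iff restrict_def)
next
  fix K L M N f g h
  assume "f \<in> Hom (left_module_category R) K L"
  then have "f \<in> carrier K \<rightarrow>\<^sub>E carrier L" by (auto simp: left_module_category_def left_module_hom_def)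
  then show "Comp (left_module_category R) K M N h (Comp (left_module_category R) K L M g f) =
      Comp (left_module_category R) K L N (Comp (left_module_category R) L M N h g) f"
    by (auto simp: left_module_category_def compose_def fun_eq_iff restrict_def PiE_iff)
qed

text \<open>An infinite set is in bijection with its square, so one coordinate can be packed
  together with the code of the remaining ones.\<close>

lemma ex_inj_finite_power:
  assumes u: "infinite (UNIV :: 'u set)" and I: "finite I"
  shows "\<exists>J :: ('i \<Rightarrow> 'u) \<Rightarrow> 'u. inj_on J (I \<rightarrow>\<^sub>E UNIV)"
  using I
proof (induction I)
  case empty
  show ?case by (simp add: PiE_empty_domain)
next
  case (insert i I)
  obtain p :: "'u \<times> 'u \<Rightarrow> 'u" where p: "inj p"
  proof -
    have "\<exists>p :: 'u \<times> 'u \<Rightarrow> 'u. inj_on p (UNIV \<times> UNIV) \<and> p ` (UNIV \<times> UNIV) \<subseteq> UNIV"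
      using card_of_Times_same_infinite[OF u] by (simp only: ordIso_iff_ordLeq card_of_ordLeq)
    then show ?thesis using that by auto
  qed
  obtain J :: "('i \<Rightarrow> 'u) \<Rightarrow> 'u" where J: "inj_on J (I \<rightarrow>\<^sub>E UNIV)" using insert by blast
  have "inj_on (\<lambda>f. p (f i, J (restrict f I))) (insert i I \<rightarrow>\<^sub>E UNIV)"
  proof (rule inj_onI)
    fix f f' :: "'i \<Rightarrow> 'u"
    assume ff: "f \<in> insert i I \<rightarrow>\<^sub>E UNIV" "f' \<in> insert i I \<rightarrow>\<^sub>E UNIV"
      and "p (f i, J (restrict f I)) = p (f' i, J (restrict f' I))"
    then have "f i = f' i" "J (restrict f I) = J (restrict f' I)" using p by (auto dest: injD)
    then have "f i = f' i" "restrict f I = restrict f' I" using inj_onD[OF J] by auto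
    then have "f x = f' x" if "x \<in> insert i I" for x using that by (auto simp: restrict_def fun_eq_iff split: if_splits)
    then show "f = f'" using ff by (intro PiE_ext)
  qed
  then show ?case by blast
qed

text \<open>\<open>\<phi>\<close> respects sums and products but sends the unit only to an
  idempotent e; by \<open>phi_onto\<close> its image is e A e. The finite family \<open>g\<close>
  generates eA as a left module over B, which is the finiteness behind the encoding.\<close>

locale corner = A: ring A + B: ring B
  for A :: "'a ring" and B :: "'b ring" +
  fixes \<phi> :: "'b \<Rightarrow> 'a" and I :: "'i set" and g :: "'i \<Rightarrow> 'a"
  assumes phi_closed [simp]: "b \<in> carrier B \<Longrightarrow> \<phi> b \<in> carrier A"
    and phi_add: "\<lbrakk>b \<in> carrier B; c \<in> carrier B\<rbrakk> \<Longrightarrow> \<phi> (b \<oplus>\<^bsub>B\<^esub> c) = \<phi> b \<oplus>\<^bsub>A\<^esub> \<phi> c"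
    and phi_mult: "\<lbrakk>b \<in> carrier B; c \<in> carrier B\<rbrakk> \<Longrightarrow> \<phi> (b \<otimes>\<^bsub>B\<^esub> c) = \<phi> b \<otimes>\<^bsub>A\<^esub> \<phi> c"
    and phi_inj: "inj_on \<phi> (carrier B)"
    and phi_onto: "\<lbrakk>x \<in> carrier A; \<phi> \<one>\<^bsub>B\<^esub> \<otimes>\<^bsub>A\<^esub> x = x; x \<otimes>\<^bsub>A\<^esub> \<phi> \<one>\<^bsub>B\<^esub> = x\<rbrakk> \<Longrightarrow> x \<in> \<phi> ` carrier B"
    and finite_I: "finite I"
    and g_closed: "i \<in> I \<Longrightarrow> g i \<in> carrier A"
    and g_left: "i \<in> I \<Longrightarrow> \<phi> \<one>\<^bsub>B\<^esub> \<otimes>\<^bsub>A\<^esub> g i = g i"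
    and generating: "\<lbrakk>x \<in> carrier A; \<phi> \<one>\<^bsub>B\<^esub> \<otimes>\<^bsub>A\<^esub> x = x\<rbrakk> \<Longrightarrow>
      \<exists>c \<in> I \<rightarrow> carrier B. x = (\<Oplus>\<^bsub>A\<^esub>i\<in>I. \<phi> (c i) \<otimes>\<^bsub>A\<^esub> g i)"
begin

abbreviation e :: 'a where "e \<equiv> \<phi> \<one>\<^bsub>B\<^esub>"

definition eA :: "'a set" where "eA = {x \<in> carrier A. e \<otimes>\<^bsub>A\<^esub> x = x}"

text \<open>The projection x to x e of eA onto e A e, read in B. It is B-linear on both sides and
  inverts \<open>\<phi>\<close> on the corner.\<close>

definition psi :: "'a \<Rightarrow> 'b" where "psi x = inv_into (carrier B) \<phi> (x \<otimes>\<^bsub>A\<^esub> e)"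

lemma phi_e [simp]: "b \<in> carrier B \<Longrightarrow> e \<otimes>\<^bsub>A\<^esub> \<phi> b = \<phi> b" "b \<in> carrier B \<Longrightarrow> \<phi> b \<otimes>\<^bsub>A\<^esub> e = \<phi> b"
  using phi_mult[of "\<one>\<^bsub>B\<^esub>" b] phi_mult[of b "\<one>\<^bsub>B\<^esub>"] by simp_all

lemma eA_carrier: "x \<in> eA \<Longrightarrow> x \<in> carrier A" by (simp add: eA_def)

lemma eA_left: "x \<in> eA \<Longrightarrow> e \<otimes>\<^bsub>A\<^esub> x = x" by (simp add: eA_def)

lemma phi_eA: "b \<in> carrier B \<Longrightarrow> \<phi> b \<in> eA" by (simp add: eA_def)

lemma eA_add: "x \<in> eA \<Longrightarrow> y \<in> eA \<Longrightarrow> x \<oplus>\<^bsub>A\<^esub> y \<in> eA"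
  by (simp add: eA_def A.r_distr)

lemma eA_zero: "\<zero>\<^bsub>A\<^esub> \<in> eA"
  by (simp add: eA_def)

lemma eA_mult: "x \<in> eA \<Longrightarrow> a \<in> carrier A \<Longrightarrow> x \<otimes>\<^bsub>A\<^esub> a \<in> eA"
  by (simp add: eA_def A.m_assoc[symmetric])

lemma g_eA: "i \<in> I \<Longrightarrow> g i \<in> eA"
  by (simp add: eA_def g_closed g_left)

lemma psi:
  assumes "x \<in> eA"
  shows "psi x \<in> carrier B" "\<phi> (psi x) = x \<otimes>\<^bsub>A\<^esub> e"
proof -
  have "e \<otimes>\<^bsub>A\<^esub> (x \<otimes>\<^bsub>A\<^esub> e) = x \<otimes>\<^bsub>A\<^esub> e"
    using assms by (simp add: eA_def A.m_assoc[symmetric])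
  moreover have "x \<otimes>\<^bsub>A\<^esub> e \<otimes>\<^bsub>A\<^esub> e = x \<otimes>\<^bsub>A\<^esub> e"
    using assms by (simp add: eA_carrier A.m_assoc)
  ultimately have "x \<otimes>\<^bsub>A\<^esub> e \<in> \<phi> ` carrier B"
    using assms by (intro phi_onto) (simp_all add: eA_carrier)
  then show "psi x \<in> carrier B" "\<phi> (psi x) = x \<otimes>\<^bsub>A\<^esub> e"
    unfolding psi_def by (rule inv_into_into, rule f_inv_into_f)
qed

lemma psi_eqI: "x \<in> eA \<Longrightarrow> b \<in> carrier B \<Longrightarrow> x \<otimes>\<^bsub>A\<^esub> e = \<phi> b \<Longrightarrow> psi x = b"
  using psi[of x] inj_onD[OF phi_inj] by auto

lemma psi_add: "x \<in> eA \<Longrightarrow> y \<in> eA \<Longrightarrow> psi (x \<oplus>\<^bsub>A\<^esub> y) = psi x \<oplus>\<^bsub>B\<^esub> psi y"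
  by (intro psi_eqI eA_add) (simp_all add: psi phi_add A.l_distr eA_carrier)

lemma psi_mult_left: "x \<in> eA \<Longrightarrow> b \<in> carrier B \<Longrightarrow> psi (\<phi> b \<otimes>\<^bsub>A\<^esub> x) = b \<otimes>\<^bsub>B\<^esub> psi x"
  by (intro psi_eqI eA_mult) (simp_all add: psi phi_mult A.m_assoc eA_carrier phi_eA)

lemma psi_mult_right:
  assumes "x \<in> eA" "b \<in> carrier B"
  shows "psi (x \<otimes>\<^bsub>A\<^esub> \<phi> b) = psi x \<otimes>\<^bsub>B\<^esub> b"
proof (rule psi_eqI)
  have "x \<otimes>\<^bsub>A\<^esub> \<phi> b \<otimes>\<^bsub>A\<^esub> e = x \<otimes>\<^bsub>A\<^esub> e \<otimes>\<^bsub>A\<^esub> \<phi> b" using assms by (simp add: A.m_assoc eA_carrier)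
  then show "x \<otimes>\<^bsub>A\<^esub> \<phi> b \<otimes>\<^bsub>A\<^esub> e = \<phi> (psi x \<otimes>\<^bsub>B\<^esub> b)" using assms by (simp add: psi phi_mult)
qed (use assms in \<open>simp_all add: psi eA_mult\<close>)

lemma psi_phi: "b \<in> carrier B \<Longrightarrow> psi (\<phi> b) = b"
  by (rule psi_eqI) (simp_all add: phi_eA)

definition homs :: "('b, 'u) module \<Rightarrow> ('a \<Rightarrow> 'u) set" where
  "homs M = {h \<in> eA \<rightarrow>\<^sub>E carrier M.
     (\<forall>x \<in> eA. \<forall>y \<in> eA. h (x \<oplus>\<^bsub>A\<^esub> y) = h x \<oplus>\<^bsub>M\<^esub> h y) \<and>
     (\<forall>b \<in> carrier B. \<forall>x \<in> eA. h (\<phi> b \<otimes>\<^bsub>A\<^esub> x) = b \<odot>\<^bsub>M\<^esub> h x)}"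

definition add_hom :: "('b, 'u) module \<Rightarrow> ('a \<Rightarrow> 'u) \<Rightarrow> ('a \<Rightarrow> 'u) \<Rightarrow> 'a \<Rightarrow> 'u" where
  "add_hom M h k = (\<lambda>x \<in> eA. h x \<oplus>\<^bsub>M\<^esub> k x)"

definition zero_hom :: "('b, 'u) module \<Rightarrow> 'a \<Rightarrow> 'u" where
  "zero_hom M = (\<lambda>x \<in> eA. \<zero>\<^bsub>M\<^esub>)"

text \<open>Right multiplication on the source yields a left action: applying b and then a sends h
  to x mapping to h(x a b), which is the action of a b.\<close>

definition act_hom :: "'a \<Rightarrow> ('a \<Rightarrow> 'u) \<Rightarrow> 'a \<Rightarrow> 'u" where
  "act_hom a h = (\<lambda>x \<in> eA. h (x \<otimes>\<^bsub>A\<^esub> a))"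

text \<open>The B-linear map on eA that takes e to \<open>u\<close> and kills eA(1 - e). These maps
  form the part of Hom(eA, M) fixed by e, and evaluation at e identifies it with M.\<close>

definition point_hom :: "('b, 'u) module \<Rightarrow> 'u \<Rightarrow> 'a \<Rightarrow> 'u" where
  "point_hom M u = (\<lambda>x \<in> eA. psi x \<odot>\<^bsub>M\<^esub> u)"

lemma homs_add: "h \<in> homs M \<Longrightarrow> x \<in> eA \<Longrightarrow> y \<in> eA \<Longrightarrow> h (x \<oplus>\<^bsub>A\<^esub> y) = h x \<oplus>\<^bsub>M\<^esub> h y"
  by (simp add: homs_def)

lemma homs_smult: "h \<in> homs M \<Longrightarrow> b \<in> carrier B \<Longrightarrow> x \<in> eA \<Longrightarrow> h (\<phi> b \<otimes>\<^bsub>A\<^esub> x) = b \<odot>\<^bsub>M\<^esub> h x"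
  by (simp add: homs_def)

lemma homs_extensional: "h \<in> homs M \<Longrightarrow> h \<in> extensional eA"
  by (simp add: homs_def PiE_iff)

lemma homs_eqI: "h \<in> homs M \<Longrightarrow> k \<in> homs N \<Longrightarrow> (\<And>x. x \<in> eA \<Longrightarrow> h x = k x) \<Longrightarrow> h = k"
  by (rule extensionalityI[OF homs_extensional homs_extensional])

lemma homsI:
  assumes "h \<in> extensional eA" "\<And>x. x \<in> eA \<Longrightarrow> h x \<in> carrier M"
    "\<And>x y. x \<in> eA \<Longrightarrow> y \<in> eA \<Longrightarrow> h (x \<oplus>\<^bsub>A\<^esub> y) = h x \<oplus>\<^bsub>M\<^esub> h y"
    "\<And>b x. b \<in> carrier B \<Longrightarrow> x \<in> eA \<Longrightarrow> h (\<phi> b \<otimes>\<^bsub>A\<^esub> x) = b \<odot>\<^bsub>M\<^esub> h x"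
  shows "h \<in> homs M"
  using assms by (auto simp: homs_def PiE_iff)

lemma homs_closed [simp]: "h \<in> homs M \<Longrightarrow> x \<in> eA \<Longrightarrow> h x \<in> carrier M"
  by (auto simp: homs_def)

lemma phi_mult_eA: "b \<in> carrier B \<Longrightarrow> x \<in> eA \<Longrightarrow> \<phi> b \<otimes>\<^bsub>A\<^esub> x \<in> eA"
  by (simp add: eA_mult phi_eA eA_carrier)

lemma act_hom_closed:
  assumes h: "h \<in> homs M" and a: "a \<in> carrier A"
  shows "act_hom a h \<in> homs M"
  using assms by (intro homsI)
    (simp_all add: act_hom_def eA_mult eA_add A.l_distr homs_add eA_carrier phi_mult_eA A.m_assoc homs_smult)

context
  fixes M :: "('b, 'u) module"
  assumes M: "left_module B M"
begin

interpretation M: left_module B M by (rule M)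

lemma add_hom_closed: "h \<in> homs M \<Longrightarrow> k \<in> homs M \<Longrightarrow> add_hom M h k \<in> homs M"
  by (intro homsI) (simp_all add: add_hom_def eA_add phi_mult_eA homs_add homs_smult M.smult_r_distr M.a_ac)

lemma zero_hom_closed: "zero_hom M \<in> homs M"
proof (intro homsI)
  fix b x assume b: "b \<in> carrier B" and x: "x \<in> eA"
  have "b \<odot>\<^bsub>M\<^esub> \<zero>\<^bsub>M\<^esub> \<oplus>\<^bsub>M\<^esub> b \<odot>\<^bsub>M\<^esub> \<zero>\<^bsub>M\<^esub> = b \<odot>\<^bsub>M\<^esub> \<zero>\<^bsub>M\<^esub>"
    using b M.smult_r_distr[of b "\<zero>\<^bsub>M\<^esub>" "\<zero>\<^bsub>M\<^esub>"] by simp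
  then have "b \<odot>\<^bsub>M\<^esub> \<zero>\<^bsub>M\<^esub> = \<zero>\<^bsub>M\<^esub>" 
    using b M.smult_closed[of b "\<zero>\<^bsub>M\<^esub>"]
      M.M.add.r_cancel_one[of "b \<odot>\<^bsub>M\<^esub> \<zero>\<^bsub>M\<^esub>" "b \<odot>\<^bsub>M\<^esub> \<zero>\<^bsub>M\<^esub>"] by simp
  then show "zero_hom M (\<phi> b \<otimes>\<^bsub>A\<^esub> x) = b \<odot>\<^bsub>M\<^esub> zero_hom M x"
    using b x by (simp add: zero_hom_def phi_mult_eA)
qed (simp_all add: zero_hom_def eA_add)

lemma point_hom_closed: "u \<in> carrier M \<Longrightarrow> point_hom M u \<in> homs M"
  by (intro homsI) (simp_all add: point_hom_def psi M.smult_closed eA_add phi_mult_eA psi_add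
    M.smult_l_distr psi_mult_left M.smult_assoc)

lemma point_hom_e: "u \<in> carrier M \<Longrightarrow> point_hom M u e = u"
  by (simp add: point_hom_def phi_eA psi_phi M.smult_one)

lemma point_hom_add:
  assumes "u \<in> carrier M" "v \<in> carrier M"
  shows "point_hom M (u \<oplus>\<^bsub>M\<^esub> v) = add_hom M (point_hom M u) (point_hom M v)"
  using assms by (intro homs_eqI[of _ M _ M] point_hom_closed add_hom_closed)
    (simp_all add: point_hom_def add_hom_def psi M.smult_r_distr)

lemma point_hom_smult:
  assumes "u \<in> carrier M" "b \<in> carrier B"
  shows "point_hom M (b \<odot>\<^bsub>M\<^esub> u) = act_hom (\<phi> b) (point_hom M u)"
  using assms by (intro homs_eqI[of _ M _ M] point_hom_closed act_hom_closed)
    (simp_all add: point_hom_def act_hom_def psi M.smult_closed eA_mult psi_mult_right M.smult_assoc)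

text \<open>Every element of a coinduced module is, after acting by \<open>y\<close>, determined by one value.
  This makes the functor full.\<close>

lemma act_hom_point:
  assumes h: "h \<in> homs M" and y: "y \<in> eA"
  shows "act_hom y h = point_hom M (h y)"
proof (rule homs_eqI[of _ M _ M])
  fix x assume x: "x \<in> eA"
  have "h (x \<otimes>\<^bsub>A\<^esub> y) = h (\<phi> (psi x) \<otimes>\<^bsub>A\<^esub> y)"
    using x y by (simp add: psi A.m_assoc eA_carrier eA_left)
  then show "act_hom y h x = point_hom M (h y) x"
    using x homs_smult[OF h psi(1)[OF x] y] by (simp add: act_hom_def point_hom_def)
qed (use h y in \<open>simp_all add: act_hom_closed point_hom_closed eA_carrier\<close>)

lemma homs_zero: "h \<in> homs M \<Longrightarrow> h \<zero>\<^bsub>A\<^esub> = \<zero>\<^bsub>M\<^esub>"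
  using homs_add[of h M "\<zero>\<^bsub>A\<^esub>" "\<zero>\<^bsub>A\<^esub>"] homs_closed[of h M "\<zero>\<^bsub>A\<^esub>"] eA_zero
    M.M.add.r_cancel_one[of "h \<zero>\<^bsub>A\<^esub>" "h \<zero>\<^bsub>A\<^esub>"] by simp

lemma homs_finsum:
  assumes h: "h \<in> homs M" and "finite T" and "\<And>i. i \<in> T \<Longrightarrow> F i \<in> eA"
  shows "(\<Oplus>\<^bsub>A\<^esub>i\<in>T. F i) \<in> eA \<and> h (\<Oplus>\<^bsub>A\<^esub>i\<in>T. F i) = (\<Oplus>\<^bsub>M\<^esub>i\<in>T. h (F i))"
  using assms(2,3)
proof (induction T)
  case empty
  then show ?case by (simp add: eA_zero homs_zero[OF h])
next
  case (insert i T)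
  have "(\<Oplus>\<^bsub>A\<^esub>j\<in>insert i T. F j) = F i \<oplus>\<^bsub>A\<^esub> (\<Oplus>\<^bsub>A\<^esub>j\<in>T. F j)"
    using insert by (intro A.finsum_insert) (auto intro: eA_carrier)
  moreover have "(\<Oplus>\<^bsub>M\<^esub>j\<in>insert i T. h (F j)) = h (F i) \<oplus>\<^bsub>M\<^esub> (\<Oplus>\<^bsub>M\<^esub>j\<in>T. h (F j))"
    using insert h by (intro M.M.finsum_insert) auto
  ultimately show ?case using insert by (simp add: eA_add homs_add[OF h])
qed

text \<open>Linearity over B and the generators \<open>g\<close> leave no freedom beyond the
  finitely many values h(g i). This is what allows a map to be stored as a finite tuple.\<close>

lemma homs_determined:
  assumes h: "h \<in> homs M" and k: "k \<in> homs M" and eq: "\<And>i. i \<in> I \<Longrightarrow> h (g i) = k (g i)"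
  shows "h = k"
proof (rule homs_eqI[OF h k])
  fix x assume x: "x \<in> eA"
  then obtain c where c: "c \<in> I \<rightarrow> carrier B" "x = (\<Oplus>\<^bsub>A\<^esub>i\<in>I. \<phi> (c i) \<otimes>\<^bsub>A\<^esub> g i)"
    using generating[of x] by (auto simp: eA_def)
  have cl: "\<phi> (c i) \<otimes>\<^bsub>A\<^esub> g i \<in> eA" if "i \<in> I" for i using c that by (intro phi_mult_eA g_eA) auto
  have "h x = (\<Oplus>\<^bsub>M\<^esub>i\<in>I. h (\<phi> (c i) \<otimes>\<^bsub>A\<^esub> g i))"
    using homs_finsum[OF h finite_I cl] c(2) by simp
  also have "\<dots> = (\<Oplus>\<^bsub>M\<^esub>i\<in>I. k (\<phi> (c i) \<otimes>\<^bsub>A\<^esub> g i))"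
  proof (rule M.M.finsum_cong')
    show "(\<lambda>i. k (\<phi> (c i) \<otimes>\<^bsub>A\<^esub> g i)) \<in> I \<rightarrow> carrier M" using k cl by simp
    fix i assume i: "i \<in> I"
    then have "c i \<in> carrier B" using c by auto
    then show "h (\<phi> (c i) \<otimes>\<^bsub>A\<^esub> g i) = k (\<phi> (c i) \<otimes>\<^bsub>A\<^esub> g i)"
      using i eq h k by (simp add: homs_smult g_eA)
  qed simp
  also have "\<dots> = k x" using homs_finsum[OF k finite_I cl] c(2) by simp
  finally show "h x = k x" .
qed

end

end

text \<open>By \<open>homs_determined\<close>, the elements of the coinduced modules are encoded by finitely many
  elements of \<open>'u\<close>, hence by a single one.\<close>

locale corner_encoding = corner A B \<phi> I g
  for A :: "'a ring" and B :: "'b ring" and \<phi> :: "'b \<Rightarrow> 'a" and I :: "'i set" and g :: "'i \<Rightarrow> 'a" +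
  fixes J :: "('i \<Rightarrow> 'u) \<Rightarrow> 'u"
  assumes J: "inj_on J (I \<rightarrow>\<^sub>E UNIV)"
begin

definition enc :: "('a \<Rightarrow> 'u) \<Rightarrow> 'u" where "enc h = J (\<lambda>i \<in> I. h (g i))"

definition dec :: "('b, 'u) module \<Rightarrow> 'u \<Rightarrow> 'a \<Rightarrow> 'u" where "dec M = inv_into (homs M) enc"

text \<open>The structure of Hom(eA, M) transported to codes: decode, operate on maps, encode
  again.\<close>

definition coind :: "('b, 'u) module \<Rightarrow> ('a, 'u) module" where
  "coind M = \<lparr>carrier = enc ` homs M, mult = (\<lambda>x y. x), one = enc (zero_hom M),
     zero = enc (zero_hom M), add = (\<lambda>x y. enc (add_hom M (dec M x) (dec M y))),
     smult = (\<lambda>a x. enc (act_hom a (dec M x)))\<rparr>"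

definition coind_map :: "('b, 'u) module \<Rightarrow> ('b, 'u) module \<Rightarrow> ('u \<Rightarrow> 'u) \<Rightarrow> 'u \<Rightarrow> 'u" where
  "coind_map M N f = (\<lambda>x \<in> carrier (coind M). enc (\<lambda>y \<in> eA. f (dec M x y)))"

lemma inj_enc: "left_module B M \<Longrightarrow> inj_on enc (homs M)"
proof (rule inj_onI)
  fix h k assume M: "left_module B M" and hk: "h \<in> homs M" "k \<in> homs M" "enc h = enc k"
  have "(\<lambda>i\<in>I. h (g i)) = (\<lambda>i\<in>I. k (g i))"
    using hk(3) inj_onD[OF J] by (auto simp: enc_def)
  then have "h (g i) = k (g i)" if "i \<in> I" for i using that by (metis restrict_apply')
  then show "h = k" by (rule homs_determined[OF M hk(1,2)])
qed

lemma dec_enc [simp]: "left_module B M \<Longrightarrow> h \<in> homs M \<Longrightarrow> dec M (enc h) = h"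
  unfolding dec_def by (rule inv_into_f_f[OF inj_enc])

lemma coind_carrier: "carrier (coind M) = enc ` homs M"
  by (simp add: coind_def)

lemma dec_homs: "x \<in> carrier (coind M) \<Longrightarrow> dec M x \<in> homs M"
  unfolding coind_carrier dec_def by (rule inv_into_into)

lemma enc_dec: "x \<in> carrier (coind M) \<Longrightarrow> enc (dec M x) = x"
  unfolding coind_carrier dec_def by (rule f_inv_into_f[where f = enc])

lemma left_module_coind:
  assumes M: "left_module B M"
  shows "left_module A (coind M)"
proof -
  interpret M: left_module B M by (rule M)
  note cl = add_hom_closed[OF M] zero_hom_closed[OF M] act_hom_closed
  note de = dec_enc[OF M]
  have ab: "abelian_group (coind M)"
  proof (rule abelian_groupI)
    fix x y z assume xyz: "x \<in> carrier (coind M)" "y \<in> carrier (coind M)" "z \<in> carrier (coind M)"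
    then obtain h k l where hkl: "h \<in> homs M" "k \<in> homs M" "l \<in> homs M" "x = enc h" "y = enc k" "z = enc l"
      by (auto simp: coind_carrier)
    show "x \<oplus>\<^bsub>coind M\<^esub> y \<oplus>\<^bsub>coind M\<^esub> z = x \<oplus>\<^bsub>coind M\<^esub> (y \<oplus>\<^bsub>coind M\<^esub> z)"
    proof -
      have "add_hom M (add_hom M h k) l = add_hom M h (add_hom M k l)"
        using hkl by (intro homs_eqI[of _ M _ M] cl) (simp_all add: add_hom_def M.a_assoc)
      then show ?thesis using hkl by (simp add: coind_def de cl)
    qed
  next
    fix x y assume xyz: "x \<in> carrier (coind M)" "y \<in> carrier (coind M)"
    then obtain h k where hk: "h \<in> homs M" "k \<in> homs M" "x = enc h" "y = enc k"
      by (auto simp: coind_carrier)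
    show "x \<oplus>\<^bsub>coind M\<^esub> y \<in> carrier (coind M)" using hk by (simp add: coind_def de cl)
    have "add_hom M h k = add_hom M k h"
      using hk by (intro homs_eqI[of _ M _ M] cl) (simp_all add: add_hom_def M.a_comm)
    then show "x \<oplus>\<^bsub>coind M\<^esub> y = y \<oplus>\<^bsub>coind M\<^esub> x" using hk by (simp add: coind_def de)
  next
    show "\<zero>\<^bsub>coind M\<^esub> \<in> carrier (coind M)" by (simp add: coind_def cl)
  next
    fix x assume x: "x \<in> carrier (coind M)"
    then obtain h where h: "h \<in> homs M" "x = enc h" by (auto simp: coind_carrier)
    have "add_hom M (zero_hom M) h = h"
      using h by (intro homs_eqI[of _ M _ M] cl) (simp_all add: add_hom_def zero_hom_def)
    then show "\<zero>\<^bsub>coind M\<^esub> \<oplus>\<^bsub>coind M\<^esub> x = x" using h by (simp add: coind_def de cl)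
    \<comment> \<open>The negative of \<open>h\<close> is obtained by letting -1 act, so its
      linearity is an instance of \<open>act_hom_closed\<close>.\<close>
    define k where "k = (\<lambda>y \<in> eA. h ((\<ominus>\<^bsub>A\<^esub> \<one>\<^bsub>A\<^esub>) \<otimes>\<^bsub>A\<^esub> y))"
    have ka: "k = act_hom (\<ominus>\<^bsub>A\<^esub> \<one>\<^bsub>A\<^esub>) h"
      unfolding k_def act_hom_def
      by (rule restrict_ext) (simp add: eA_carrier A.l_minus A.r_minus)
    have k: "k \<in> homs M" unfolding ka using h by (simp add: cl)
    have "add_hom M k h = zero_hom M"
    proof (rule homs_eqI[of _ M _ M])
      fix y assume y: "y \<in> eA"
      have neg: "y \<otimes>\<^bsub>A\<^esub> (\<ominus>\<^bsub>A\<^esub> \<one>\<^bsub>A\<^esub>) \<in> eA" using y by (simp add: eA_mult)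
      have "y \<otimes>\<^bsub>A\<^esub> (\<ominus>\<^bsub>A\<^esub> \<one>\<^bsub>A\<^esub>) \<oplus>\<^bsub>A\<^esub> y = \<zero>\<^bsub>A\<^esub>"
        using y by (simp add: eA_carrier A.r_minus A.l_neg)
      then have "h (y \<otimes>\<^bsub>A\<^esub> (\<ominus>\<^bsub>A\<^esub> \<one>\<^bsub>A\<^esub>)) \<oplus>\<^bsub>M\<^esub> h y = \<zero>\<^bsub>M\<^esub>"
        using homs_add[OF h(1) neg y] homs_zero[OF M h(1)] by simp
      then show "add_hom M k h y = zero_hom M y"
        unfolding ka using y by (simp add: add_hom_def act_hom_def zero_hom_def)
    qed (use h k in \<open>simp_all add: cl\<close>)
    then have "enc k \<oplus>\<^bsub>coind M\<^esub> x = \<zero>\<^bsub>coind M\<^esub>" using h k by (simp add: coind_def de)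
    then show "\<exists>y\<in>carrier (coind M). y \<oplus>\<^bsub>coind M\<^esub> x = \<zero>\<^bsub>coind M\<^esub>"
      using k by (auto simp: coind_carrier)
  qed
  interpret C: abelian_group "coind M" by (rule ab)
  show ?thesis
  proof (unfold_locales)
    fix a b x assume ab: "a \<in> carrier A" "b \<in> carrier A" and x: "x \<in> carrier (coind M)"
    then obtain h where h: "h \<in> homs M" "x = enc h" by (auto simp: coind_carrier)
    have "act_hom (a \<oplus>\<^bsub>A\<^esub> b) h = add_hom M (act_hom a h) (act_hom b h)"
      using h ab by (intro homs_eqI[of _ M _ M] cl A.a_closed)
        (simp_all add: act_hom_def add_hom_def A.r_distr eA_carrier homs_add[OF h(1)] eA_mult)
    then show "(a \<oplus>\<^bsub>A\<^esub> b) \<odot>\<^bsub>coind M\<^esub> x = a \<odot>\<^bsub>coind M\<^esub> x \<oplus>\<^bsub>coind M\<^esub> b \<odot>\<^bsub>coind M\<^esub> x"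
      using h ab by (simp add: coind_def de cl)
    have "act_hom (a \<otimes>\<^bsub>A\<^esub> b) h = act_hom a (act_hom b h)"
      using h ab by (intro homs_eqI[of _ M _ M] cl A.m_closed)
        (simp_all add: act_hom_def A.m_assoc eA_carrier eA_mult)
    then show "(a \<otimes>\<^bsub>A\<^esub> b) \<odot>\<^bsub>coind M\<^esub> x = a \<odot>\<^bsub>coind M\<^esub> (b \<odot>\<^bsub>coind M\<^esub> x)"
      using h ab by (simp add: coind_def de cl)
  next
    fix a x assume a: "a \<in> carrier A" and x: "x \<in> carrier (coind M)"
    then obtain h where h: "h \<in> homs M" "x = enc h" by (auto simp: coind_carrier)
    show "a \<odot>\<^bsub>coind M\<^esub> x \<in> carrier (coind M)" using h a by (simp add: coind_def de cl)
  next
    fix a x y assume a: "a \<in> carrier A" and x: "x \<in> carrier (coind M)" "y \<in> carrier (coind M)"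
    then obtain h k where hk: "h \<in> homs M" "k \<in> homs M" "x = enc h" "y = enc k" by (auto simp: coind_carrier)
    have "act_hom a (add_hom M h k) = add_hom M (act_hom a h) (act_hom a k)"
      using hk a by (intro homs_eqI[of _ M _ M] cl) (simp_all add: act_hom_def add_hom_def eA_mult)
    then show "a \<odot>\<^bsub>coind M\<^esub> (x \<oplus>\<^bsub>coind M\<^esub> y) = a \<odot>\<^bsub>coind M\<^esub> x \<oplus>\<^bsub>coind M\<^esub> a \<odot>\<^bsub>coind M\<^esub> y"
      using hk a by (simp add: coind_def de cl)
  next
    fix x assume x: "x \<in> carrier (coind M)"
    then obtain h where h: "h \<in> homs M" "x = enc h" by (auto simp: coind_carrier)
    have "act_hom \<one>\<^bsub>A\<^esub> h = h"
      using h by (intro homs_eqI[of _ M _ M] cl) (simp_all add: act_hom_def eA_carrier)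
    then show "\<one>\<^bsub>A\<^esub> \<odot>\<^bsub>coind M\<^esub> x = x" using h by (simp add: coind_def de)
  qed
qed

lemma compose_homs:
  assumes f: "f \<in> left_module_hom B M N" and h: "h \<in> homs M"
  shows "(\<lambda>y \<in> eA. f (h y)) \<in> homs N"
  using f h by (intro homsI)
    (auto simp: left_module_hom_def eA_add phi_mult_eA homs_add homs_smult)

lemma coind_map_closed:
  assumes M: "left_module B M" and N: "left_module B N" and f: "f \<in> left_module_hom B M N"
  shows "coind_map M N f \<in> left_module_hom A (coind M) (coind N)"
proof -
  have map: "coind_map M N f (enc h) = enc (\<lambda>y \<in> eA. f (h y))" if "h \<in> homs M" for h
    using that by (simp add: coind_map_def coind_carrier dec_enc[OF M])
  note cl = add_hom_closed[OF M] zero_hom_closed[OF M] act_hom_closed add_hom_closed[OF N]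
    zero_hom_closed[OF N] compose_homs[OF f]
  have fadd: "f (u \<oplus>\<^bsub>M\<^esub> v) = f u \<oplus>\<^bsub>N\<^esub> f v" if "u \<in> carrier M" "v \<in> carrier M" for u v
    using f that by (simp add: left_module_hom_def)
  have "coind_map M N f \<in> carrier (coind M) \<rightarrow>\<^sub>E carrier (coind N)"
    using cl(6) dec_homs by (auto simp: coind_map_def coind_carrier[of N])
  moreover have "coind_map M N f (x \<oplus>\<^bsub>coind M\<^esub> y) = coind_map M N f x \<oplus>\<^bsub>coind N\<^esub> coind_map M N f y"
    if xy: "x \<in> carrier (coind M)" "y \<in> carrier (coind M)" for x y
  proof -
    obtain h k where hk: "h \<in> homs M" "k \<in> homs M" "x = enc h" "y = enc k"
      using xy by (auto simp: coind_carrier)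
    have "(\<lambda>y \<in> eA. f (add_hom M h k y)) = add_hom N (\<lambda>y \<in> eA. f (h y)) (\<lambda>y \<in> eA. f (k y))"
      using hk by (intro homs_eqI[of _ N _ N] cl) (simp_all add: add_hom_def fadd)
    moreover have "x \<oplus>\<^bsub>coind M\<^esub> y = enc (add_hom M h k)" using hk by (simp add: coind_def dec_enc[OF M])
    ultimately have "coind_map M N f (x \<oplus>\<^bsub>coind M\<^esub> y) =
        enc (add_hom N (\<lambda>y \<in> eA. f (h y)) (\<lambda>y \<in> eA. f (k y)))"
      using hk by (simp add: map cl)
    also have "\<dots> = coind_map M N f x \<oplus>\<^bsub>coind N\<^esub> coind_map M N f y"
      using hk by (simp add: map coind_def dec_enc[OF N] cl)
    finally show ?thesis .
  qed
  moreover have "coind_map M N f (a \<odot>\<^bsub>coind M\<^esub> x) = a \<odot>\<^bsub>coind N\<^esub> coind_map M N f x"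
    if xa: "x \<in> carrier (coind M)" "a \<in> carrier A" for x a
  proof -
    obtain h where h: "h \<in> homs M" "x = enc h" using xa by (auto simp: coind_carrier)
    have "(\<lambda>y \<in> eA. f (act_hom a h y)) = act_hom a (\<lambda>y \<in> eA. f (h y))"
      using h xa by (intro homs_eqI[of _ N _ N] cl) (simp_all add: act_hom_def eA_mult)
    moreover have "a \<odot>\<^bsub>coind M\<^esub> x = enc (act_hom a h)" using h by (simp add: coind_def dec_enc[OF M])
    ultimately have "coind_map M N f (a \<odot>\<^bsub>coind M\<^esub> x) = enc (act_hom a (\<lambda>y \<in> eA. f (h y)))"
      using h xa by (simp add: map cl)
    also have "\<dots> = a \<odot>\<^bsub>coind N\<^esub> coind_map M N f x"
      using h by (simp add: map coind_def dec_enc[OF N] cl)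
    finally show ?thesis .
  qed
  ultimately show ?thesis by (simp add: left_module_hom_def)
qed

lemma coind_map_eval:
  assumes M: "left_module B M" and N: "left_module B N" and f: "f \<in> left_module_hom B M N"
    and h: "h \<in> homs M" and y: "y \<in> eA"
  shows "dec N (coind_map M N f (enc h)) y = f (h y)"
proof -
  have "coind_map M N f (enc h) = enc (\<lambda>y \<in> eA. f (h y))"
    using h by (simp add: coind_map_def coind_carrier dec_enc[OF M])
  then show ?thesis using y by (simp add: dec_enc[OF N compose_homs[OF f h]])
qed

text \<open>\<open>G\<close> commutes with the action of A. Its effect on the copy of M made of the
  maps \<open>point_hom M u\<close>, evaluated at e, defines \<open>f\<close>. This determines
  \<open>G\<close>, since evaluating a map at \<open>y\<close> means evaluating its translate by
  \<open>y\<close> at e, and that translate is a \<open>point_hom\<close>.\<close>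

lemma coind_map_full:
  assumes M: "left_module B M" and N: "left_module B N"
    and G: "G \<in> left_module_hom A (coind M) (coind N)"
  shows "\<exists>f \<in> left_module_hom B M N. G = coind_map M N f"
proof -
  interpret M: left_module B M by (rule M)
  interpret N: left_module B N by (rule N)
  define G' where "G' h = dec N (G (enc h))" for h
  define f where "f = (\<lambda>u \<in> carrier M. G' (point_hom M u) e)"
  have Gc: "G x \<in> carrier (coind N)" if "x \<in> carrier (coind M)" for x
    using G that by (auto simp: left_module_hom_def)
  have encc: "enc h \<in> carrier (coind M)" if "h \<in> homs M" for h using that by (simp add: coind_carrier)
  have G'c: "G' h \<in> homs N" if "h \<in> homs M" for h
    unfolding G'_def using that by (intro dec_homs Gc encc)
  have GG': "G (enc h) = enc (G' h)" if "h \<in> homs M" for h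
    unfolding G'_def using that by (simp add: enc_dec Gc encc)
  have G'add: "G' (add_hom M h k) = add_hom N (G' h) (G' k)" if hk: "h \<in> homs M" "k \<in> homs M" for h k
  proof -
    have "enc (add_hom M h k) = enc h \<oplus>\<^bsub>coind M\<^esub> enc k" using hk by (simp add: coind_def dec_enc[OF M])
    then have "G (enc (add_hom M h k)) = G (enc h) \<oplus>\<^bsub>coind N\<^esub> G (enc k)"
      using G hk encc by (simp add: left_module_hom_def)
    also have "\<dots> = enc (add_hom N (G' h) (G' k))" by (simp add: coind_def G'_def)
    finally show ?thesis using hk G'c by (simp add: G'_def[of "add_hom M h k"] dec_enc[OF N] add_hom_closed[OF N])
  qed
  have G'act: "G' (act_hom a h) = act_hom a (G' h)" if ha: "h \<in> homs M" "a \<in> carrier A" for h a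
  proof -
    have "enc (act_hom a h) = a \<odot>\<^bsub>coind M\<^esub> enc h" using ha by (simp add: coind_def dec_enc[OF M])
    then have "G (enc (act_hom a h)) = a \<odot>\<^bsub>coind N\<^esub> G (enc h)"
      using G ha encc by (simp add: left_module_hom_def)
    also have "\<dots> = enc (act_hom a (G' h))" by (simp add: coind_def G'_def)
    finally show ?thesis using ha G'c by (simp add: G'_def[of "act_hom a h"] dec_enc[OF N] act_hom_closed)
  qed
  have eeA: "e \<in> eA" by (simp add: phi_eA)
  have pc: "point_hom M u \<in> homs M" if "u \<in> carrier M" for u by (rule point_hom_closed[OF M that])
  have f: "f \<in> left_module_hom B M N"
    unfolding left_module_hom_def
  proof (intro CollectI conjI ballI)
    show "f \<in> carrier M \<rightarrow>\<^sub>E carrier N"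
      using pc G'c eeA by (auto simp: f_def)
    show "f (u \<oplus>\<^bsub>M\<^esub> v) = f u \<oplus>\<^bsub>N\<^esub> f v" if uv: "u \<in> carrier M" "v \<in> carrier M" for u v
    proof -
      have "f (u \<oplus>\<^bsub>M\<^esub> v) = G' (point_hom M (u \<oplus>\<^bsub>M\<^esub> v)) e" using uv by (simp add: f_def M.M.a_closed)
      also have "\<dots> = add_hom N (G' (point_hom M u)) (G' (point_hom M v)) e"
        unfolding point_hom_add[OF M uv] using uv by (simp only: G'add pc)
      also have "\<dots> = f u \<oplus>\<^bsub>N\<^esub> f v" using uv eeA by (simp add: add_hom_def f_def)
      finally show ?thesis .
    qed
    show "f (b \<odot>\<^bsub>M\<^esub> u) = b \<odot>\<^bsub>N\<^esub> f u" if "b \<in> carrier B" "u \<in> carrier M" for b u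
    proof -
      have "f (b \<odot>\<^bsub>M\<^esub> u) = G' (point_hom M u) (e \<otimes>\<^bsub>A\<^esub> \<phi> b)"
      proof -
        have "f (b \<odot>\<^bsub>M\<^esub> u) = G' (point_hom M (b \<odot>\<^bsub>M\<^esub> u)) e" using that by (simp add: f_def M.smult_closed)
        also have "\<dots> = act_hom (\<phi> b) (G' (point_hom M u)) e"
          using that by (simp only: point_hom_smult[OF M] G'act pc phi_closed)
        finally show ?thesis using eeA by (simp add: act_hom_def)
      qed
      \<comment> \<open>Both products equal \<phi>(b). The change of order turns right
        multiplication, through which A acts, into left multiplication by B, for which maps in
        \<open>homs\<close> are linear.\<close>
      also have "\<dots> = G' (point_hom M u) (\<phi> b \<otimes>\<^bsub>A\<^esub> e)" using that by simp
      also have "\<dots> = b \<odot>\<^bsub>N\<^esub> G' (point_hom M u) e" using that eeA by (intro homs_smult[OF G'c[OF pc]])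
      also have "\<dots> = b \<odot>\<^bsub>N\<^esub> f u" using that by (simp add: f_def)
      finally show ?thesis .
    qed
  qed
  have G'f: "G' h y = f (h y)" if h: "h \<in> homs M" and y: "y \<in> eA" for h y
  proof -
    have "G' h y = act_hom y (G' h) e" using y eeA by (simp add: act_hom_def eA_left)
    also have "\<dots> = G' (act_hom y h) e" using h y by (simp add: G'act eA_carrier)
    also have "\<dots> = f (h y)" using h y by (simp add: act_hom_point[OF M] f_def)
    finally show ?thesis .
  qed
  have "G x = coind_map M N f x" if x: "x \<in> carrier (coind M)" for x
  proof -
    obtain h where h: "h \<in> homs M" "x = enc h" using x by (auto simp: coind_carrier)
    have "G' h = (\<lambda>y \<in> eA. f (h y))"
      using h G'f by (intro homs_eqI[of _ N _ N] G'c compose_homs[OF f]) auto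
    then show ?thesis using h x by (simp add: GG' coind_map_def dec_enc[OF M])
  qed
  moreover have "coind_map M N f \<in> extensional (carrier (coind M))" by (simp add: coind_map_def)
  moreover have "G \<in> extensional (carrier (coind M))" using G by (simp add: left_module_hom_def PiE_iff)
  ultimately have "G = coind_map M N f" by (intro extensionalityI)
  then show ?thesis using f by blast
qed

text \<open>Applied to the code of \<open>point_hom M u\<close> and evaluated at e, the induced map
  returns f u.\<close>

lemma coind_map_inj:
  assumes M: "left_module B M" and N: "left_module B N"
  shows "inj_on (coind_map M N) (left_module_hom B M N)"
proof (rule inj_onI)
  fix f f' assume f: "f \<in> left_module_hom B M N" and f': "f' \<in> left_module_hom B M N"
    and eq: "coind_map M N f = coind_map M N f'"
  have "f u = f' u" if u: "u \<in> carrier M" for u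
  proof -
    have p: "point_hom M u \<in> homs M" "e \<in> eA" using u by (simp_all add: point_hom_closed[OF M] phi_eA)
    show ?thesis
      using coind_map_eval[OF M N f p] coind_map_eval[OF M N f' p] eq by (simp add: point_hom_e[OF M u])
  qed
  moreover have "f \<in> extensional (carrier M)" "f' \<in> extensional (carrier M)"
    using f f' by (simp_all add: left_module_hom_def PiE_iff)
  ultimately show "f = f'" by (intro extensionalityI)
qed

theorem coind_fully_faithful:
  "fully_faithful_functor (left_module_category B) (left_module_category A)
    \<lparr>on_obj = coind, on_hom = coind_map\<rparr>"
proof -
  interpret CB: is_category "left_module_category B" by (rule is_category_left_modules)
  interpret CA: is_category "left_module_category A" by (rule is_category_left_modules)
  have [simp]: "Obj (left_module_category R) = {M. left_module R M}"
    "Hom (left_module_category R) = left_module_hom R"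
    "Ident (left_module_category R) M = (\<lambda>x \<in> carrier M. x)"
    "Comp (left_module_category R) L M N k f = compose (carrier L) k f" for R :: "'r ring" and L M N k f
    by (simp_all add: left_module_category_def)
  have "is_functor (left_module_category B) (left_module_category A) \<lparr>on_obj = coind, on_hom = coind_map\<rparr>"
  proof (unfold_locales, goal_cases)
    case (1 M)
    then show ?case by (simp add: left_module_coind)
  next
    case (2 M N f)
    then show ?case by (simp add: coind_map_closed)
  next
    case (3 M)
    then have M: "left_module B M" by simp
    have "coind_map M M (\<lambda>x \<in> carrier M. x) x = x" if x: "x \<in> carrier (coind M)" for x
    proof -
      have "(\<lambda>y \<in> eA. (\<lambda>x \<in> carrier M. x) (dec M x y)) = dec M x"
        using dec_homs[OF x] homs_extensional[OF dec_homs[OF x]]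
        by (intro extensionalityI[of _ eA]) simp_all
      then show ?thesis using x by (simp only: coind_map_def restrict_apply' enc_dec)
    qed
    then have "coind_map M M (\<lambda>x \<in> carrier M. x) = (\<lambda>x \<in> carrier (coind M). x)"
      by (intro extensionalityI[of _ "carrier (coind M)"]) (simp_all add: coind_map_def)
    then show ?case by simp
  next
    case (4 L M N f k)
    then have L: "left_module B L" and M: "left_module B M" and N: "left_module B N"
      and f: "f \<in> left_module_hom B L M" and k: "k \<in> left_module_hom B M N" by simp_all
    have *: "coind_map L N (compose (carrier L) k f) x = coind_map M N k (coind_map L M f x)"
      if x: "x \<in> carrier (coind L)" for x
    proof -
      have h: "dec L x \<in> homs L" by (rule dec_homs[OF x])
      have "coind_map L M f x = enc (\<lambda>y \<in> eA. f (dec L x y))" using x by (simp add: coind_map_def)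
      then have "coind_map M N k (coind_map L M f x) = enc (\<lambda>y \<in> eA. k ((\<lambda>y \<in> eA. f (dec L x y)) y))"
        by (simp add: coind_map_def coind_carrier compose_homs[OF f h] dec_enc[OF M])
      also have "(\<lambda>y \<in> eA. k ((\<lambda>y \<in> eA. f (dec L x y)) y)) = (\<lambda>y \<in> eA. compose (carrier L) k f (dec L x y))"
        using h by (intro restrict_ext) (simp add: compose_def)
      also have "enc \<dots> = coind_map L N (compose (carrier L) k f) x"
        unfolding coind_map_def by (rule restrict_apply'[OF x, symmetric])
      finally show ?thesis by (rule sym)
    qed
    have "coind_map L N (compose (carrier L) k f) =
        compose (carrier (coind L)) (coind_map M N k) (coind_map L M f)"
    proof (rule extensionalityI[of _ "carrier (coind L)"])
      show "coind_map L N (compose (carrier L) k f) \<in> extensional (carrier (coind L))"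
        by (simp add: coind_map_def)
    qed (simp_all add: * compose_eq compose_extensional)
    then show ?case by simp
  qed
  moreover have "full (left_module_category B) (left_module_category A) \<lparr>on_obj = coind, on_hom = coind_map\<rparr>"
    unfolding full_def using coind_map_full coind_map_closed by fastforce
  moreover have "faithful (left_module_category B) \<lparr>on_obj = coind, on_hom = coind_map\<rparr>"
    unfolding faithful_def using coind_map_inj by simp
  ultimately show ?thesis by (simp add: fully_faithful_functor_def)
qed

end

section \<open>The smaller algebra inside the larger one\<close>

section \<open>The corner of the larger algebra\<close>

context cring
begin

context
  fixes k :: nat and \<delta> \<delta>\<^sub>e \<kappa> :: 'a
  assumes par: "\<delta> \<in> carrier R" "\<delta>\<^sub>e \<in> carrier R" and unit: "\<kappa> \<in> Units R"
begin

abbreviation (input) "small \<equiv> b_prime R k \<delta> \<delta>\<^sub>e \<kappa>"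
abbreviation (input) "large \<equiv> b_prime R (Suc k) \<delta> \<kappa> \<delta>\<^sub>e"

definition corner_map :: "(diagram \<Rightarrow> 'a) \<Rightarrow> diagram \<Rightarrow> 'a" where
  "corner_map f = (\<lambda>c \<in> JB (Suc k). if c \<in> widen k ` JB k
     then inv \<kappa> \<otimes> f (inv_into (JB k) (widen k) c) else \<zero>)"

lemma kappa [simp]: "\<kappa> \<in> carrier R" "inv \<kappa> \<in> carrier R" "\<kappa> \<otimes> inv \<kappa> = \<one>" "inv \<kappa> \<otimes> \<kappa> = \<one>"
  using unit by (simp_all add: Units_closed)

text \<open>The two algebras list the same parameters in different orders, matching the exchange of
  colours.\<close>

lemmas small_par = par(1) par(2) kappa(1)
lemmas large_par = par(1) kappa(1) par(2)

lemma inj_widen: "inj_on (widen k) X"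
  by (rule inj_onI) (rule widen_inj)

lemma corner_map_widen [simp]: "d \<in> JB k \<Longrightarrow> corner_map f (widen k d) = inv \<kappa> \<otimes> f d"
  by (simp add: corner_map_def widen_JB inv_into_f_f[OF inj_widen])

lemma corner_map_outside: "c \<in> JB (Suc k) \<Longrightarrow> c \<notin> widen k ` JB k \<Longrightarrow> corner_map f c = \<zero>"
  by (simp add: corner_map_def)

lemma widen_cases:
  assumes "c \<in> JB (Suc k)"
  obtains d where "d \<in> JB k" "c = widen k d" | "c \<notin> widen k ` JB k"
  using assms by blast

lemma corner_map_closed: "f \<in> carrier small \<Longrightarrow> corner_map f \<in> carrier large"
proof -
  assume f: "f \<in> carrier small"
  have "corner_map f c \<in> carrier R" if c: "c \<in> JB (Suc k)" for c
    using c by (cases rule: widen_cases) (use f b_mem[OF small_par] corner_map_outside[OF c] in auto)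
  then show ?thesis by (auto simp: b_carrier[OF large_par] corner_map_def)
qed

text \<open>Each parameter follows its loops through the change of colour: \<open>\<kappa>\<close>
  weighs the black loops of the small algebra and the white ones of the large algebra,
  \<open>\<delta>\<^sub>e\<close> the reverse. The extra factor is the new white loop.\<close>

lemma weight_widen:
  assumes "a \<in> JB k" "b \<in> JB k"
  shows "loop_weight R (Suc k) \<delta> \<kappa> \<delta>\<^sub>e (widen k a) (widen k b) = \<kappa> \<otimes> loop_weight R k \<delta> \<delta>\<^sub>e \<kappa> a b"
  unfolding loop_weight_def loop_counts_widen[OF assms] using par by (simp add: m_ac)

lemma finsum_widen:
  assumes F: "\<And>c. c \<in> JB (Suc k) \<Longrightarrow> F c \<in> carrier R"
    and zero: "\<And>c. c \<in> JB (Suc k) \<Longrightarrow> c \<notin> widen k ` JB k \<Longrightarrow> F c = \<zero>"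
  shows "(\<Oplus>c\<in>JB (Suc k). F c) = (\<Oplus>d\<in>JB k. F (widen k d))"
proof -
  have sub: "widen k ` JB k \<subseteq> JB (Suc k)" using widen_JB by blast
  have "(\<Oplus>c\<in>JB (Suc k). F c) = (\<Oplus>c\<in>widen k ` JB k. F c)"
    using F zero sub by (intro add.finprod_mono_neutral_cong_right finite_JB) auto
  also have "\<dots> = (\<Oplus>d\<in>JB k. F (widen k d))"
    using F sub by (intro finsum_reindex inj_widen) auto
  finally show ?thesis .
qed

lemma corner_map_mult:
  assumes f: "f \<in> carrier small" and g: "g \<in> carrier small"
  shows "corner_map (f \<otimes>\<^bsub>small\<^esub> g) = corner_map f \<otimes>\<^bsub>large\<^esub> corner_map g"
proof (rule b_ext[OF large_par])
  interpret S: ring small by (rule ring_b_prime[OF small_par])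
  interpret L: ring large by (rule ring_b_prime[OF large_par])
  show "corner_map (f \<otimes>\<^bsub>small\<^esub> g) \<in> carrier large" "corner_map f \<otimes>\<^bsub>large\<^esub> corner_map g \<in> carrier large"
    using f g by (simp_all add: corner_map_closed)
  fix c assume c: "c \<in> JB (Suc k)"
  have fg [simp]: "a \<in> JB k \<Longrightarrow> f a \<in> carrier R" "a \<in> JB k \<Longrightarrow> g a \<in> carrier R" for a
    using f g b_mem[OF small_par] by auto
  have pfg [simp]: "a \<in> JB (Suc k) \<Longrightarrow> corner_map f a \<in> carrier R" "a \<in> JB (Suc k) \<Longrightarrow> corner_map g a \<in> carrier R" for a
    using corner_map_closed f g b_mem[OF large_par] by auto
  have [simp]: "loop_weight R k \<delta> \<delta>\<^sub>e \<kappa> a b \<in> carrier R" "loop_weight R (Suc k) \<delta> \<kappa> \<delta>\<^sub>e a b \<in> carrier R" for a b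
    by (rule weight_closed[OF small_par], rule weight_closed[OF large_par])
  let ?t = "\<lambda>x y. if concat_diagram (2 * Suc k) x y = c
    then corner_map f x \<otimes> corner_map g y \<otimes> loop_weight R (Suc k) \<delta> \<kappa> \<delta>\<^sub>e x y else \<zero>"
  let ?s = "\<lambda>a b. f a \<otimes> g b \<otimes> loop_weight R k \<delta> \<delta>\<^sub>e \<kappa> a b"
  have tm: "?t (widen k a) (widen k b) = (if widen k (concat_diagram (2 * k) a b) = c then inv \<kappa> \<otimes> ?s a b else \<zero>)"
    if ab: "a \<in> JB k" "b \<in> JB k" for a b
  proof -
    have "corner_map f (widen k a) \<otimes> corner_map g (widen k b) \<otimes>
        loop_weight R (Suc k) \<delta> \<kappa> \<delta>\<^sub>e (widen k a) (widen k b)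
        = (inv \<kappa> \<otimes> f a) \<otimes> (inv \<kappa> \<otimes> g b) \<otimes> (\<kappa> \<otimes> loop_weight R k \<delta> \<delta>\<^sub>e \<kappa> a b)"
      using ab by (simp add: weight_widen)
    \<comment> \<open>The two factors bring inverse \<kappa> twice and the central loop brings
      \<kappa> once. What remains is the single inverse \<kappa> carried by the image of the
      product.\<close>
    also have "\<dots> = (inv \<kappa> \<otimes> \<kappa>) \<otimes> (inv \<kappa> \<otimes> ?s a b)"
      using ab by (simp add: m_ac del: kappa(3,4))
    also have "\<dots> = inv \<kappa> \<otimes> ?s a b" using ab by simp
    finally show ?thesis unfolding concat_widen[OF ab] by simp
  qed
  have "(corner_map f \<otimes>\<^bsub>large\<^esub> corner_map g) c = (\<Oplus>x\<in>JB (Suc k). \<Oplus>y\<in>JB (Suc k). ?t x y)"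
    using f g corner_map_closed by (intro mult_eq[OF large_par _ _ c]) (simp_all add: b_carrier[OF large_par, symmetric])
  also have "\<dots> = (\<Oplus>a\<in>JB k. \<Oplus>y\<in>JB (Suc k). ?t (widen k a) y)"
  proof (rule finsum_widen)
    fix x assume x: "x \<in> JB (Suc k)" "x \<notin> widen k ` JB k"
    then have "(\<Oplus>y\<in>JB (Suc k). ?t x y) = (\<Oplus>y\<in>JB (Suc k). \<zero>)"
      by (intro finsum_cong') (auto simp: corner_map_outside)
    then show "(\<Oplus>y\<in>JB (Suc k). ?t x y) = \<zero>" by (simp add: finsum_zero)
  qed (auto intro!: finsum_closed)
  also have "\<dots> = (\<Oplus>a\<in>JB k. \<Oplus>b\<in>JB k. ?t (widen k a) (widen k b))"
    using widen_JB by (intro finsum_cong' finsum_widen) (auto intro!: finsum_closed simp: corner_map_outside)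
  also have "\<dots> = (\<Oplus>a\<in>JB k. \<Oplus>b\<in>JB k. if widen k (concat_diagram (2 * k) a b) = c then inv \<kappa> \<otimes> ?s a b else \<zero>)"
    using tm by (intro finsum_cong') (auto intro!: finsum_closed)
  also have "\<dots> = corner_map (f \<otimes>\<^bsub>small\<^esub> g) c"
    using c
  proof (cases rule: widen_cases)
    case (1 d)
    let ?r = "\<lambda>a b. if concat_diagram (2 * k) a b = d then ?s a b else \<zero>"
    have "(\<Oplus>a\<in>JB k. \<Oplus>b\<in>JB k. if widen k (concat_diagram (2 * k) a b) = c then inv \<kappa> \<otimes> ?s a b else \<zero>)
        = (\<Oplus>a\<in>JB k. \<Oplus>b\<in>JB k. inv \<kappa> \<otimes> ?r a b)"
      using 1 widen_inj by (intro finsum_cong') (auto intro!: finsum_closed)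
    also have "\<dots> = (\<Oplus>a\<in>JB k. inv \<kappa> \<otimes> (\<Oplus>b\<in>JB k. ?r a b))"
      by (intro finsum_cong' finsum_rdistr[symmetric] finite_JB) (auto intro!: finsum_closed)
    also have "\<dots> = inv \<kappa> \<otimes> (\<Oplus>a\<in>JB k. \<Oplus>b\<in>JB k. ?r a b)"
      by (intro finsum_rdistr[symmetric] finite_JB) (auto intro!: finsum_closed)
    also have "(\<Oplus>a\<in>JB k. \<Oplus>b\<in>JB k. ?r a b) = (f \<otimes>\<^bsub>small\<^esub> g) d"
      using f g 1 by (intro mult_eq[OF small_par, symmetric]) (simp_all add: b_carrier[OF small_par, symmetric])
    finally show ?thesis using 1 by simp
  next
    case 2
    then have ne: "widen k (concat_diagram (2 * k) a b) \<noteq> c" if "a \<in> JB k" "b \<in> JB k" for a b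
      using concat_JB that by blast
    have "(\<Oplus>a\<in>JB k. \<Oplus>b\<in>JB k. if widen k (concat_diagram (2 * k) a b) = c then inv \<kappa> \<otimes> ?s a b else \<zero>)
        = (\<Oplus>a\<in>JB k. \<Oplus>b\<in>JB k. \<zero>)"
      using ne by (intro finsum_cong') (auto intro!: finsum_closed)
    then show ?thesis using 2 c by (simp add: finsum_zero corner_map_outside)
  qed
  finally show "corner_map (f \<otimes>\<^bsub>small\<^esub> g) c = (corner_map f \<otimes>\<^bsub>large\<^esub> corner_map g) c" ..
qed

lemma corner_map_add:
  assumes f: "f \<in> carrier small" and g: "g \<in> carrier small"
  shows "corner_map (f \<oplus>\<^bsub>small\<^esub> g) = corner_map f \<oplus>\<^bsub>large\<^esub> corner_map g"
proof (rule b_ext[OF large_par])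
  interpret S: ring small by (rule ring_b_prime[OF small_par])
  interpret L: ring large by (rule ring_b_prime[OF large_par])
  show "corner_map (f \<oplus>\<^bsub>small\<^esub> g) \<in> carrier large" "corner_map f \<oplus>\<^bsub>large\<^esub> corner_map g \<in> carrier large"
    using f g by (simp_all add: corner_map_closed)
  fix c assume c: "c \<in> JB (Suc k)"
  then show "corner_map (f \<oplus>\<^bsub>small\<^esub> g) c = (corner_map f \<oplus>\<^bsub>large\<^esub> corner_map g) c"
  proof (cases rule: widen_cases)
    case (1 d)
    then show ?thesis
      using c f g b_mem[OF small_par] by (simp add: b_add[OF small_par] b_add[OF large_par] r_distr)
  qed (use c in \<open>simp add: b_add[OF large_par] corner_map_outside\<close>)
qed

lemma corner_map_inj: "inj_on corner_map (carrier small)"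
proof (rule inj_onI, rule b_ext[OF small_par])
  fix f g d assume fg: "f \<in> carrier small" "g \<in> carrier small" "corner_map f = corner_map g" and d: "d \<in> JB k"
  have fd: "f d \<in> carrier R" "g d \<in> carrier R" using fg d b_mem[OF small_par] by auto
  have "inv \<kappa> \<otimes> f d = inv \<kappa> \<otimes> g d" using fg(3) corner_map_widen[OF d] by metis
  then have "\<kappa> \<otimes> (inv \<kappa> \<otimes> f d) = \<kappa> \<otimes> (inv \<kappa> \<otimes> g d)" by simp
  then show "f d = g d" using fd by (simp add: m_assoc[symmetric])
qed

text \<open>A corner element is supported on diagrams with both central arcs. A concatenation
  inherits the northern arc from its upper and the southern arc from its lower factor, so terms
  contributing to any other \<open>c\<close> vanish.\<close>

lemma corner_map_supp:
  assumes f: "f \<in> carrier small" and x: "x \<in> carrier large" and c: "c \<in> JB (Suc k)"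
  shows "cup k \<notin> c \<Longrightarrow> (corner_map f \<otimes>\<^bsub>large\<^esub> x) c = \<zero>"
    and "cap k \<notin> c \<Longrightarrow> (x \<otimes>\<^bsub>large\<^esub> corner_map f) c = \<zero>"
proof -
  note mem = b_mem[OF large_par] and pf = corner_map_closed[OF f]
  have x' [simp]: "a \<in> JB (Suc k) \<Longrightarrow> x a \<in> carrier R" for a using mem[OF x] by simp
  have w [simp]: "loop_weight R (Suc k) \<delta> \<kappa> \<delta>\<^sub>e a b \<in> carrier R" for a b by (rule weight_closed[OF large_par])
  have zero: "corner_map f a = \<zero>" if "a \<in> JB (Suc k)" "cup k \<notin> a \<or> cap k \<notin> a" for a
    using that widen_cup_cap by (intro corner_map_outside) auto
  {
    assume "cup k \<notin> c"
    have "(corner_map f \<otimes>\<^bsub>large\<^esub> x) c = (\<Oplus>a\<in>JB (Suc k). \<Oplus>b\<in>JB (Suc k).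
        if concat_diagram (2 * Suc k) a b = c then corner_map f a \<otimes> x b \<otimes> loop_weight R (Suc k) \<delta> \<kappa> \<delta>\<^sub>e a b else \<zero>)"
      using x pf by (intro mult_eq[OF large_par _ _ c]) (simp_all only: b_carrier[OF large_par])
    also have "\<dots> = (\<Oplus>a\<in>JB (Suc k). \<Oplus>b\<in>JB (Suc k). \<zero>)"
    proof (intro finsum_cong' Pi_I finsum_closed zero_closed refl)
      fix a b assume ab: "a \<in> JB (Suc k)" "b \<in> JB (Suc k)"
      show "(if concat_diagram (2 * Suc k) a b = c then corner_map f a \<otimes> x b \<otimes> loop_weight R (Suc k) \<delta> \<kappa> \<delta>\<^sub>e a b else \<zero>) = \<zero>"
      proof (cases "concat_diagram (2 * Suc k) a b = c")
        case True
        then have "cup k \<notin> a" using \<open>cup k \<notin> c\<close> cup_concat by blast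
        then show ?thesis using ab zero[OF ab(1)] by simp
      qed simp
    qed
    finally show "(corner_map f \<otimes>\<^bsub>large\<^esub> x) c = \<zero>" by (simp add: finsum_zero)
  next
    assume "cap k \<notin> c"
    have "(x \<otimes>\<^bsub>large\<^esub> corner_map f) c = (\<Oplus>a\<in>JB (Suc k). \<Oplus>b\<in>JB (Suc k).
        if concat_diagram (2 * Suc k) a b = c then x a \<otimes> corner_map f b \<otimes> loop_weight R (Suc k) \<delta> \<kappa> \<delta>\<^sub>e a b else \<zero>)"
      using x pf by (intro mult_eq[OF large_par _ _ c]) (simp_all only: b_carrier[OF large_par])
    also have "\<dots> = (\<Oplus>a\<in>JB (Suc k). \<Oplus>b\<in>JB (Suc k). \<zero>)"
    proof (intro finsum_cong' Pi_I finsum_closed zero_closed refl)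
      fix a b assume ab: "a \<in> JB (Suc k)" "b \<in> JB (Suc k)"
      show "(if concat_diagram (2 * Suc k) a b = c then x a \<otimes> corner_map f b \<otimes> loop_weight R (Suc k) \<delta> \<kappa> \<delta>\<^sub>e a b else \<zero>) = \<zero>"
      proof (cases "concat_diagram (2 * Suc k) a b = c")
        case True
        then have "cap k \<notin> b" using \<open>cap k \<notin> c\<close> cap_concat by blast
        then show ?thesis using ab zero[OF ab(2)] by simp
      qed simp
    qed
    finally show "(x \<otimes>\<^bsub>large\<^esub> corner_map f) c = \<zero>" by (simp add: finsum_zero)
  }
qed

lemma corner_map_onto:
  assumes x: "x \<in> carrier large" and ex: "corner_map \<one>\<^bsub>small\<^esub> \<otimes>\<^bsub>large\<^esub> x = x"
    and xe: "x \<otimes>\<^bsub>large\<^esub> corner_map \<one>\<^bsub>small\<^esub> = x"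
  shows "x \<in> corner_map ` carrier small"
proof
  interpret S: ring small by (rule ring_b_prime[OF small_par])
  \<comment> \<open>The factor \<kappa> undoes the inverse \<kappa> built into
    \<open>corner_map\<close>.\<close>
  define f where "f = (\<lambda>d \<in> JB k. \<kappa> \<otimes> x (widen k d))"
  have xc [simp]: "c \<in> JB (Suc k) \<Longrightarrow> x c \<in> carrier R" for c using b_mem[OF large_par x] by simp
  show f: "f \<in> carrier small" by (auto simp: f_def b_carrier[OF small_par] widen_JB)
  show "x = corner_map f"
  proof (rule b_ext[OF large_par x corner_map_closed[OF f]])
    fix c assume c: "c \<in> JB (Suc k)"
    then show "x c = corner_map f c"
    proof (cases rule: widen_cases)
      case (1 d)
      then show ?thesis using c by (simp add: f_def m_assoc[symmetric])
    next
      case 2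
      \<comment> \<open>A diagram outside the range of \<open>widen\<close> lacks one of the central
        arcs. Then e x or x e vanishes there, and both are equal to x.\<close>
      then have "cup k \<notin> c \<or> cap k \<notin> c" using widen_onto[OF c] by blast
      then have "x c = \<zero>"
        using corner_map_supp[OF S.one_closed x c] ex xe by auto
      then show ?thesis using 2 c by (simp add: corner_map_outside)
    qed
  qed
qed

definition single :: "nat \<Rightarrow> 'a \<Rightarrow> diagram \<Rightarrow> diagram \<Rightarrow> 'a" where
  "single j s d = (\<lambda>c \<in> JB j. if c = d then s else \<zero>)"

lemma single_closed:
  "s \<in> carrier R \<Longrightarrow> single k s d \<in> carrier small"
  "s \<in> carrier R \<Longrightarrow> single (Suc k) s d \<in> carrier large"
  by (auto simp: single_def b_carrier[OF small_par] b_carrier[OF large_par])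

lemma one_single: "\<one>\<^bsub>small\<^esub> = single k \<one> (id_diagram (2 * k))"
  by (simp add: b_prime_def single_def)

text \<open>Scalars of K reach eA through B as multiples of its unit: the coefficient of a diagram
  may be moved into the corner element on its left. Thus spanning over K by diagrams becomes
  generation over B.\<close>

lemma scalar_action:
  assumes s: "s \<in> carrier R"
  shows "corner_map (single k s (id_diagram (2 * k))) \<otimes>\<^bsub>large\<^esub> single (Suc k) \<one> d
    = corner_map \<one>\<^bsub>small\<^esub> \<otimes>\<^bsub>large\<^esub> single (Suc k) s d" (is "?l = ?r")
proof (rule b_ext[OF large_par])
  interpret S: ring small by (rule ring_b_prime[OF small_par])
  interpret L: ring large by (rule ring_b_prime[OF large_par])
  note cl = corner_map_closed[OF single_closed(1)[OF s]] corner_map_closed[OF S.one_closed]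
    single_closed(2)[OF s] single_closed(2)[OF one_closed]
  show "?l \<in> carrier large" "?r \<in> carrier large" using cl by simp_all
  fix c assume c: "c \<in> JB (Suc k)"
  have w [simp]: "loop_weight R (Suc k) \<delta> \<kappa> \<delta>\<^sub>e a b \<in> carrier R" for a b by (rule weight_closed[OF large_par])
  have mem: "corner_map (single k s (id_diagram (2 * k))) a \<in> carrier R" "corner_map \<one>\<^bsub>small\<^esub> a \<in> carrier R"
    "single (Suc k) s d a \<in> carrier R" "single (Suc k) \<one> d a \<in> carrier R" if "a \<in> JB (Suc k)" for a
    by (rule b_mem[OF large_par cl(1) that], rule b_mem[OF large_par cl(2) that],
      rule b_mem[OF large_par cl(3) that], rule b_mem[OF large_par cl(4) that])
  have eq: "corner_map (single k s (id_diagram (2 * k))) a \<otimes> single (Suc k) \<one> d b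
      = corner_map \<one>\<^bsub>small\<^esub> a \<otimes> single (Suc k) s d b" if ab: "a \<in> JB (Suc k)" "b \<in> JB (Suc k)" for a b
    using ab(1)
  proof (cases rule: widen_cases)
    case (1 a')
    then show ?thesis using ab s by (simp add: one_single single_def m_ac)
  next
    case 2
    then show ?thesis using ab mem by (simp add: corner_map_outside)
  qed
  have "?l c = (\<Oplus>a\<in>JB (Suc k). \<Oplus>b\<in>JB (Suc k). if concat_diagram (2 * Suc k) a b = c
      then corner_map (single k s (id_diagram (2 * k))) a \<otimes> single (Suc k) \<one> d b \<otimes>
        loop_weight R (Suc k) \<delta> \<kappa> \<delta>\<^sub>e a b else \<zero>)"
    by (rule mult_eq[OF large_par _ _ c]) (use cl in \<open>simp_all only: b_carrier[OF large_par]\<close>)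
  also have "\<dots> = (\<Oplus>a\<in>JB (Suc k). \<Oplus>b\<in>JB (Suc k). if concat_diagram (2 * Suc k) a b = c
      then corner_map \<one>\<^bsub>small\<^esub> a \<otimes> single (Suc k) s d b \<otimes> loop_weight R (Suc k) \<delta> \<kappa> \<delta>\<^sub>e a b else \<zero>)"
    using eq mem by (intro finsum_cong') (auto intro!: finsum_closed)
  also have "\<dots> = ?r c"
    by (rule mult_eq[OF large_par _ _ c, symmetric]) (use cl in \<open>simp_all only: b_carrier[OF large_par]\<close>)
  finally show "?l c = ?r c" .
qed

lemma finsum_apply:
  assumes "finite T" "\<And>i. i \<in> T \<Longrightarrow> F i \<in> carrier large" and c: "c \<in> JB (Suc k)"
  shows "(\<Oplus>\<^bsub>large\<^esub>i\<in>T. F i) \<in> carrier large \<and> (\<Oplus>\<^bsub>large\<^esub>i\<in>T. F i) c = (\<Oplus>i\<in>T. F i c)"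
proof -
  interpret L: ring large by (rule ring_b_prime[OF large_par])
  show ?thesis
    using assms(1,2)
  proof (induction T)
    case empty
    have "\<zero>\<^bsub>large\<^esub> c = \<zero>" using c by (simp add: b_zero[OF large_par])
    then show ?case using L.zero_closed by (simp only: L.finsum_empty finsum_empty simp_thms)
  next
    case (insert i T)
    have "(\<Oplus>\<^bsub>large\<^esub>j\<in>insert i T. F j) = F i \<oplus>\<^bsub>large\<^esub> (\<Oplus>\<^bsub>large\<^esub>j\<in>T. F j)"
      using insert by (intro L.finsum_insert) auto
    moreover have "(\<Oplus>j\<in>insert i T. F j c) = F i c \<oplus> (\<Oplus>j\<in>T. F j c)"
      using insert c b_mem[OF large_par] by (intro finsum_insert) auto
    moreover have "(F i \<oplus>\<^bsub>large\<^esub> (\<Oplus>\<^bsub>large\<^esub>j\<in>T. F j)) c = F i c \<oplus> (\<Oplus>j\<in>T. F j c)"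
      using insert c by (simp add: b_add[OF large_par])
    moreover have "F i \<oplus>\<^bsub>large\<^esub> (\<Oplus>\<^bsub>large\<^esub>j\<in>T. F j) \<in> carrier large"
      using insert by (intro L.a_closed) auto
    ultimately show ?case by (simp only: simp_thms)
  qed
qed

lemma corner_large:
  "corner large small corner_map (JB (Suc k))
    (\<lambda>d. corner_map \<one>\<^bsub>small\<^esub> \<otimes>\<^bsub>large\<^esub> single (Suc k) \<one> d)"
proof -
  interpret S: ring small by (rule ring_b_prime[OF small_par])
  interpret L: ring large by (rule ring_b_prime[OF large_par])
  let ?e = "corner_map \<one>\<^bsub>small\<^esub>"
  have e: "?e \<in> carrier large" by (rule corner_map_closed[OF S.one_closed])
  have ee: "?e \<otimes>\<^bsub>large\<^esub> ?e = ?e" using corner_map_mult[OF S.one_closed S.one_closed] by simp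
  note sc = single_closed(2)[OF one_closed]
  show ?thesis
  proof (unfold_locales, goal_cases)
    case (1 b)
    then show ?case by (rule corner_map_closed)
  next
    case (2 b c)
    then show ?case by (rule corner_map_add)
  next
    case (3 b c)
    then show ?case by (rule corner_map_mult)
  next
    case 4
    show ?case by (rule corner_map_inj)
  next
    case (5 x)
    then show ?case by (intro corner_map_onto)
  next
    case 6
    show ?case by (rule finite_JB)
  next
    case (7 i)
    show ?case using e sc by simp
  next
    case (8 i)
    show ?case using e sc ee by (simp add: L.m_assoc[symmetric])
  next
    case (9 x)
    note x = 9(1)
    \<comment> \<open>Expanding x = e x into diagrams gives the sum of the elements e (x_d d). The
      B-coefficient of the generator e d is x_d times the identity diagram of the small
      algebra.\<close>
    let ?c = "\<lambda>d. single k (x d) (id_diagram (2 * k))"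
    have xd: "x d \<in> carrier R" if "d \<in> JB (Suc k)" for d using b_mem[OF large_par x that] .
    have "x = (\<Oplus>\<^bsub>large\<^esub>d\<in>JB (Suc k). single (Suc k) (x d) d)" (is "_ = ?sum")
    proof (rule b_ext[OF large_par x])
      show "?sum \<in> carrier large" using xd single_closed(2) by (intro L.finsum_closed) auto
      fix c assume c: "c \<in> JB (Suc k)"
      have "?sum c = (\<Oplus>d\<in>JB (Suc k). single (Suc k) (x d) d c)"
        by (rule conjunct2[OF finsum_apply[OF finite_JB _ c]]) (rule single_closed(2)[OF xd])
      also have "\<dots> = (\<Oplus>d\<in>JB (Suc k). if d = c then x d else \<zero>)"
        using xd c by (intro finsum_cong') (auto simp: single_def)
      also have "\<dots> = x c" using c xd by (intro finsum_delta finite_JB)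
      finally show "x c = ?sum c" ..
    qed
    then have "x = ?e \<otimes>\<^bsub>large\<^esub> ?sum" using 9(2) by simp
    also have "\<dots> = (\<Oplus>\<^bsub>large\<^esub>d\<in>JB (Suc k). ?e \<otimes>\<^bsub>large\<^esub> single (Suc k) (x d) d)"
      using xd single_closed(2) by (intro L.finsum_rdistr finite_JB e) auto
    also have "\<dots> = (\<Oplus>\<^bsub>large\<^esub>d\<in>JB (Suc k). corner_map (?c d) \<otimes>\<^bsub>large\<^esub> (?e \<otimes>\<^bsub>large\<^esub> single (Suc k) \<one> d))"
    proof (rule L.finsum_cong')
      show "(\<lambda>d. corner_map (?c d) \<otimes>\<^bsub>large\<^esub> (?e \<otimes>\<^bsub>large\<^esub> single (Suc k) \<one> d)) \<in> JB (Suc k) \<rightarrow> carrier large"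
        using xd e sc corner_map_closed single_closed(1) by auto
      fix d assume d: "d \<in> JB (Suc k)"
      have c: "?c d \<in> carrier small" using xd[OF d] by (rule single_closed(1))
      \<comment> \<open>Corner elements absorb e on the right, so the generators e d may replace the
        bare diagrams d.\<close>
      have "corner_map (?c d) \<otimes>\<^bsub>large\<^esub> ?e = corner_map (?c d)"
        using corner_map_mult[OF c S.one_closed] c by simp
      then have "corner_map (?c d) \<otimes>\<^bsub>large\<^esub> (?e \<otimes>\<^bsub>large\<^esub> single (Suc k) \<one> d)
          = corner_map (?c d) \<otimes>\<^bsub>large\<^esub> single (Suc k) \<one> d"
        using e sc corner_map_closed[OF c] by (simp add: L.m_assoc[symmetric])
      then show "?e \<otimes>\<^bsub>large\<^esub> single (Suc k) (x d) d
          = corner_map (?c d) \<otimes>\<^bsub>large\<^esub> (?e \<otimes>\<^bsub>large\<^esub> single (Suc k) \<one> d)"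
        using scalar_action[OF xd[OF d]] by simp
    qed simp
    finally show ?case using xd single_closed(1) by (intro bexI[of _ ?c]) auto
  qed
qed

end

end

theorem theorem5p0p5:
  fixes K :: "('k, 'z) ring_scheme"
    and \<delta> \<delta>\<^sub>e \<kappa> :: 'k
    and m :: nat
  assumes "cring K"
    and "\<delta> \<in> carrier K" and "\<delta>\<^sub>e \<in> carrier K" and "\<kappa> \<in> Units K"
    and "m \<ge> 1"
    and universe: "infinite (UNIV :: 'u set)"
  shows "\<exists>F. fully_faithful_functor
    (left_module_category (b_prime K (m - 1) \<delta> \<delta>\<^sub>e \<kappa>)
      :: ((diagram \<Rightarrow> 'k, 'u) module, 'u \<Rightarrow> 'u) category_data)
    (left_module_category (b_prime K m \<delta> \<kappa> \<delta>\<^sub>e)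
      :: ((diagram \<Rightarrow> 'k, 'u) module, 'u \<Rightarrow> 'u) category_data)
    F"
proof -
  obtain k where m: "m = Suc k" using \<open>m \<ge> 1\<close> by (cases m) auto
  \<comment> \<open>One coordinate for each generator e d with \<open>d\<close> in
    \<open>JB m\<close>; \<open>J\<close> packs them into a single element of
    \<open>'u\<close>.\<close>
  obtain J :: "(diagram \<Rightarrow> 'u) \<Rightarrow> 'u" where J: "inj_on J (JB m \<rightarrow>\<^sub>E UNIV)"
    using ex_inj_finite_power[OF universe finite_JB] by blast
  note corner = cring.corner_large[OF assms(1-4), of k]
  interpret corner_encoding "b_prime K m \<delta> \<kappa> \<delta>\<^sub>e" "b_prime K (m - 1) \<delta> \<delta>\<^sub>e \<kappa>"
    "cring.corner_map K k \<kappa>" "JB m" "\<lambda>d. cring.corner_map K k \<kappa> \<one>\<^bsub>b_prime K (m - 1) \<delta> \<delta>\<^sub>e \<kappa>\<^esub>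
      \<otimes>\<^bsub>b_prime K m \<delta> \<kappa> \<delta>\<^sub>e\<^esub> cring.single K m \<one>\<^bsub>K\<^esub> d" J
    using corner J unfolding m by (simp add: corner_encoding_def corner_encoding_axioms_def)
  show ?thesis using coind_fully_faithful by blast
qed

end
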